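(* Let $\mathsf{k}$ be a field of characteristic $p>2$, let $G=\langle g\rangle\cong\mathbb{Z}/n\mathbb{Z}$ be the cyclic group of order $n$ with $n$ divisible by $p$, and let $V$ be the two-dimensional right $\mathsf{k}G$-module with basis $\{a,b\}$ and action $a\cdot g=a$, $b\cdot g=a+b$, regarded as a Yetter--Drinfeld module over $\mathsf{k}G$ concentrated in degree $g$ (that is, $V_g=V$). Let $\mathcal{B}(V)$ be its Nichols algebra. Then the Radford biproduct $\mathcal{B}(V)\#\mathsf{k}G$ is a $p^2n$-dimensional pointed Hopf algebra generated by $a$, $b$, and $g$, with (defining) relations $$g^n=1,\quad g^{-1}ag=a,\quad g^{-1}bg=a+b,$$ $$a^p=0,\quad b^p=0,\quad ba=ab+\tfrac12a^2.$$ The coproduct is determined by $$\Delta(g)=g\otimes g,\quad \Delta(a)=a\otimes 1+g\otimes a,\quad \Delta(b)=b\otimes 1+g\otimes b.$$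
   Context: Definition of the Nichols algebra and Radford biproduct used here. Write $v_1=a$, $v_2=b$. Let $Q$ be the quiver with vertex set $G$ and, for each $0\le j\le n-1$, exactly two arrows from $g^j$ to $g^{j+1}$, denoted $a^{i}_{g^j}$ ($i=1,2$), where $a^i_{g^j}$ corresponds to $g^j\otimes v_i$ in $B=\mathsf{k}G\otimes V$. For an arrow $\alpha$, $s(\alpha)$ and $t(\alpha)$ denote its source and target. For $v=\lambda_1v_1+\lambda_2v_2\in V$ identify $h\otimes v$ with $\lambda_1a^1_h+\lambda_2a^2_h$. The group $G$ acts on the span $B$ of the arrows on the left by $l\cdot(h\otimes v)=lh\otimes v$ and on the right by $(h\otimes v)\cdot l=hl\otimes (v\cdot l)$. Let $\mathsf{k}Q$ be the path coalgebra: the vector space with basis all paths $a_m\cdots a_2a_1$ (arrows with $s(a_{j+1})=t(a_j)$; vertices are paths of length $0$), with $\Delta(h)=h\otimes h$ for $h\in G$ and $\Delta(a_m\cdots a_1)=\sum_{i=0}^m a_m\cdots a_{i+1}\otimes a_i\cdots a_1$, where the empty products for $i=m$ and $i=0$ are read as $t(a_m)$ and $s(a_1)$ respectively. $\mathsf{k}Q$ is a pointed graded Hopf algebra with the following product. For a path $\alpha$ of length $m$ and a subset $d\subseteq\{1,\dots,q\}$ of cardinality $m$, let $d\alpha=((d\alpha)_q,\dots,(d\alpha)_1)$ be the unique sequence of vertices and arrows whose concatenation is $\alpha$ and whose arrows occupy exactly the positions in $d$. For paths $\alpha,\beta$ of lengths $m,m'$, $$\alpha\cdot\beta=\sum_{d}\big[(d\alpha)_{m+m'}\cdot(\overline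 d\beta)_{m+m'}\big]\cdots\big[(d\alpha)_1\cdot(\overline d\beta)_1\big],$$ the sum being over all $m$-element subsets $d$ of $\{1,\dots,m+m'\}$, where $\overline d$ is the complement of $d$, each factor $(d\alpha)_i\cdot(\overline d\beta)_i$ is given by the left or right action of $G$ on $B$ (exactly one of the two entries is an arrow, the other a vertex), and the square brackets are concatenated as paths (extended multilinearly). For two vertices the product is the product in $G$. The Nichols algebra $\mathcal{B}(V)$ is the subalgebra of $\mathsf{k}Q$ generated by $V$, identified with the span of the arrows $a=1\otimes v_1$ and $b=1\otimes v_2$ from $1$ to $g$. The Radford biproduct (bosonization) $\mathcal{B}(V)\#\mathsf{k}G$ is the subalgebra of $\mathsf{k}Q$ generated by $V$ and $G$; as an algebra it is the smash product, i.e. $\mathsf{k}G\otimes\mathcal{B}(V)$ with multiplication $(h\otimes x)(h'\otimes y)=hh'\otimes(x\cdot h')y$, where $h\otimes x$ is abbreviated $hx$. *)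

theory Defs
  imports Complex_Main "HOL-Algebra.Generated_Groups" "HOL-Library.Poly_Mapping"
begin

section \<open>Free vector spaces and their tensor products\<close>

text \<open>
  The type \<open>'x \<Rightarrow>\<^sub>0 'k\<close> of finitely supported functions is the vector space with basis \<open>'x\<close>;
  the basis vector of \<open>x\<close> is \<open>bas x\<close>. Its tensor square is \<open>('x \<times> 'x) \<Rightarrow>\<^sub>0 'k\<close>, and for
  subspaces \<open>A\<close>, \<open>B\<close> the tensor product is the subspace \<open>tensor_space A B\<close> spanned by the
  elementary tensors (over a field the canonical map from the abstract tensor product is injective).
\<close>

definition scl :: "'k::field \<Rightarrow> ('x \<Rightarrow>\<^sub>0 'k) \<Rightarrow> ('x \<Rightarrow>\<^sub>0 'k)" where
  "scl c x = Poly_Mapping.map ((*) c) x"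

lemma lookup_scl [simp]: "Poly_Mapping.lookup (scl c x) e = c * Poly_Mapping.lookup x e"
  by (simp add: scl_def Poly_Mapping.map.rep_eq when_def)

interpretation vs: vector_space scl
  by unfold_locales (auto intro!: poly_mapping_eqI simp: lookup_add algebra_simps)

definition bas :: "'x \<Rightarrow> ('x \<Rightarrow>\<^sub>0 'k::field)" where
  "bas x = Poly_Mapping.single x 1"

definition lin_ext :: "('x \<Rightarrow> ('y \<Rightarrow>\<^sub>0 'k::field)) \<Rightarrow> ('x \<Rightarrow>\<^sub>0 'k) \<Rightarrow> ('y \<Rightarrow>\<^sub>0 'k)" where
  "lin_ext f x = (\<Sum>e\<in>Poly_Mapping.keys x. scl (Poly_Mapping.lookup x e) (f e))"

definition bilin_ext ::
    "('x \<Rightarrow> 'y \<Rightarrow> ('z \<Rightarrow>\<^sub>0 'k::field)) \<Rightarrow> ('x \<Rightarrow>\<^sub>0 'k) \<Rightarrow> ('y \<Rightarrow>\<^sub>0 'k) \<Rightarrow> ('z \<Rightarrow>\<^sub>0 'k)" where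
  "bilin_ext f x y = lin_ext (\<lambda>e. lin_ext (f e) y) x"

definition tens :: "('x \<Rightarrow>\<^sub>0 'k::field) \<Rightarrow> ('y \<Rightarrow>\<^sub>0 'k) \<Rightarrow> (('x \<times> 'y) \<Rightarrow>\<^sub>0 'k)"  (infixr \<open>\<boxtimes>\<close> 75) where
  "x \<boxtimes> y = bilin_ext (\<lambda>e f. bas (e, f)) x y"

definition tensor_space :: "('x \<Rightarrow>\<^sub>0 'k::field) set \<Rightarrow> ('y \<Rightarrow>\<^sub>0 'k) set \<Rightarrow> (('x \<times> 'y) \<Rightarrow>\<^sub>0 'k) set" where
  "tensor_space A B = vs.span {x \<boxtimes> y |x y. x \<in> A \<and> y \<in> B}"

definition tens_map :: "(('x \<Rightarrow>\<^sub>0 'k::field) \<Rightarrow> ('u \<Rightarrow>\<^sub>0 'k)) \<Rightarrow> (('y \<Rightarrow>\<^sub>0 'k) \<Rightarrow> ('v \<Rightarrow>\<^sub>0 'k)) \<Rightarrow>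
    (('x \<times> 'y) \<Rightarrow>\<^sub>0 'k) \<Rightarrow> (('u \<times> 'v) \<Rightarrow>\<^sub>0 'k)" where
  "tens_map f h = lin_ext (\<lambda>(x, y). f (bas x) \<boxtimes> h (bas y))"

definition tens_assoc :: "((('x \<times> 'y) \<times> 'z) \<Rightarrow>\<^sub>0 'k::field) \<Rightarrow> (('x \<times> 'y \<times> 'z) \<Rightarrow>\<^sub>0 'k)" where
  "tens_assoc = lin_ext (\<lambda>((x, y), z). bas (x, y, z))"

section \<open>Algebras, coalgebras and Hopf algebras\<close>

text \<open>
  All structures live on a subspace \<open>H\<close> of a free vector space. The structure maps are
  (bi)linear on the ambient space and restrict to \<open>H\<close>; the axioms are only required on \<open>H\<close>.
  Up to isomorphism this is no restriction: every vector space has a basis, and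
  every linear map on a subspace extends.
\<close>

definition subalgebra :: "(('x \<Rightarrow>\<^sub>0 'k::field) \<Rightarrow> ('x \<Rightarrow>\<^sub>0 'k) \<Rightarrow> ('x \<Rightarrow>\<^sub>0 'k)) \<Rightarrow> ('x \<Rightarrow>\<^sub>0 'k) \<Rightarrow>
    ('x \<Rightarrow>\<^sub>0 'k) set \<Rightarrow> bool" where
  "subalgebra mul u A \<longleftrightarrow> vs.subspace A \<and> u \<in> A \<and> (\<forall>x\<in>A. \<forall>y\<in>A. mul x y \<in> A)"

definition algebra_on :: "('x \<Rightarrow>\<^sub>0 'k::field) set \<Rightarrow>
    (('x \<Rightarrow>\<^sub>0 'k) \<Rightarrow> ('x \<Rightarrow>\<^sub>0 'k) \<Rightarrow> ('x \<Rightarrow>\<^sub>0 'k)) \<Rightarrow> ('x \<Rightarrow>\<^sub>0 'k) \<Rightarrow> bool" where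
  "algebra_on H mul u \<longleftrightarrow>
     (\<forall>x. Vector_Spaces.linear scl scl (mul x)) \<and>
     (\<forall>y. Vector_Spaces.linear scl scl (\<lambda>x. mul x y)) \<and>
     subalgebra mul u H \<and>
     (\<forall>x\<in>H. \<forall>y\<in>H. \<forall>z\<in>H. mul (mul x y) z = mul x (mul y z)) \<and>
     (\<forall>x\<in>H. mul u x = x \<and> mul x u = x)"

definition coalgebra_on :: "('x \<Rightarrow>\<^sub>0 'k::field) set \<Rightarrow>
    (('x \<Rightarrow>\<^sub>0 'k) \<Rightarrow> (('x \<times> 'x) \<Rightarrow>\<^sub>0 'k)) \<Rightarrow> (('x \<Rightarrow>\<^sub>0 'k) \<Rightarrow> 'k) \<Rightarrow> bool" where
  "coalgebra_on H \<Delta> \<epsilon> \<longleftrightarrow>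
     vs.subspace H \<and>
     Vector_Spaces.linear scl scl \<Delta> \<and> Vector_Spaces.linear scl (*) \<epsilon> \<and>
     \<Delta> ` H \<subseteq> tensor_space H H \<and>
     (\<forall>h\<in>H. tens_assoc (tens_map \<Delta> id (\<Delta> h)) = tens_map id \<Delta> (\<Delta> h)) \<and>
     (\<forall>h\<in>H. lin_ext (\<lambda>(x, y). scl (\<epsilon> (bas x)) (bas y)) (\<Delta> h) = h) \<and>
     (\<forall>h\<in>H. lin_ext (\<lambda>(x, y). scl (\<epsilon> (bas y)) (bas x)) (\<Delta> h) = h)"

text \<open>The componentwise product on the tensor square, and the multiplication as a map
  on the tensor square.\<close>

definition tens_mul :: "(('x \<Rightarrow>\<^sub>0 'k::field) \<Rightarrow> ('x \<Rightarrow>\<^sub>0 'k) \<Rightarrow> ('x \<Rightarrow>\<^sub>0 'k)) \<Rightarrow>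
    (('x \<times> 'x) \<Rightarrow>\<^sub>0 'k) \<Rightarrow> (('x \<times> 'x) \<Rightarrow>\<^sub>0 'k) \<Rightarrow> (('x \<times> 'x) \<Rightarrow>\<^sub>0 'k)" where
  "tens_mul mul =
     bilin_ext (\<lambda>(x, y) (x', y'). mul (bas x) (bas x') \<boxtimes> mul (bas y) (bas y'))"

definition mul_map :: "(('x \<Rightarrow>\<^sub>0 'k::field) \<Rightarrow> ('x \<Rightarrow>\<^sub>0 'k) \<Rightarrow> ('x \<Rightarrow>\<^sub>0 'k)) \<Rightarrow>
    (('x \<times> 'x) \<Rightarrow>\<^sub>0 'k) \<Rightarrow> ('x \<Rightarrow>\<^sub>0 'k)" where
  "mul_map mul = lin_ext (\<lambda>(x, y). mul (bas x) (bas y))"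

definition algebra_hom :: "('x \<Rightarrow>\<^sub>0 'k::field) set \<Rightarrow>
    (('x \<Rightarrow>\<^sub>0 'k) \<Rightarrow> ('x \<Rightarrow>\<^sub>0 'k) \<Rightarrow> ('x \<Rightarrow>\<^sub>0 'k)) \<Rightarrow> ('x \<Rightarrow>\<^sub>0 'k) \<Rightarrow>
    ('y \<Rightarrow>\<^sub>0 'k) set \<Rightarrow>
    (('y \<Rightarrow>\<^sub>0 'k) \<Rightarrow> ('y \<Rightarrow>\<^sub>0 'k) \<Rightarrow> ('y \<Rightarrow>\<^sub>0 'k)) \<Rightarrow> ('y \<Rightarrow>\<^sub>0 'k) \<Rightarrow>
    (('x \<Rightarrow>\<^sub>0 'k) \<Rightarrow> ('y \<Rightarrow>\<^sub>0 'k)) \<Rightarrow> bool" where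
  "algebra_hom A mA uA B mB uB f \<longleftrightarrow>
     f ` A \<subseteq> B \<and>
     (\<forall>x\<in>A. \<forall>y\<in>A. f (x + y) = f x + f y) \<and>
     (\<forall>c. \<forall>x\<in>A. f (scl c x) = scl c (f x)) \<and>
     (\<forall>x\<in>A. \<forall>y\<in>A. f (mA x y) = mB (f x) (f y)) \<and>
     f uA = uB"

definition hopf_algebra_on :: "('x \<Rightarrow>\<^sub>0 'k::field) set \<Rightarrow>
    (('x \<Rightarrow>\<^sub>0 'k) \<Rightarrow> ('x \<Rightarrow>\<^sub>0 'k) \<Rightarrow> ('x \<Rightarrow>\<^sub>0 'k)) \<Rightarrow> ('x \<Rightarrow>\<^sub>0 'k) \<Rightarrow>
    (('x \<Rightarrow>\<^sub>0 'k) \<Rightarrow> (('x \<times> 'x) \<Rightarrow>\<^sub>0 'k)) \<Rightarrow> (('x \<Rightarrow>\<^sub>0 'k) \<Rightarrow> 'k) \<Rightarrow> bool" where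
  "hopf_algebra_on H mul u \<Delta> \<epsilon> \<longleftrightarrow>
     algebra_on H mul u \<and> coalgebra_on H \<Delta> \<epsilon> \<and>
     algebra_hom H mul u (tensor_space H H) (tens_mul mul) (u \<boxtimes> u) \<Delta> \<and>
     (\<forall>x\<in>H. \<forall>y\<in>H. \<epsilon> (mul x y) = \<epsilon> x * \<epsilon> y) \<and> \<epsilon> u = 1 \<and>
     (\<exists>S. Vector_Spaces.linear scl scl S \<and> S ` H \<subseteq> H \<and>
        (\<forall>h\<in>H. mul_map mul (tens_map S id (\<Delta> h)) = scl (\<epsilon> h) u \<and>
               mul_map mul (tens_map id S (\<Delta> h)) = scl (\<epsilon> h) u))"

definition subcoalgebra :: "(('x \<Rightarrow>\<^sub>0 'k::field) \<Rightarrow> (('x \<times> 'x) \<Rightarrow>\<^sub>0 'k)) \<Rightarrow> ('x \<Rightarrow>\<^sub>0 'k) set \<Rightarrow> bool" where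
  "subcoalgebra \<Delta> C \<longleftrightarrow> vs.subspace C \<and> \<Delta> ` C \<subseteq> tensor_space C C"

definition simple_subcoalgebra ::
    "(('x \<Rightarrow>\<^sub>0 'k::field) \<Rightarrow> (('x \<times> 'x) \<Rightarrow>\<^sub>0 'k)) \<Rightarrow> ('x \<Rightarrow>\<^sub>0 'k) set \<Rightarrow> bool" where
  "simple_subcoalgebra \<Delta> C \<longleftrightarrow> subcoalgebra \<Delta> C \<and> C \<noteq> {0} \<and>
     (\<forall>D. subcoalgebra \<Delta> D \<and> D \<subseteq> C \<longrightarrow> D = {0} \<or> D = C)"

definition pointed :: "('x \<Rightarrow>\<^sub>0 'k::field) set \<Rightarrow> (('x \<Rightarrow>\<^sub>0 'k) \<Rightarrow> (('x \<times> 'x) \<Rightarrow>\<^sub>0 'k)) \<Rightarrow> bool" where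
  "pointed H \<Delta> \<longleftrightarrow> (\<forall>C. C \<subseteq> H \<and> simple_subcoalgebra \<Delta> C \<longrightarrow> vs.dim C = 1)"

section \<open>Free algebras and presentations\<close>

text \<open>The free algebra on \<open>'i\<close> has the words over \<open>'i\<close> as basis and concatenation as product.\<close>

definition free_mul :: "('i list \<Rightarrow>\<^sub>0 'k::field) \<Rightarrow> ('i list \<Rightarrow>\<^sub>0 'k) \<Rightarrow> ('i list \<Rightarrow>\<^sub>0 'k)" where
  "free_mul = bilin_ext (\<lambda>v w. bas (v @ w))"

definition two_sided_ideal :: "('i list \<Rightarrow>\<^sub>0 'k::field) set \<Rightarrow> bool" where
  "two_sided_ideal I \<longleftrightarrow> vs.subspace I \<and> (\<forall>x\<in>I. \<forall>y. free_mul x y \<in> I \<and> free_mul y x \<in> I)"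

definition free_eval :: "(('x \<Rightarrow>\<^sub>0 'k::field) \<Rightarrow> ('x \<Rightarrow>\<^sub>0 'k) \<Rightarrow> ('x \<Rightarrow>\<^sub>0 'k)) \<Rightarrow> ('x \<Rightarrow>\<^sub>0 'k) \<Rightarrow>
    ('i \<Rightarrow> ('x \<Rightarrow>\<^sub>0 'k)) \<Rightarrow> ('i list \<Rightarrow>\<^sub>0 'k) \<Rightarrow> ('x \<Rightarrow>\<^sub>0 'k)" where
  "free_eval mul u val = lin_ext (\<lambda>w. foldr (\<lambda>i x. mul (val i) x) w u)"

text \<open>\<open>H\<close> is the quotient of the free algebra on \<open>'i\<close> by the ideal generated by \<open>R\<close>, via
  \<open>i \<mapsto> val i\<close>.\<close>

definition presented_by :: "('x \<Rightarrow>\<^sub>0 'k::field) set \<Rightarrow>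
    (('x \<Rightarrow>\<^sub>0 'k) \<Rightarrow> ('x \<Rightarrow>\<^sub>0 'k) \<Rightarrow> ('x \<Rightarrow>\<^sub>0 'k)) \<Rightarrow> ('x \<Rightarrow>\<^sub>0 'k) \<Rightarrow>
    ('i \<Rightarrow> ('x \<Rightarrow>\<^sub>0 'k)) \<Rightarrow> ('i list \<Rightarrow>\<^sub>0 'k) set \<Rightarrow> bool" where
  "presented_by H mul u val R \<longleftrightarrow>
     free_eval mul u val ` UNIV = H \<and>
     {x. free_eval mul u val x = 0} = two_sided_ideal hull R"

section \<open>The path Hopf algebra of the quiver\<close>

text \<open>\<open>V\<close> is the free vector space on the two-element type \<open>vbasis\<close>, with \<open>a = bas Va\<close> and
  \<open>b = bas Vb\<close>.\<close>

datatype vbasis = Va | Vb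

definition right_module :: "('g, 'm) monoid_scheme \<Rightarrow>
    (('i \<Rightarrow>\<^sub>0 'k::field) \<Rightarrow> 'g \<Rightarrow> ('i \<Rightarrow>\<^sub>0 'k)) \<Rightarrow> bool" where
  "right_module G act \<longleftrightarrow>
     (\<forall>l\<in>carrier G. Vector_Spaces.linear scl scl (\<lambda>v. act v l)) \<and>
     (\<forall>v. act v \<one>\<^bsub>G\<^esub> = v) \<and>
     (\<forall>v. \<forall>l\<in>carrier G. \<forall>l'\<in>carrier G. act v (l \<otimes>\<^bsub>G\<^esub> l') = act (act v l) l')"

text \<open>
  The pair \<open>(h, i)\<close> is the arrow \<open>h \<otimes> v\<^sub>i\<close>, which starts at \<open>h\<close> and ends at \<open>hg\<close>. The path
  \<open>a\<^sub>m \<cdots> a\<^sub>1\<close> is the pair of its initial vertex and the list \<open>[a\<^sub>1, \<dots>, a\<^sub>m]\<close> of its arrows in order of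
  traversal, so lists read from left to right what the usual notation writes from right to left.
  Vertices are the paths \<open>(h, [])\<close>.
\<close>

type_synonym 'g arrow = "'g \<times> vbasis"
type_synonym 'g path = "'g \<times> 'g arrow list"

definition source :: "'g arrow \<Rightarrow> 'g" where
  "source \<alpha> = fst \<alpha>"

definition target :: "('g, 'm) monoid_scheme \<Rightarrow> 'g \<Rightarrow> 'g arrow \<Rightarrow> 'g" where
  "target G g \<alpha> = fst \<alpha> \<otimes>\<^bsub>G\<^esub> g"

text \<open>The vertex reached after the first \<open>k\<close> arrows.\<close>

definition vertex_at :: "('g, 'm) monoid_scheme \<Rightarrow> 'g \<Rightarrow> 'g path \<Rightarrow> nat \<Rightarrow> 'g" where
  "vertex_at G g \<alpha> k = (if k = 0 then fst \<alpha> else target G g (snd \<alpha> ! (k - 1)))"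

definition paths :: "('g, 'm) monoid_scheme \<Rightarrow> 'g \<Rightarrow> 'g path set" where
  "paths G g = {\<alpha>. fst \<alpha> \<in> carrier G \<and>
     (\<forall>k < length (snd \<alpha>). source (snd \<alpha> ! k) \<in> carrier G \<and>
        source (snd \<alpha> ! k) = vertex_at G g \<alpha> k)}"

definition kQ :: "('g, 'm) monoid_scheme \<Rightarrow> 'g \<Rightarrow> ('g path \<Rightarrow>\<^sub>0 'k::field) set" where
  "kQ G g = {x. Poly_Mapping.keys x \<subseteq> paths G g}"

definition kQ_comult :: "('g, 'm) monoid_scheme \<Rightarrow> 'g \<Rightarrow>
    ('g path \<Rightarrow>\<^sub>0 'k::field) \<Rightarrow> (('g path \<times> 'g path) \<Rightarrow>\<^sub>0 'k)" where
  "kQ_comult G g = lin_ext (\<lambda>\<alpha>. \<Sum>i\<le>length (snd \<alpha>).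
     bas ((vertex_at G g \<alpha> i, drop i (snd \<alpha>)), (fst \<alpha>, take i (snd \<alpha>))))"

definition kQ_counit :: "('g path \<Rightarrow>\<^sub>0 'k::field) \<Rightarrow> 'k" where
  "kQ_counit x = (\<Sum>\<alpha>\<in>Poly_Mapping.keys x.
     Poly_Mapping.lookup x \<alpha> * (if snd \<alpha> = [] then 1 else 0))"

datatype 'g entry = Vertex 'g | Arrow "'g arrow"

text \<open>The entry \<open>(d\<alpha>)\<^sub>i\<close> of the thin splitting of \<open>\<alpha>\<close> along the set \<open>d\<close> of (1-based) positions:
  before position \<open>i\<close> exactly \<open>card (d \<inter> {1..<i})\<close> arrows of \<open>\<alpha>\<close> have been used.\<close>

definition split_entry :: "('g, 'm) monoid_scheme \<Rightarrow> 'g \<Rightarrow> nat set \<Rightarrow> 'g path \<Rightarrow> nat \<Rightarrow> 'g entry" where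
  "split_entry G g d \<alpha> i =
     (let k = card (d \<inter> {1..<i})
      in if i \<in> d then Arrow (snd \<alpha> ! k) else Vertex (vertex_at G g \<alpha> k))"

text \<open>The bimodule action of \<open>G\<close> on the span of the arrows. The last two cases never occur in the
  product of paths.\<close>

fun bracket :: "('g, 'm) monoid_scheme \<Rightarrow> ((vbasis \<Rightarrow>\<^sub>0 'k::field) \<Rightarrow> 'g \<Rightarrow> (vbasis \<Rightarrow>\<^sub>0 'k)) \<Rightarrow>
    'g entry \<Rightarrow> 'g entry \<Rightarrow> ('g arrow \<Rightarrow>\<^sub>0 'k)" where
  "bracket G act (Vertex l) (Arrow (h, i)) = bas (l \<otimes>\<^bsub>G\<^esub> h, i)"
| "bracket G act (Arrow (h, i)) (Vertex l) = lin_ext (\<lambda>j. bas (h \<otimes>\<^bsub>G\<^esub> l, j)) (act (bas i) l)"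
| "bracket G act (Vertex _) (Vertex _) = 0"
| "bracket G act (Arrow _) (Arrow _) = 0"

text \<open>Multilinear extension of the formation of lists of arrows.\<close>

fun multi_list :: "('e \<Rightarrow>\<^sub>0 'k::field) list \<Rightarrow> ('e list \<Rightarrow>\<^sub>0 'k)" where
  "multi_list [] = bas []"
| "multi_list (x # xs) = bilin_ext (\<lambda>e w. bas (e # w)) x (multi_list xs)"

text \<open>Every path in the product of \<open>\<alpha>\<close> and \<open>\<beta>\<close> starts at the product of their initial vertices;
  for two vertices this initial vertex is the whole product.\<close>

definition path_mul :: "('g, 'm) monoid_scheme \<Rightarrow> 'g \<Rightarrow>
    ((vbasis \<Rightarrow>\<^sub>0 'k::field) \<Rightarrow> 'g \<Rightarrow> (vbasis \<Rightarrow>\<^sub>0 'k)) \<Rightarrow> 'g path \<Rightarrow> 'g path \<Rightarrow> ('g path \<Rightarrow>\<^sub>0 'k)" where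
  "path_mul G g act \<alpha> \<beta> =
     (let m = length (snd \<alpha>); q = m + length (snd \<beta>)
      in \<Sum>d | d \<subseteq> {1..q} \<and> card d = m.
           lin_ext (\<lambda>w. bas (fst \<alpha> \<otimes>\<^bsub>G\<^esub> fst \<beta>, w))
             (multi_list (map (\<lambda>i. bracket G act (split_entry G g d \<alpha> i)
                                  (split_entry G g ({1..q} - d) \<beta> i)) [1..<q+1])))"

definition kQ_mul :: "('g, 'm) monoid_scheme \<Rightarrow> 'g \<Rightarrow>
    ((vbasis \<Rightarrow>\<^sub>0 'k::field) \<Rightarrow> 'g \<Rightarrow> (vbasis \<Rightarrow>\<^sub>0 'k)) \<Rightarrow>
    ('g path \<Rightarrow>\<^sub>0 'k) \<Rightarrow> ('g path \<Rightarrow>\<^sub>0 'k) \<Rightarrow> ('g path \<Rightarrow>\<^sub>0 'k)" where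
  "kQ_mul G g act = bilin_ext (path_mul G g act)"

definition vert :: "'g \<Rightarrow> ('g path \<Rightarrow>\<^sub>0 'k::field)" where
  "vert h = bas (h, [])"

definition arr :: "'g \<Rightarrow> vbasis \<Rightarrow> ('g path \<Rightarrow>\<^sub>0 'k::field)" where
  "arr h i = bas (h, [(h, i)])"

definition kQ_pow :: "('g, 'm) monoid_scheme \<Rightarrow> 'g \<Rightarrow>
    ((vbasis \<Rightarrow>\<^sub>0 'k::field) \<Rightarrow> 'g \<Rightarrow> (vbasis \<Rightarrow>\<^sub>0 'k)) \<Rightarrow>
    ('g path \<Rightarrow>\<^sub>0 'k) \<Rightarrow> nat \<Rightarrow> ('g path \<Rightarrow>\<^sub>0 'k)" where
  "kQ_pow G g act x r = (kQ_mul G g act x ^^ r) (vert \<one>\<^bsub>G\<^esub>)"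

section \<open>The Nichols algebra and its Radford biproduct\<close>

definition generated_subalgebra :: "('g, 'm) monoid_scheme \<Rightarrow> 'g \<Rightarrow>
    ((vbasis \<Rightarrow>\<^sub>0 'k::field) \<Rightarrow> 'g \<Rightarrow> (vbasis \<Rightarrow>\<^sub>0 'k)) \<Rightarrow>
    ('g path \<Rightarrow>\<^sub>0 'k) set \<Rightarrow> ('g path \<Rightarrow>\<^sub>0 'k) set" where
  "generated_subalgebra G g act X =
     (\<lambda>A. A \<subseteq> kQ G g \<and> subalgebra (kQ_mul G g act) (vert \<one>\<^bsub>G\<^esub>) A) hull X"

definition V_in_kQ :: "('g, 'm) monoid_scheme \<Rightarrow> ('g path \<Rightarrow>\<^sub>0 'k::field) set" where
  "V_in_kQ G = vs.span {arr \<one>\<^bsub>G\<^esub> Va, arr \<one>\<^bsub>G\<^esub> Vb}"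

definition nichols_algebra :: "('g, 'm) monoid_scheme \<Rightarrow> 'g \<Rightarrow>
    ((vbasis \<Rightarrow>\<^sub>0 'k::field) \<Rightarrow> 'g \<Rightarrow> (vbasis \<Rightarrow>\<^sub>0 'k)) \<Rightarrow> ('g path \<Rightarrow>\<^sub>0 'k) set" where
  "nichols_algebra G g act = generated_subalgebra G g act (V_in_kQ G)"

definition radford_biproduct :: "('g, 'm) monoid_scheme \<Rightarrow> 'g \<Rightarrow>
    ((vbasis \<Rightarrow>\<^sub>0 'k::field) \<Rightarrow> 'g \<Rightarrow> (vbasis \<Rightarrow>\<^sub>0 'k)) \<Rightarrow> ('g path \<Rightarrow>\<^sub>0 'k) set" where
  "radford_biproduct G g act = generated_subalgebra G g act (V_in_kQ G \<union> vert ` carrier G)"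

lemma radford_biproduct_eq:
  "radford_biproduct G g act =
     generated_subalgebra G g act (nichols_algebra G g act \<union> vert ` carrier G)"
  unfolding radford_biproduct_def nichols_algebra_def generated_subalgebra_def
  by (metis hull_Un_left)

section \<open>The presentation\<close>

datatype generator = Xa | Xb | Xg

fun gen_val :: "('g, 'm) monoid_scheme \<Rightarrow> 'g \<Rightarrow> generator \<Rightarrow> ('g path \<Rightarrow>\<^sub>0 'k::field)" where
  "gen_val G g Xa = arr \<one>\<^bsub>G\<^esub> Va"
| "gen_val G g Xb = arr \<one>\<^bsub>G\<^esub> Vb"
| "gen_val G g Xg = vert g"

text \<open>The relators of \<open>g\<^sup>n = 1\<close>, \<open>g\<^sup>-\<^sup>1 a g = a\<close>, \<open>g\<^sup>-\<^sup>1 b g = a + b\<close>, \<open>a\<^sup>p = 0\<close>, \<open>b\<^sup>p = 0\<close> and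
  \<open>b a = a b + 1/2 a\<^sup>2\<close>. In view of the first one, \<open>g\<^sup>-\<^sup>1\<close> stands for the word \<open>g\<^sup>n\<^sup>-\<^sup>1\<close>.\<close>

definition relators :: "nat \<Rightarrow> nat \<Rightarrow> (generator list \<Rightarrow>\<^sub>0 'k::field) set" where
  "relators n p =
    {bas (replicate n Xg) - bas [],
     bas (replicate (n - 1) Xg @ [Xa, Xg]) - bas [Xa],
     bas (replicate (n - 1) Xg @ [Xb, Xg]) - (bas [Xa] + bas [Xb]),
     bas (replicate p Xa),
     bas (replicate p Xb),
     bas [Xb, Xa] - (bas [Xa, Xb] + scl (1/2) (bas [Xa, Xa]))}"

end

theory Submission
  imports Defs "HOL-Algebra.Multiplicative_Group"
begin

text \<open>
  The products in the path Hopf algebra are controlled by removing the first arrow of a path: the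
  operators \<open>strip Va\<close>, \<open>strip Vb\<close> obey Leibniz rules twisted by the action of \<open>G\<close>, and an element of
  \<open>kQ\<close> is determined by its two strips and its part of length zero. Associativity, the
  multiplicativity of \<open>\<Delta>\<close> (strip the right tensor leg) and the relations, \<open>b\<^sup>p = 0\<close> included, follow by
  induction on length. Iterated strips pair the elements \<open>g\<^sup>c a\<^sup>i b\<^sup>j\<close> diagonally with the values \<open>i! j!\<close>,
  which are invertible for \<open>i, j < p\<close>; as the relations reduce every word to this normal form,
  dimension and presentation follow at once. The antipode is defined on all of \<open>kQ\<close> by recursion on
  length; since convolution by the identity is cancellative, it reverses products with generators and
  therefore preserves the biproduct.
\<close>

text \<open>The first arrow is the right one to remove because position 1 of a product carries it.
  Either the first arrow of the left factor stands there, acted on from the right by the start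
  vertex h of the other factor, or the first arrow of the right factor, merely translated by a
  vertex. Since h sends b to b + shift(h) a, \<open>strip Vb\<close> is an ordinary derivation,
  while \<open>strip Va\<close> picks up the extra term \<open>strip Vb x \<star> weight y\<close>.
  In the coproduct the initial segments form the right leg, which is why strips act on that leg.

  The delicate relation is b^p = 0. As b commutes neither with the grouplike g nor with a,
  \<open>strip Vb\<close> of b^(j+1) is not simply (j+1) g b^j; the recursion has to carry a
  correction by a half of a times the previous strip, and only in that form does the factor j+1
  appear.

  The recursion for the antipode yields only the left convolution identity. The right one is carried
  from the unit along left multiplication by generators.\<close>

abbreviation lin :: "(('x \<Rightarrow>\<^sub>0 'k::field) \<Rightarrow> ('y \<Rightarrow>\<^sub>0 'k)) \<Rightarrow> bool" where
  "lin \<equiv> Vector_Spaces.linear scl scl"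

abbreviation supp :: "'x set \<Rightarrow> ('x \<Rightarrow>\<^sub>0 'k::field) set" where
  "supp S \<equiv> {x. Poly_Mapping.keys x \<subseteq> S}"

section \<open>Linear maps between free vector spaces\<close>

lemma lin_iff: "lin f \<longleftrightarrow> (\<forall>x y. f (x + y) = f x + f y) \<and> (\<forall>c x. f (scl c x) = scl c (f x))"
  by (simp add: Vector_Spaces.linear_iff vs.vector_space_axioms)

lemma linI:
  "\<lbrakk>\<And>x y. f (x + y) = f x + f y; \<And>c x. f (scl c x) = scl c (f x)\<rbrakk> \<Longrightarrow> lin f"
  by (simp add: lin_iff)

lemma lin_add: "lin f \<Longrightarrow> f (x + y) = f x + f y"
  and lin_scl: "lin f \<Longrightarrow> f (scl c x) = scl c (f x)"
  by (simp_all add: lin_iff)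

lemma lin_zero: assumes "lin f" shows "f 0 = 0"
  using lin_scl[OF assms, of 0 0] by (simp only: vs.scale_zero_left)

lemma lin_neg: assumes "lin f" shows "f (- x) = - f x"
  using lin_scl[OF assms, of "- 1" x] by (simp only: vs.scale_minus_left vs.scale_one)

lemma lin_diff: assumes "lin f" shows "f (x - y) = f x - f y"
  using lin_add[OF assms, of x "- y"] by (simp only: lin_neg[OF assms] diff_conv_add_uminus)

lemma lin_sum: assumes "lin f" shows "f (sum h A) = (\<Sum>i\<in>A. f (h i))"
  by (induction A rule: infinite_finite_induct) (auto simp: lin_zero[OF assms] lin_add[OF assms])

lemma lin_id [simp]: "lin id" "lin (\<lambda>x. x)"
  by (simp_all add: lin_iff)

lemma lin_0 [simp]: "lin (\<lambda>x. 0)"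
  by (simp add: lin_iff)

lemma lin_comp: "lin f \<Longrightarrow> lin h \<Longrightarrow> lin (\<lambda>x. f (h x))"
  by (simp add: lin_iff)

lemma lin_plus: "lin f \<Longrightarrow> lin h \<Longrightarrow> lin (\<lambda>x. f x + h x)"
  by (simp add: lin_iff vs.scale_right_distrib algebra_simps)

lemma lin_minus: "lin f \<Longrightarrow> lin h \<Longrightarrow> lin (\<lambda>x. f x - h x)"
  by (simp add: lin_iff vs.scale_right_diff_distrib algebra_simps)

lemma lin_scale: "lin f \<Longrightarrow> lin (\<lambda>x. scl c (f x))"
  by (simp add: lin_iff vs.scale_right_distrib mult.commute)

section \<open>Linear extension\<close>

lemma lin_ext_superset:
  assumes "finite S" "Poly_Mapping.keys x \<subseteq> S"
  shows "lin_ext f x = (\<Sum>e\<in>S. scl (Poly_Mapping.lookup x e) (f e))"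
  unfolding lin_ext_def using assms
  by (intro sum.mono_neutral_left) (auto simp: in_keys_iff)

lemma lin_lin_ext [simp]: "lin (lin_ext f)" for f :: "'x \<Rightarrow> ('y \<Rightarrow>\<^sub>0 'k::field)"
proof (rule linI)
  fix x y :: "'x \<Rightarrow>\<^sub>0 'k"
  let ?S = "Poly_Mapping.keys x \<union> Poly_Mapping.keys y"
  have "lin_ext f (x + y) = (\<Sum>e\<in>?S. scl (Poly_Mapping.lookup (x + y) e) (f e))"
    by (rule lin_ext_superset) (simp_all add: Poly_Mapping.keys_add)
  also have "\<dots> = lin_ext f x + lin_ext f y"
    by (simp add: lin_ext_superset[of ?S x] lin_ext_superset[of ?S y] lookup_add
        vs.scale_left_distrib sum.distrib)
  finally show "lin_ext f (x + y) = lin_ext f x + lin_ext f y" .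
next
  fix c and x :: "'x \<Rightarrow>\<^sub>0 'k"
  have "Poly_Mapping.keys (scl c x) \<subseteq> Poly_Mapping.keys x"
    by (auto simp: in_keys_iff)
  then show "lin_ext f (scl c x) = scl c (lin_ext f x)"
    by (simp add: lin_ext_superset[of "Poly_Mapping.keys x"] vs.scale_sum_right)
qed

lemmas lin_ext_add = lin_add[OF lin_lin_ext]
  and lin_ext_scl = lin_scl[OF lin_lin_ext]
  and lin_ext_zero [simp] = lin_zero[OF lin_lin_ext]
  and lin_ext_sum = lin_sum[OF lin_lin_ext]

lemma lookup_bas: "Poly_Mapping.lookup (bas e) e' = (if e = e' then 1 else 0)"
  by (auto simp: bas_def lookup_single)

lemma keys_bas [simp]: "Poly_Mapping.keys (bas e :: 'x \<Rightarrow>\<^sub>0 'k::field) = {e}"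
  by (simp add: bas_def)

lemma bas_nonzero [simp]: "(bas e :: 'x \<Rightarrow>\<^sub>0 'k::field) \<noteq> 0"
  by (metis keys_bas keys_zero insert_not_empty)

lemma lin_ext_bas [simp]: "lin_ext f (bas e) = f e"
  by (simp add: lin_ext_def lookup_bas)

lemma lookup_sum_pm: "Poly_Mapping.lookup (sum f A) k = (\<Sum>i\<in>A. Poly_Mapping.lookup (f i) k)"
  by (induction A rule: infinite_finite_induct) (auto simp: lookup_add)

lemma lin_ext_bas_eq: "lin_ext bas x = x"
  by (rule poly_mapping_eqI)
    (auto simp: lin_ext_def lookup_sum_pm lookup_bas sum.delta in_keys_iff if_distrib cong: if_cong)

lemma lin_eq_lin_ext:
  assumes "lin f" shows "f x = lin_ext (\<lambda>e. f (bas e)) x"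
proof -
  have "f x = f (lin_ext bas x)" by (simp add: lin_ext_bas_eq)
  also have "\<dots> = lin_ext (\<lambda>e. f (bas e)) x"
    unfolding lin_ext_def by (simp add: lin_sum[OF assms] lin_scl[OF assms])
  finally show ?thesis .
qed

lemma lin_ext_cong:
  "(\<And>e. e \<in> Poly_Mapping.keys x \<Longrightarrow> f e = f' e) \<Longrightarrow> lin_ext f x = lin_ext f' x"
  by (simp add: lin_ext_def)

text \<open>The ambient type also contains arrow lists that do not compose, on which identities such
  as \<open>decompose\<close> fail. Linear identities are therefore tested only on the basis
  elements of a support set, in practice the genuine paths or pairs of them.\<close>

lemma lin_eq_on_supp:
  assumes "x \<in> supp S" "lin f" "lin f'" "\<And>e. e \<in> S \<Longrightarrow> f (bas e) = f' (bas e)"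
  shows "f x = f' x"
proof -
  have "f x = lin_ext (\<lambda>e. f (bas e)) x" "f' x = lin_ext (\<lambda>e. f' (bas e)) x"
    by (rule lin_eq_lin_ext, rule assms)+
  moreover have "lin_ext (\<lambda>e. f (bas e)) x = lin_ext (\<lambda>e. f' (bas e)) x"
    using assms(1,4) by (intro lin_ext_cong) blast
  ultimately show ?thesis by simp
qed

lemma lin_eq:
  assumes "lin f" "lin f'" "\<And>e. f (bas e) = f' (bas e)"
  shows "f x = f' x"
  by (rule lin_eq_on_supp[of x UNIV, OF _ assms]) simp

lemma bilin_eq_on_supp:
  assumes "x \<in> supp S" "y \<in> supp T"
    and "\<And>y. lin (\<lambda>x. f x y)" "\<And>x. lin (f x)" "\<And>y. lin (\<lambda>x. f' x y)" "\<And>x. lin (f' x)"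
    and "\<And>d e. d \<in> S \<Longrightarrow> e \<in> T \<Longrightarrow> f (bas d) (bas e) = f' (bas d) (bas e)"
  shows "f x y = f' x y"
proof (rule lin_eq_on_supp[OF assms(1) assms(3) assms(5)])
  fix d assume d: "d \<in> S"
  show "f (bas d) y = f' (bas d) y"
    by (rule lin_eq_on_supp[OF assms(2) assms(4) assms(6) assms(7)[OF d]])
qed

lemma subspace_supp: "vs.subspace (supp S :: ('x \<Rightarrow>\<^sub>0 'k::field) set)"
proof (rule vs.subspaceI)
  fix x y :: "'x \<Rightarrow>\<^sub>0 'k" assume "x \<in> supp S" "y \<in> supp S"
  then show "x + y \<in> supp S" using Poly_Mapping.keys_add[of x y] by auto
next
  fix c and x :: "'x \<Rightarrow>\<^sub>0 'k" assume "x \<in> supp S"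
  then show "scl c x \<in> supp S" by (auto simp: in_keys_iff)
qed simp

lemma lin_ext_in_subspace:
  assumes "vs.subspace M" "\<And>e. e \<in> Poly_Mapping.keys x \<Longrightarrow> f e \<in> M"
  shows "lin_ext f x \<in> M"
  unfolding lin_ext_def using assms
  by (intro vs.subspace_sum vs.subspace_scale) auto

lemma lin_maps_supp:
  assumes "lin f" "vs.subspace M" "x \<in> supp S" "\<And>e. e \<in> S \<Longrightarrow> f (bas e) \<in> M"
  shows "f x \<in> M"
  unfolding lin_eq_lin_ext[OF assms(1), of x]
  using assms(2-4) by (intro lin_ext_in_subspace) auto

lemma lin_maps_span:
  assumes "lin f" "vs.subspace M" "x \<in> vs.span B" "\<And>e. e \<in> B \<Longrightarrow> f e \<in> M"
  shows "f x \<in> M"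
  using assms(3)
proof (induction rule: vs.span_induct_alt)
  case base then show ?case by (simp add: lin_zero[OF assms(1)] assms(2) vs.subspace_0)
next
  case (step c x y) then show ?case
    by (simp add: lin_add[OF assms(1)] lin_scl[OF assms(1)] assms(2,4) vs.subspace_add vs.subspace_scale)
qed

section \<open>Bilinear extension and tensor products\<close>

lemma lin_lin_ext_left:
  assumes "\<And>e. lin (\<lambda>y. F y e)" shows "lin (\<lambda>y. lin_ext (F y) x)"
proof (rule linI)
  fix y z
  have "F (y + z) e = F y e + F z e" for e
    by (rule lin_add[OF assms])
  then show "lin_ext (F (y + z)) x = lin_ext (F y) x + lin_ext (F z) x"
    by (simp add: lin_ext_def vs.scale_right_distrib sum.distrib)
next
  fix c y
  have "F (scl c y) e = scl c (F y e)" for e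
    by (rule lin_scl[OF assms])
  then show "lin_ext (F (scl c y)) x = scl c (lin_ext (F y) x)"
    by (simp add: lin_ext_def vs.scale_sum_right mult.commute)
qed

lemma lin_bilin_ext [simp]: "lin (bilin_ext f x)" "lin (\<lambda>x. bilin_ext f x y)"
  unfolding bilin_ext_def by (auto intro: lin_lin_ext_left)

lemma bilin_ext_bas [simp]: "bilin_ext f (bas d) (bas e) = f d e"
  by (simp add: bilin_ext_def)

lemma lin_tens [simp]: "lin (\<lambda>y. x \<boxtimes> y)" "lin (\<lambda>x. x \<boxtimes> y)"
  unfolding tens_def by auto

lemma tens_bas [simp]: "bas d \<boxtimes> bas e = bas (d, e)"
  by (simp add: tens_def)

lemma tens_zero [simp]: "x \<boxtimes> 0 = 0" "0 \<boxtimes> y = 0"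
  using lin_zero[OF lin_tens(1)] lin_zero[OF lin_tens(2)] by auto

lemma lin_tens_map [simp]: "lin (tens_map f h)"
  unfolding tens_map_def by simp

lemma tens_map_bas: "tens_map f h (bas e) = f (bas (fst e)) \<boxtimes> h (bas (snd e))"
  by (simp add: tens_map_def case_prod_unfold)

lemmas tens_simps = lin_add[OF lin_tens(1)] lin_add[OF lin_tens(2)]
  lin_scl[OF lin_tens(1)] lin_scl[OF lin_tens(2)] lin_add[OF lin_tens_map] lin_scl[OF lin_tens_map]

lemma tens_map_tens:
  assumes "lin f" "lin h" shows "tens_map f h (x \<boxtimes> y) = f x \<boxtimes> h y"
proof (rule bilin_eq_on_supp[of x UNIV y UNIV "\<lambda>x y. tens_map f h (x \<boxtimes> y)" "\<lambda>x y. f x \<boxtimes> h y"])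
  fix x y
  show "lin (\<lambda>x. tens_map f h (x \<boxtimes> y))" "lin (\<lambda>y. tens_map f h (x \<boxtimes> y))"
    by (rule linI; simp add: tens_simps)+
  show "lin (\<lambda>x. f x \<boxtimes> h y)"
    by (rule linI; simp add: tens_simps lin_add[OF assms(1)] lin_scl[OF assms(1)])
  show "lin (\<lambda>y. f x \<boxtimes> h y)"
    by (rule linI; simp add: tens_simps lin_add[OF assms(2)] lin_scl[OF assms(2)])
qed (simp_all add: tens_map_bas)

lemma tens_map_comp:
  assumes "lin f'" "lin h'"
  shows "tens_map f' h' (tens_map f h t) = tens_map (\<lambda>x. f' (f x)) (\<lambda>x. h' (h x)) t"
  by (rule lin_eq[of _ _ t])
    (simp_all add: lin_comp[OF lin_tens_map lin_tens_map] tens_map_bas tens_map_tens assms)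

text \<open>\<open>tens_map\<close> sees its arguments only on basis vectors, so an identity valid
  only on \<open>kQ\<close>, such as a unit law, may still be rewritten inside one leg.\<close>

lemma tens_map_cong:
  assumes "t \<in> supp (S \<times> T)" "\<And>d. d \<in> S \<Longrightarrow> f (bas d) = f' (bas d)"
    "\<And>e. e \<in> T \<Longrightarrow> h (bas e) = h' (bas e)"
  shows "tens_map f h t = tens_map f' h' t"
  proof (rule lin_eq_on_supp[OF assms(1) lin_tens_map lin_tens_map])
  fix e assume "e \<in> S \<times> T"
  then have "fst e \<in> S" "snd e \<in> T" by auto
  then show "tens_map f h (bas e) = tens_map f' h' (bas e)"
    by (simp add: tens_map_bas assms(2,3))
qed

lemma tens_map_add_right: "tens_map f (\<lambda>x. h x + h' x) t = tens_map f h t + tens_map f h' t"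
  by (rule lin_eq[of "tens_map f (\<lambda>x. h x + h' x)" "\<lambda>t. tens_map f h t + tens_map f h' t"])
    (simp_all add: tens_map_bas lin_plus tens_simps)

lemma tens_map_add_left: "tens_map (\<lambda>x. h x + h' x) f t = tens_map h f t + tens_map h' f t"
  by (rule lin_eq[of "tens_map (\<lambda>x. h x + h' x) f" "\<lambda>t. tens_map h f t + tens_map h' f t"])
    (simp_all add: tens_map_bas lin_plus tens_simps)

lemma tens_map_diff:
  "tens_map (\<lambda>x. h x - h' x) f t = tens_map h f t - tens_map h' f t"
  by (rule lin_eq[of "tens_map (\<lambda>x. h x - h' x) f" "\<lambda>t. tens_map h f t - tens_map h' f t"])
    (simp_all add: tens_map_bas lin_minus lin_diff[OF lin_tens(2)])

lemma tens_map_id [simp]: "tens_map id id t = t" "tens_map (\<lambda>x. x) (\<lambda>x. x) t = t"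
  by (rule lin_eq[OF lin_tens_map lin_id(2)], simp add: tens_map_bas)+

lemma tens_in_tensor_space: "x \<in> A \<Longrightarrow> y \<in> B \<Longrightarrow> x \<boxtimes> y \<in> tensor_space A B"
  unfolding tensor_space_def by (intro vs.span_base) blast

lemma subspace_tensor_space: "vs.subspace (tensor_space A B)"
  unfolding tensor_space_def by simp

lemma tens_map_tensor_space:
  assumes "lin f" "lin h" "f ` A \<subseteq> C" "h ` B \<subseteq> D" "t \<in> tensor_space A B"
  shows "tens_map f h t \<in> tensor_space C D"
proof (rule lin_maps_span[OF lin_tens_map subspace_tensor_space assms(5)[unfolded tensor_space_def]])
  fix e assume "e \<in> {x \<boxtimes> y |x y. x \<in> A \<and> y \<in> B}"
  then obtain x y where e: "e = x \<boxtimes> y" and xy: "x \<in> A" "y \<in> B" by blast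
  have "f x \<in> C" "h y \<in> D" using assms(3,4) xy by blast+
  then show "tens_map f h e \<in> tensor_space C D"
    unfolding e tens_map_tens[OF assms(1,2)] by (rule tens_in_tensor_space)
qed

lemma tens_in_supp:
  assumes "x \<in> supp S" "y \<in> supp T" shows "x \<boxtimes> y \<in> supp (S \<times> T)"
proof (rule lin_maps_supp[of "\<lambda>x. x \<boxtimes> y", OF lin_tens(2) subspace_supp assms(1)])
  fix e assume "e \<in> S"
  then have "bas e \<boxtimes> bas e' \<in> supp (S \<times> T)" if "e' \<in> T" for e'
    using that by simp
  then show "bas e \<boxtimes> y \<in> supp (S \<times> T)"
    by (rule lin_maps_supp[of "\<lambda>y. bas e \<boxtimes> y", OF lin_tens(1) subspace_supp assms(2)])
qed

lemma lin_tens_mul [simp]: "lin (tens_mul mul s)" "lin (\<lambda>s. tens_mul mul s t)"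
  unfolding tens_mul_def by auto

lemma tens_mul_bas:
  "tens_mul mul (bas (d, e)) (bas (d', e')) = mul (bas d) (bas d') \<boxtimes> mul (bas e) (bas e')"
  by (simp add: tens_mul_def)

text \<open>In this form, multiplying by the terms of \<Delta> v = v \<otimes> 1 + g \<otimes> v is
  an application of \<open>tens_map\<close>, and successive steps merge by
  \<open>tens_map_comp\<close>.\<close>

lemma tens_mul_tens:
  assumes "\<And>x. lin (mul x)" "\<And>y. lin (\<lambda>x. mul x y)"
  shows "tens_mul mul (x \<boxtimes> y) t = tens_map (mul x) (mul y) t"
proof (rule lin_eq[of "tens_mul mul (x \<boxtimes> y)"])
  note ss = tens_simps lin_add[OF lin_tens_mul(2)] lin_scl[OF lin_tens_mul(2)]
    lin_add[OF assms(2)] lin_scl[OF assms(2)]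
  fix e
  show "tens_mul mul (x \<boxtimes> y) (bas e) = tens_map (mul x) (mul y) (bas e)"
  proof (rule bilin_eq_on_supp[of x UNIV y UNIV "\<lambda>x y. tens_mul mul (x \<boxtimes> y) (bas e)"
        "\<lambda>x y. tens_map (mul x) (mul y) (bas e)"])
    fix x y
    show "lin (\<lambda>x. tens_mul mul (x \<boxtimes> y) (bas e))" "lin (\<lambda>y. tens_mul mul (x \<boxtimes> y) (bas e))"
      "lin (\<lambda>x. tens_map (mul x) (mul y) (bas e))" "lin (\<lambda>y. tens_map (mul x) (mul y) (bas e))"
      unfolding tens_map_bas by (rule linI; simp add: ss)+
    show "tens_mul mul (bas x \<boxtimes> bas y) (bas e) = tens_map (mul (bas x)) (mul (bas y)) (bas e)" for x y
      using tens_mul_bas[of mul x y "fst e" "snd e"] by (simp add: tens_map_bas)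
  qed simp_all
qed simp_all

lemma lin_mul_map [simp]: "lin (mul_map mul)"
  unfolding mul_map_def by simp

lemma mul_map_tens:
  assumes "\<And>x. lin (mul x)" "\<And>y. lin (\<lambda>x. mul x y)"
  shows "mul_map mul (x \<boxtimes> y) = mul x y"
proof (rule bilin_eq_on_supp[of x UNIV y UNIV "\<lambda>x y. mul_map mul (x \<boxtimes> y)" mul])
  fix x y
  show "lin (\<lambda>x. mul_map mul (x \<boxtimes> y))" "lin (\<lambda>y. mul_map mul (x \<boxtimes> y))"
    by (rule linI; simp add: tens_simps lin_add[OF lin_mul_map] lin_scl[OF lin_mul_map])+
qed (simp_all add: mul_map_def assms)

section \<open>The product of paths, one position at a time\<close>

text \<open>One step of \<open>multi_list\<close>, named so that its bilinearity can be
  used.\<close>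

definition cons_ext :: "('e \<Rightarrow>\<^sub>0 'k::field) \<Rightarrow> ('e list \<Rightarrow>\<^sub>0 'k) \<Rightarrow> ('e list \<Rightarrow>\<^sub>0 'k)" where
  "cons_ext = bilin_ext (\<lambda>e w. bas (e # w))"

lemma lin_cons_ext [simp]: "lin (cons_ext x)" "lin (\<lambda>x. cons_ext x y)"
  by (simp_all add: cons_ext_def)

lemma cons_ext_bas [simp]: "cons_ext (bas e) (bas w) = bas (e # w)"
  by (simp add: cons_ext_def)

lemma vertex_at_Cons: "vertex_at G g (h, x # l) (Suc k) = vertex_at G g (target G g x, l) k"
  by (auto simp: vertex_at_def nth_Cons split: nat.splits)

lemma vertex_at_0 [simp]: "vertex_at G g \<alpha> 0 = fst \<alpha>"
  by (simp add: vertex_at_def)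

text \<open>Once position 1 has consumed the first arrow, the rest is the splitting of the path that
  starts at its target; the extra position raises every count by one, which matches the extra list
  entry.\<close>

lemma split_entry_insert_Suc:
  assumes "d \<subseteq> {1..q}" "1 \<le> i"
  shows "split_entry G g (insert 1 (Suc ` d)) (h, x # l) (Suc i) = split_entry G g d (target G g x, l) i"
proof -
  have "insert 1 (Suc ` d) \<inter> {1..<Suc i} = insert 1 (Suc ` (d \<inter> {1..<i}))"
    using assms by auto
  moreover have "1 \<notin> Suc ` (d \<inter> {1..<i})" by auto
  ultimately have "card (insert 1 (Suc ` d) \<inter> {1..<Suc i}) = Suc (card (d \<inter> {1..<i}))"
    by (simp add: card_image)
  moreover have "Suc i \<in> insert 1 (Suc ` d) \<longleftrightarrow> i \<in> d" using assms by auto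
  ultimately show ?thesis
    by (simp add: split_entry_def Let_def vertex_at_Cons)
qed

lemma split_entry_Suc:
  assumes "d \<subseteq> {1..q}" "1 \<le> i"
  shows "split_entry G g (Suc ` d) \<alpha> (Suc i) = split_entry G g d \<alpha> i"
proof -
  have "Suc ` d \<inter> {1..<Suc i} = Suc ` (d \<inter> {1..<i})"
    using assms by auto
  then have "card (Suc ` d \<inter> {1..<Suc i}) = card (d \<inter> {1..<i})"
    by (simp add: card_image)
  moreover have "Suc i \<in> Suc ` d \<longleftrightarrow> i \<in> d" by auto
  ultimately show ?thesis
    by (simp add: split_entry_def Let_def)
qed

lemma split_entry_insert_1: "split_entry G g (insert 1 d) (h, x # l) 1 = Arrow x"
  by (simp add: split_entry_def Let_def)

lemma split_entry_1: "d \<subseteq> {1..q} \<Longrightarrow> split_entry G g (Suc ` d) \<alpha> 1 = Vertex (fst \<alpha>)"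
  by (auto simp: split_entry_def Let_def)

definition split_term where
  "split_term G g act \<alpha> \<beta> q d =
     multi_list (map (\<lambda>i. bracket G act (split_entry G g d \<alpha> i)
                        (split_entry G g ({1..q} - d) \<beta> i)) [1..<q+1])"

definition list_mul :: "('g, 'm) monoid_scheme \<Rightarrow> 'g \<Rightarrow>
    ((vbasis \<Rightarrow>\<^sub>0 'k::field) \<Rightarrow> 'g \<Rightarrow> (vbasis \<Rightarrow>\<^sub>0 'k)) \<Rightarrow> 'g path \<Rightarrow> 'g path \<Rightarrow> ('g arrow list \<Rightarrow>\<^sub>0 'k)" where
  "list_mul G g act \<alpha> \<beta> =
     (\<Sum>d | d \<subseteq> {1..length (snd \<alpha>) + length (snd \<beta>)} \<and> card d = length (snd \<alpha>).
        split_term G g act \<alpha> \<beta> (length (snd \<alpha>) + length (snd \<beta>)) d)"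

lemma path_mul_eq:
  "path_mul G g act \<alpha> \<beta> = lin_ext (\<lambda>w. bas (fst \<alpha> \<otimes>\<^bsub>G\<^esub> fst \<beta>, w)) (list_mul G g act \<alpha> \<beta>)"
  by (simp add: path_mul_def list_mul_def split_term_def Let_def lin_ext_sum)

lemma upt_shift: "[1..<Suc q + 1] = 1 # map Suc [1..<q + 1]"
  by (simp add: map_Suc_upt upt_conv_Cons del: upt_Suc)

lemma atLeastAtMost_Suc_image: "{1..Suc q} = insert 1 (Suc ` {1..q})"
  by auto

text \<open>With position 1 in the index set, the left factor contributes its first arrow there and
  the right factor its start vertex. The complement shifts without gaining 1, so the tail is a term
  of a shorter product.\<close>

lemma split_term_insert:
  assumes d: "d \<subseteq> {1..q}"
  shows "split_term G g act (h, x # l) \<beta> (Suc q) (insert 1 (Suc ` d)) =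
    cons_ext (bracket G act (Arrow x) (Vertex (fst \<beta>))) (split_term G g act (target G g x, l) \<beta> q d)"
proof -
  have c: "{1..Suc q} - insert 1 (Suc ` d) = Suc ` ({1..q} - d)"
    unfolding atLeastAtMost_Suc_image using d by (auto simp del: image_Suc_atLeastAtMost)
  have m: "map (\<lambda>i. bracket G act (split_entry G g (insert 1 (Suc ` d)) (h, x # l) i)
              (split_entry G g (Suc ` ({1..q} - d)) \<beta> i)) (map Suc [1..<q + 1])
        = map (\<lambda>i. bracket G act (split_entry G g d (target G g x, l) i)
              (split_entry G g ({1..q} - d) \<beta> i)) [1..<q + 1]"
    unfolding map_map o_def
    by (intro map_cong refl)
      (auto simp: split_entry_insert_Suc[OF d, simplified] split_entry_Suc[of "{1..q} - d" q, simplified])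
  show ?thesis
    unfolding split_term_def c upt_shift
    by (subst list.map(2), subst m) (use split_entry_1[of "{1..q} - d" q G g \<beta>] in
      \<open>simp add: split_entry_insert_1[simplified] cons_ext_def\<close>)
qed

lemma split_term_Suc:
  assumes d: "d \<subseteq> {1..q}"
  shows "split_term G g act \<alpha> (h', y # l') (Suc q) (Suc ` d) =
    cons_ext (bracket G act (Vertex (fst \<alpha>)) (Arrow y)) (split_term G g act \<alpha> (target G g y, l') q d)"
proof -
  have c: "{1..Suc q} - Suc ` d = insert 1 (Suc ` ({1..q} - d))"
    unfolding atLeastAtMost_Suc_image using d by (auto simp del: image_Suc_atLeastAtMost)
  have m: "map (\<lambda>i. bracket G act (split_entry G g (Suc ` d) \<alpha> i)
              (split_entry G g (insert 1 (Suc ` ({1..q} - d))) (h', y # l') i)) (map Suc [1..<q + 1])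
        = map (\<lambda>i. bracket G act (split_entry G g d \<alpha> i)
              (split_entry G g ({1..q} - d) (target G g y, l') i)) [1..<q + 1]"
    unfolding map_map o_def
    by (intro map_cong refl)
      (auto simp: split_entry_Suc[OF d, simplified] split_entry_insert_Suc[of "{1..q} - d" q, simplified])
  show ?thesis
    unfolding split_term_def c upt_shift
    by (subst list.map(2), subst m) (use split_entry_1[OF d, of G g \<alpha>] in
      \<open>simp add: split_entry_insert_1[simplified] cons_ext_def\<close>)
qed

lemma card_insert_Suc_image:
  assumes "d \<subseteq> {1..q}" shows "card (insert 1 (Suc ` d)) = Suc (card d)"
proof -
  have "1 \<notin> Suc ` d" "finite d" using assms finite_subset by auto
  then show ?thesis by (simp add: card_image)
qed

text \<open>Pascal's recursion at the level of sets. Writing \<open>Suc (card d) = m\<close> instead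
  of subtracting keeps the first family empty for \<open>m = 0\<close>.\<close>

lemma subsets_Suc:
  "{d. d \<subseteq> {1..Suc q} \<and> card d = m} =
     (\<lambda>d. insert 1 (Suc ` d)) ` {d. d \<subseteq> {1..q} \<and> Suc (card d) = m} \<union>
     image Suc ` {d. d \<subseteq> {1..q} \<and> card d = m}" (is "?L = ?A \<union> ?B")
proof (intro equalityI subsetI)
  fix e assume "e \<in> ?A \<union> ?B"
  then consider d where "e = insert 1 (Suc ` d)" "d \<subseteq> {1..q}" "Suc (card d) = m"
    | d where "e = Suc ` d" "d \<subseteq> {1..q}" "card d = m" by blast
  then show "e \<in> ?L"
  proof cases
    case 1
    then have "e \<subseteq> {1..Suc q}" by fastforce
    then show ?thesis using 1 card_insert_Suc_image[OF 1(2)] by simp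
  next
    case 2
    then have "e \<subseteq> {1..Suc q}" by fastforce
    then show ?thesis using 2 by (simp add: card_image)
  qed
next
  fix e assume e: "e \<in> ?L"
  \<comment> \<open>The bound \<open>i \<ge> 1\<close> keeps \<open>0\<close> out of
    \<open>d\<close> when \<open>1 \<in> e\<close>.\<close>
  define d where "d = {i. i \<ge> 1 \<and> Suc i \<in> e}"
  have d: "d \<subseteq> {1..q}" using e by (auto simp: d_def)
  have img: "Suc ` d = e - {1}"
  proof (intro equalityI subsetI)
    fix i assume i: "i \<in> e - {1}"
    then have "i \<in> {1..Suc q}" using e by blast
    then have "i = Suc (i - 1)" "i - 1 \<ge> 1" using i by auto
    then have "i - 1 \<in> d" using i by (simp add: d_def)
    then show "i \<in> Suc ` d" using \<open>i = Suc (i - 1)\<close> by blast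
  qed (auto simp: d_def)
  show "e \<in> ?A \<union> ?B"
  proof (cases "1 \<in> e")
    case True
    then have eq: "e = insert 1 (Suc ` d)" using img by blast
    then have "Suc (card d) = m" using e card_insert_Suc_image[OF d] by simp
    then show ?thesis using eq d by blast
  next
    case False
    then have eq: "e = Suc ` d" using img by blast
    then have "card d = m" using e by (simp add: card_image)
    then show ?thesis using eq d by blast
  qed
qed

lemma sum_subsets_Suc:
  fixes f :: "nat set \<Rightarrow> 'a::comm_monoid_add"
  shows "(\<Sum>d | d \<subseteq> {1..Suc q} \<and> card d = m. f d) =
     (\<Sum>d | d \<subseteq> {1..q} \<and> Suc (card d) = m. f (insert 1 (Suc ` d))) +
     (\<Sum>d | d \<subseteq> {1..q} \<and> card d = m. f (Suc ` d))"
proof -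
  have fin: "finite {d. d \<subseteq> {1..q} \<and> P d}" for P
    by (rule finite_subset[of _ "Pow {1..q}"]) auto
  have inj1: "inj_on (\<lambda>d. insert 1 (Suc ` d)) {d. d \<subseteq> {1..q} \<and> Suc (card d) = m}"
  proof (rule inj_onI)
    fix d d' assume "d \<in> {d. d \<subseteq> {1..q} \<and> Suc (card d) = m}" "d' \<in> {d. d \<subseteq> {1..q} \<and> Suc (card d) = m}"
      and eq: "insert 1 (Suc ` d) = insert 1 (Suc ` d')"
    then have "1 \<notin> Suc ` d" "1 \<notin> Suc ` d'" by auto
    with eq have "Suc ` d = Suc ` d'" by (metis insert_ident)
    then show "d = d'" by (simp add: inj_image_eq_iff)
  qed
  have inj2: "inj_on (image Suc) {d. d \<subseteq> {1..q} \<and> card d = m}"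
    by (rule inj_onI) (simp add: inj_image_eq_iff)
  have "1 \<notin> Suc ` d" if "d \<subseteq> {1..q}" for d
    using that by auto
  then have disj: "(\<lambda>d. insert 1 (Suc ` d)) ` {d. d \<subseteq> {1..q} \<and> Suc (card d) = m} \<inter>
      image Suc ` {d. d \<subseteq> {1..q} \<and> card d = m} = {}"
    by blast
  show ?thesis
    unfolding subsets_Suc
      sum.union_disjoint[OF finite_imageI[OF fin] finite_imageI[OF fin] disj]
      sum.reindex[OF inj1] sum.reindex[OF inj2] o_def ..
qed

lemma list_mul_Nil [simp]: "list_mul G g act (h, []) (h', []) = bas []"
proof -
  have "{d::nat set. d = {} \<and> card d = 0} = {{}}" by auto
  then show ?thesis by (simp add: list_mul_def split_term_def)
qed

text \<open>A twisted shuffle recursion: the first place of the product comes from one factor or the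
  other. The value \<open>0\<close> in a \<open>case\<close> covers an exhausted factor.\<close>

lemma list_mul_rec:
  assumes "l \<noteq> [] \<or> l' \<noteq> []"
  shows "list_mul G g act (h, l) (h', l') =
    (case l of [] \<Rightarrow> 0 | x # l1 \<Rightarrow>
       cons_ext (bracket G act (Arrow x) (Vertex h')) (list_mul G g act (target G g x, l1) (h', l'))) +
    (case l' of [] \<Rightarrow> 0 | y # l1 \<Rightarrow>
       cons_ext (bracket G act (Vertex h) (Arrow y)) (list_mul G g act (h, l) (target G g y, l1)))"
proof -
  define q where "q = length l + length l' - 1"
  have q: "length l + length l' = Suc q"
    using assms by (auto simp: q_def)
  have 1: "(\<Sum>d | d \<subseteq> {1..q} \<and> Suc (card d) = length l.
        split_term G g act (h, l) (h', l') (Suc q) (insert 1 (Suc ` d))) =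
     (case l of [] \<Rightarrow> 0 | x # l1 \<Rightarrow>
       cons_ext (bracket G act (Arrow x) (Vertex h')) (list_mul G g act (target G g x, l1) (h', l')))"
  proof (cases l)
    case (Cons x l1)
    with q have "length l1 + length l' = q" by simp
    then show ?thesis
      unfolding list_mul_def Cons
      by (auto simp: lin_sum[OF lin_cons_ext(1)] split_term_insert[simplified] intro!: sum.cong)
  qed simp
  have 2: "(\<Sum>d | d \<subseteq> {1..q} \<and> card d = length l.
        split_term G g act (h, l) (h', l') (Suc q) (Suc ` d)) =
     (case l' of [] \<Rightarrow> 0 | y # l1 \<Rightarrow>
       cons_ext (bracket G act (Vertex h) (Arrow y)) (list_mul G g act (h, l) (target G g y, l1)))"
  proof (cases l')
    case Nil
    \<comment> \<open>With \<open>l'\<close> empty all \<open>Suc q\<close> positions carry arrows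
      of \<open>l\<close>, too many for a subset of \<open>{1..q}\<close>.\<close>
    have "card d \<noteq> length l" if "d \<subseteq> {1..q}" for d
      using card_mono[OF _ that] q Nil by simp
    then have e: "{d. d \<subseteq> {1..q} \<and> card d = length l} = {}" by blast
    show ?thesis unfolding e Nil by simp
  next
    case (Cons y l1)
    with q have "length l + length l1 = q" by simp
    then show ?thesis
      unfolding list_mul_def Cons
      by (auto simp: lin_sum[OF lin_cons_ext(1)] split_term_Suc[simplified] intro!: sum.cong)
  qed
  show ?thesis
    unfolding list_mul_def snd_conv q sum_subsets_Suc 1 2 list_mul_def ..
qed

section \<open>The skew derivations of the path algebra\<close>

locale jordan_quiver = group G for G :: "('g, 'm) monoid_scheme" (structure) +
  fixes g :: 'g and act :: "(vbasis \<Rightarrow>\<^sub>0 'k::field) \<Rightarrow> 'g \<Rightarrow> (vbasis \<Rightarrow>\<^sub>0 'k)"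
  assumes finite_carrier: "finite (carrier G)"
    and g [simp]: "g \<in> carrier G"
    and carrier_generated: "carrier G = generate G {g}"
    and module: "right_module G act"
    and act_Va_g: "act (bas Va) g = bas Va"
    and act_Vb_g: "act (bas Vb) g = bas Va + bas Vb"
begin

abbreviation mul (infixl \<open>\<star>\<close> 70) where "x \<star> y \<equiv> kQ_mul G g act x y"
abbreviation "P \<equiv> paths G g"
abbreviation K :: "('g path \<Rightarrow>\<^sub>0 'k) set" where "K \<equiv> supp P"

text \<open>The additive character of \<open>G\<close> that sends \<open>g\<close> to 1; h acts by b
  \<mapsto> b + shift(h) a. Reading it off the action avoids choosing an exponent for h.\<close>

definition shift :: "'g \<Rightarrow> 'k" where
  "shift h = Poly_Mapping.lookup (act (bas Vb) h) Va"

text \<open>Finiteness lets natural exponents suffice, so the action can be computed by induction on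
  them.\<close>

lemma carrier_pow: "carrier G = {g [^] (k::nat) | k. k \<in> UNIV}"
  using generate_pow_on_finite_carrier[OF finite_carrier g] carrier_generated by simp

lemma act_mult:
  "h \<in> carrier G \<Longrightarrow> h' \<in> carrier G \<Longrightarrow> act v (h \<otimes> h') = act (act v h) h'"
  and act_one: "act v \<one> = v"
  and lin_act: "h \<in> carrier G \<Longrightarrow> lin (\<lambda>v. act v h)"
  using module by (auto simp: right_module_def)

lemma act_pow:
  "act (bas Va) (g [^] (k::nat)) = bas Va"
  "act (bas Vb) (g [^] (k::nat)) = bas Vb + scl (of_nat k) (bas Va)"
proof (induction k)
  case 0
  { case 1 show ?case by (simp add: act_one) }
  { case 2 show ?case by (simp add: act_one) }
next
  case (Suc k)
  note lin = lin_act[OF g]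
  { case 1 show ?case using Suc.IH(1) by (simp add: act_mult act_Va_g) }
  { case 2 show ?case using Suc.IH(2)
      by (simp add: act_mult lin_add[OF lin] lin_scl[OF lin] act_Va_g act_Vb_g
          vs.scale_left_distrib add_ac) }
qed

lemma shift_pow: "shift (g [^] (k::nat)) = of_nat k"
  by (simp add: shift_def act_pow lookup_add lookup_bas)

lemma carrier_cases:
  assumes "h \<in> carrier G" obtains k :: nat where "h = g [^] k"
  using assms carrier_pow by auto

lemma act_Va: "h \<in> carrier G \<Longrightarrow> act (bas Va) h = bas Va"
  by (erule carrier_cases) (simp add: act_pow)

lemma act_Vb: "h \<in> carrier G \<Longrightarrow> act (bas Vb) h = bas Vb + scl (shift h) (bas Va)"
  by (erule carrier_cases) (simp add: act_pow shift_pow)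

lemma shift_mult:
  assumes "h \<in> carrier G" "h' \<in> carrier G" shows "shift (h \<otimes> h') = shift h + shift h'"
proof -
  obtain k k' :: nat where "h = g [^] k" "h' = g [^] k'"
    using assms carrier_cases by metis
  then show ?thesis by (simp add: nat_pow_mult shift_pow)
qed

lemma shift_one [simp]: "shift \<one> = 0"
  using shift_pow[of 0] by simp

lemma shift_g [simp]: "shift g = 1"
  by (simp add: shift_def act_Vb_g lookup_add lookup_bas)

lemma commute:
  assumes "h \<in> carrier G" "h' \<in> carrier G" shows "h \<otimes> h' = h' \<otimes> h"
proof -
  obtain k k' :: nat where "h = g [^] k" "h' = g [^] k'"
    using assms carrier_cases by metis
  then show ?thesis by (simp add: nat_pow_mult add.commute)
qed

lemma swap_g: "h \<in> carrier G \<Longrightarrow> h' \<in> carrier G \<Longrightarrow> h \<otimes> g \<otimes> h' = h \<otimes> h' \<otimes> g"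
  by (simp add: m_assoc commute[of g h'])

lemma paths_Nil [simp]: "(h, []) \<in> P \<longleftrightarrow> h \<in> carrier G"
  by (simp add: paths_def)

lemma paths_Cons [simp]: "(h, x # l) \<in> P \<longleftrightarrow> h \<in> carrier G \<and> fst x = h \<and> (h \<otimes> g, l) \<in> P"
  unfolding paths_def
  by (auto simp: All_less_Suc2 vertex_at_Cons source_def target_def)

lemma paths_fst: "\<alpha> \<in> P \<Longrightarrow> fst \<alpha> \<in> carrier G"
  by (simp add: paths_def)

lemma lin_mul [simp]: "lin (\<lambda>y. x \<star> y)" "lin (\<lambda>x. x \<star> y)"
  by (simp_all add: kQ_mul_def)

lemmas mul_simps = lin_add[OF lin_mul(1)] lin_add[OF lin_mul(2)]
  lin_scl[OF lin_mul(1)] lin_scl[OF lin_mul(2)]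
  lin_zero[OF lin_mul(1)] lin_zero[OF lin_mul(2)]

lemma mul_bas: "bas \<alpha> \<star> bas \<beta> = path_mul G g act \<alpha> \<beta>"
  by (simp add: kQ_mul_def)

definition strip :: "vbasis \<Rightarrow> ('g path \<Rightarrow>\<^sub>0 'k) \<Rightarrow> ('g path \<Rightarrow>\<^sub>0 'k)" where
  "strip j = lin_ext (\<lambda>(h, l). case l of [] \<Rightarrow> 0
     | x # l' \<Rightarrow> if snd x = j then bas (fst x \<otimes> g, l') else 0)"

definition vpart :: "('g path \<Rightarrow>\<^sub>0 'k) \<Rightarrow> ('g path \<Rightarrow>\<^sub>0 'k)" where
  "vpart = lin_ext (\<lambda>(h, l). if l = [] then bas (h, []) else 0)"

text \<open>The twist in the Leibniz rule for \<open>strip Va\<close>. As \<open>shift\<close> is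
  additive and start vertices multiply, this operator is itself a derivation.\<close>

definition weight :: "('g path \<Rightarrow>\<^sub>0 'k) \<Rightarrow> ('g path \<Rightarrow>\<^sub>0 'k)" where
  "weight = lin_ext (\<lambda>\<alpha>. scl (shift (fst \<alpha>)) (bas \<alpha>))"

text \<open>A right inverse of \<open>strip j\<close> on paths: the new arrow must end at the old
  start h, so it begins at \<open>h \<otimes> inv g\<close>.\<close>

definition attach :: "vbasis \<Rightarrow> ('g path \<Rightarrow>\<^sub>0 'k) \<Rightarrow> ('g path \<Rightarrow>\<^sub>0 'k)" where
  "attach j = lin_ext (\<lambda>(h, l). bas (h \<otimes> inv g, (h \<otimes> inv g, j) # l))"

definition place :: "'g \<Rightarrow> ('g arrow list \<Rightarrow>\<^sub>0 'k) \<Rightarrow> ('g path \<Rightarrow>\<^sub>0 'k)" where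
  "place m = lin_ext (\<lambda>w. bas (m, w))"

lemma lin_ops [simp]: "lin (strip j)" "lin vpart" "lin weight" "lin (attach j)" "lin (place m)"
  by (simp_all add: strip_def vpart_def weight_def attach_def place_def)

lemmas ops_add = lin_ops[THEN lin_add] and ops_scl = lin_ops[THEN lin_scl]
  and ops_zero = lin_ops[THEN lin_zero]

lemmas ops_simps = ops_add ops_scl ops_zero

lemma strip_Nil [simp]: "strip j (bas (h, [])) = 0"
  and strip_Cons [simp]: "strip j (bas (h, x # l)) = (if snd x = j then bas (fst x \<otimes> g, l) else 0)"
  and vpart_bas [simp]: "vpart (bas (h, l)) = (if l = [] then bas (h, []) else 0)"
  and weight_bas [simp]: "weight (bas \<alpha>) = scl (shift (fst \<alpha>)) (bas \<alpha>)"
  and attach_bas [simp]: "attach j (bas (h, l)) = bas (h \<otimes> inv g, (h \<otimes> inv g, j) # l)"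
  and place_bas [simp]: "place m (bas w) = bas (m, w)"
  by (simp_all add: strip_def vpart_def weight_def attach_def place_def)

lemma strip_bas_cases:
  assumes "\<alpha> \<in> P"
  obtains "strip j (bas \<alpha>) = 0"
  | \<alpha>' where "\<alpha>' \<in> P" "length (snd \<alpha>') < length (snd \<alpha>)" "strip j (bas \<alpha>) = bas \<alpha>'"
proof (cases \<alpha>)
  case (Pair h l)
  show thesis
  proof (cases l)
    case Nil then show ?thesis using that(1) Pair by simp
  next
    case (Cons x l')
    then show ?thesis using that(1) that(2)[of "(h \<otimes> g, l')"] assms Pair by (cases "snd x = j") auto
  qed
qed

lemma attach_K: assumes "x \<in> K" shows "attach j x \<in> K"
proof (rule lin_maps_supp[OF lin_ops(4) subspace_supp assms])
  fix \<alpha> assume "\<alpha> \<in> P"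
  then show "attach j (bas \<alpha>) \<in> K"
    using paths_fst[of \<alpha>] by (cases \<alpha>) (simp add: m_assoc)
qed

lemma strip_K: assumes "x \<in> K" shows "strip j x \<in> K"
proof (rule lin_maps_supp[OF lin_ops(1) subspace_supp assms])
  fix \<alpha> assume "\<alpha> \<in> P"
  then show "strip j (bas \<alpha>) \<in> K"
    by (rule strip_bas_cases[of \<alpha> j]) auto
qed

lemma K_add: "x \<in> K \<Longrightarrow> y \<in> K \<Longrightarrow> x + y \<in> K"
  by (rule vs.subspace_add[OF subspace_supp])

lemma K_scl: "x \<in> K \<Longrightarrow> scl c x \<in> K"
  by (rule vs.subspace_scale[OF subspace_supp])

lemma K_0: "0 \<in> K"
  by (rule vs.subspace_0[OF subspace_supp])

text \<open>An arrow is determined by its type and its end, so \<open>attach\<close> restores what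
  \<open>strip\<close> took away. This uses composability: the start of a path must be the start of
  its first arrow.\<close>

lemma decompose:
  assumes "x \<in> K" shows "x = vpart x + attach Va (strip Va x) + attach Vb (strip Vb x)"
proof (rule lin_eq_on_supp[OF assms lin_id(2), of "\<lambda>x. vpart x + attach Va (strip Va x) + attach Vb (strip Vb x)"])
  show "lin (\<lambda>x. vpart x + attach Va (strip Va x) + attach Vb (strip Vb x))"
    by (rule linI) (simp_all add: ops_simps vs.scale_right_distrib add_ac)
  fix \<alpha> assume "\<alpha> \<in> P"
  moreover obtain h l where \<alpha>: "\<alpha> = (h, l)" by fastforce
  moreover have "snd x = Va \<or> snd x = Vb" for x :: "'g arrow" by (cases "snd x") auto
  ultimately show "bas \<alpha> = vpart (bas \<alpha>) + attach Va (strip Va (bas \<alpha>)) + attach Vb (strip Vb (bas \<alpha>))"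
    by (cases l) (auto simp: ops_simps m_assoc)
qed

lemma K_eqI:
  assumes "x \<in> K" "y \<in> K" "vpart x = vpart y" "strip Va x = strip Va y" "strip Vb x = strip Vb y"
  shows "x = y"
  using decompose[OF assms(1)] decompose[OF assms(2)] assms(3-5) by simp

lemma place_cons:
  assumes "m \<in> carrier G"
  shows "place m (cons_ext (bas (m, i)) y) = attach i (place (m \<otimes> g) y)"
proof (rule lin_eq[of "\<lambda>y. place m (cons_ext (bas (m, i)) y)" "\<lambda>y. attach i (place (m \<otimes> g) y)"])
  show "lin (\<lambda>y. place m (cons_ext (bas (m, i)) y))"
    by (rule lin_comp[OF lin_ops(5) lin_cons_ext(1)])
  show "lin (\<lambda>y. attach i (place (m \<otimes> g) y))"
    by (rule lin_comp[OF lin_ops(4) lin_ops(5)])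
qed (use assms in \<open>simp add: m_assoc\<close>)

lemma strip_attach: "x \<in> K \<Longrightarrow> strip j (attach i x) = (if i = j then x else 0)"
proof -
  assume x: "x \<in> K"
  show ?thesis
  proof (rule lin_eq_on_supp[OF x, of "\<lambda>x. strip j (attach i x)" "\<lambda>x. if i = j then x else 0"])
    show "lin (\<lambda>x. strip j (attach i x))" by (rule lin_comp[OF lin_ops(1) lin_ops(4)])
    show "lin (\<lambda>x. if i = j then x else 0)" by (cases "i = j") simp_all
    fix \<alpha> assume "\<alpha> \<in> P"
    then show "strip j (attach i (bas \<alpha>)) = (if i = j then bas \<alpha> else 0)"
      by (cases \<alpha>) (auto dest: paths_fst simp: m_assoc)
  qed
qed

lemma vpart_attach: "vpart (attach i x) = 0"
  by (rule lin_eq[OF lin_comp[OF lin_ops(2) lin_ops(4)] lin_0]) (simp add: attach_def case_prod_unfold)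

section \<open>Recursion for products of paths\<close>

lemma bracket_Arrow:
  assumes "h' \<in> carrier G"
  shows "bracket G act (Arrow (h, i)) (Vertex h') =
    bas (h \<otimes> h', i) + (if i = Vb then scl (shift h') (bas (h \<otimes> h', Va)) else 0)"
  by (cases i) (simp_all add: assms act_Va act_Vb lin_ext_add lin_ext_scl)

text \<open>The subsets in the product are split according to whether they contain the position \<open>1\<close>.\<close>

lemma mul_bas_rec:
  assumes "(h, l) \<in> P" "(h', l') \<in> P" "l \<noteq> [] \<or> l' \<noteq> []"
  shows "bas (h, l) \<star> bas (h', l') =
    (case l of [] \<Rightarrow> 0 | x # l1 \<Rightarrow>
       attach (snd x) (bas (h \<otimes> g, l1) \<star> bas (h', l')) +
       (if snd x = Vb then attach Va (scl (shift h') (bas (h \<otimes> g, l1) \<star> bas (h', l'))) else 0)) +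
    (case l' of [] \<Rightarrow> 0 | y # l1 \<Rightarrow> attach (snd y) (bas (h, l) \<star> bas (h' \<otimes> g, l1)))"
proof -
  have h: "h \<in> carrier G" "h' \<in> carrier G" using assms(1,2)[THEN paths_fst] by auto
  have mul: "bas (m, u) \<star> bas (m', u') = place (m \<otimes> m') (list_mul G g act (m, u) (m', u'))" for m m' u u'
    by (simp add: mul_bas path_mul_eq place_def)
  have 1: "place (h \<otimes> h') (case l of [] \<Rightarrow> 0 | x # l1 \<Rightarrow>
       cons_ext (bracket G act (Arrow x) (Vertex h')) (list_mul G g act (target G g x, l1) (h', l'))) =
    (case l of [] \<Rightarrow> 0 | x # l1 \<Rightarrow>
       attach (snd x) (bas (h \<otimes> g, l1) \<star> bas (h', l')) +
       (if snd x = Vb then attach Va (scl (shift h') (bas (h \<otimes> g, l1) \<star> bas (h', l'))) else 0))"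
  proof (cases l)
    case (Cons x l1)
    obtain i where x: "x = (h, i)" using assms(1) Cons by (cases x) auto
    show ?thesis
      unfolding Cons x using h
      by (simp add: mul bracket_Arrow lin_add[OF lin_cons_ext(2)] lin_scl[OF lin_cons_ext(2)] lin_zero[OF lin_cons_ext(2)] ops_simps
          place_cons target_def swap_g del: bracket.simps)
  qed (simp add: ops_simps)
  have 2: "place (h \<otimes> h') (case l' of [] \<Rightarrow> 0 | y # l1 \<Rightarrow>
       cons_ext (bracket G act (Vertex h) (Arrow y)) (list_mul G g act (h, l) (target G g y, l1))) =
     (case l' of [] \<Rightarrow> 0 | y # l1 \<Rightarrow> attach (snd y) (bas (h, l) \<star> bas (h' \<otimes> g, l1)))"
  proof (cases l')
    case (Cons y l1)
    obtain i where y: "y = (h', i)" using assms(2) Cons by (cases y) auto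
    show ?thesis
      unfolding Cons y using h by (simp add: mul place_cons target_def m_assoc)
  qed (simp add: ops_simps)
  show ?thesis
    by (simp only: mul[of h l h' l'] list_mul_rec[OF assms(3)] ops_add(5) 1 2)
qed

lemma mul_vert_bas: "bas (h, []) \<star> bas (h', []) = bas (h \<otimes> h', [])"
  by (simp add: mul_bas path_mul_eq)

section \<open>Closure under the product and Leibniz rules\<close>

lemma mul_bas_K: "\<alpha> \<in> P \<Longrightarrow> \<beta> \<in> P \<Longrightarrow> bas \<alpha> \<star> bas \<beta> \<in> K"
proof (induction "length (snd \<alpha>) + length (snd \<beta>)" arbitrary: \<alpha> \<beta> rule: less_induct)
  case less
  obtain h l h' l' where \<alpha>: "\<alpha> = (h, l)" and \<beta>: "\<beta> = (h', l')" by fastforce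
  have h: "h \<in> carrier G" "h' \<in> carrier G" using less.prems[THEN paths_fst] \<alpha> \<beta> by auto
  show ?case
  proof (cases "l = [] \<and> l' = []")
    case True then show ?thesis unfolding \<alpha> \<beta> using h by (simp add: mul_vert_bas)
  next
    case False
    have 1: "bas (h \<otimes> g, l1) \<star> bas (h', l') \<in> K" if "l = x # l1" for x l1
      using less.hyps[of "(h \<otimes> g, l1)" "(h', l')"] less.prems that \<alpha> \<beta> by simp
    have 2: "bas (h, l) \<star> bas (h' \<otimes> g, l1) \<in> K" if "l' = x # l1" for x l1
      using less.hyps[of "(h, l)" "(h' \<otimes> g, l1)"] less.prems that \<alpha> \<beta> by simp
    have P: "(h, l) \<in> P" "(h', l') \<in> P" "l \<noteq> [] \<or> l' \<noteq> []" using less.prems \<alpha> \<beta> False by auto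
    show ?thesis
      unfolding \<alpha> \<beta> mul_bas_rec[OF P]
    proof (rule K_add)
      show "(case l of [] \<Rightarrow> 0 | x # l1 \<Rightarrow>
         attach (snd x) (bas (h \<otimes> g, l1) \<star> bas (h', l')) +
         (if snd x = Vb then attach Va (scl (shift h') (bas (h \<otimes> g, l1) \<star> bas (h', l'))) else 0)) \<in> K"
      proof (cases l)
        case (Cons x l1)
        then show ?thesis
          using attach_K[OF 1[OF Cons]] attach_K[OF K_scl[OF 1[OF Cons]]] K_add K_0 by simp
      qed (simp add: K_0)
      show "(case l' of [] \<Rightarrow> 0 | y # l1 \<Rightarrow> attach (snd y) (bas (h, l) \<star> bas (h' \<otimes> g, l1))) \<in> K"
        using attach_K[OF 2] K_0 by (cases l') simp_all
    qed
  qed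
qed

lemma mul_K: assumes "x \<in> K" "y \<in> K" shows "x \<star> y \<in> K"
proof (rule lin_maps_supp[of "\<lambda>x. x \<star> y", OF lin_mul(2) subspace_supp assms(1)])
  fix \<alpha> assume "\<alpha> \<in> P"
  then show "bas \<alpha> \<star> y \<in> K"
    by (intro lin_maps_supp[of "\<lambda>y. bas \<alpha> \<star> y", OF lin_mul(1) subspace_supp assms(2)] mul_bas_K)
qed

text \<open>By \<open>mul_bas_rec\<close> the product is \<open>?A + ?B\<close>, sorted by the
  factor that supplies the first arrow, and \<open>strip\<close> undoes \<open>attach\<close>. The
  middle term for \<open>Va\<close> arises because an arrow of type \<open>Vb\<close> acted on by h'
  acquires shift(h') times an arrow of type \<open>Va\<close>.\<close>

lemma strip_mul_bas:
  assumes "\<alpha> \<in> P" "\<beta> \<in> P"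
  shows "strip Vb (bas \<alpha> \<star> bas \<beta>) = strip Vb (bas \<alpha>) \<star> bas \<beta> + bas \<alpha> \<star> strip Vb (bas \<beta>)" (is ?b)
    and "strip Va (bas \<alpha> \<star> bas \<beta>) =
      strip Va (bas \<alpha>) \<star> bas \<beta> + strip Vb (bas \<alpha>) \<star> weight (bas \<beta>) + bas \<alpha> \<star> strip Va (bas \<beta>)" (is ?a)
    and "vpart (bas \<alpha> \<star> bas \<beta>) = vpart (bas \<alpha>) \<star> vpart (bas \<beta>)" (is ?v)
proof -
  obtain h l h' l' where \<alpha>: "\<alpha> = (h, l)" and \<beta>: "\<beta> = (h', l')" by fastforce
  have "?b \<and> ?a \<and> ?v"
  proof (cases "l = [] \<and> l' = []")
    case True
    then show ?thesis by (simp add: \<alpha> \<beta> mul_vert_bas mul_simps)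
  next
    case False
    have P: "(h, l) \<in> P" "(h', l') \<in> P" "l \<noteq> [] \<or> l' \<noteq> []" using assms \<alpha> \<beta> False by auto
    let ?X = "\<lambda>l1. bas (h \<otimes> g, l1) \<star> bas (h', l')"
    let ?Y = "\<lambda>l1. bas (h, l) \<star> bas (h' \<otimes> g, l1)"
    have X: "?X l1 \<in> K" if "l = (h, i) # l1" for i l1 using that P by (intro mul_bas_K) auto
    have Y: "?Y l1 \<in> K" if "l' = (h', i) # l1" for i l1 using that P by (intro mul_bas_K) auto
    have l: "l = [] \<or> (\<exists>i l1. l = (h, i) # l1)" and l': "l' = [] \<or> (\<exists>i l1. l' = (h', i) # l1)"
      using P by (cases l; cases l'; auto)+
    let ?A = "case l of [] \<Rightarrow> 0 | x # l1 \<Rightarrow> attach (snd x) (?X l1) +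
       (if snd x = Vb then attach Va (scl (shift h') (?X l1)) else 0)"
    let ?B = "case l' of [] \<Rightarrow> 0 | y # l1 \<Rightarrow> attach (snd y) (?Y l1)"
    have A: "strip Vb ?A = strip Vb (bas \<alpha>) \<star> bas \<beta>"
      "strip Va ?A = strip Va (bas \<alpha>) \<star> bas \<beta> + strip Vb (bas \<alpha>) \<star> weight (bas \<beta>)"
      "vpart ?A = 0"
    proof -
      from l consider "l = []" | i l1 where "l = (h, i) # l1" by blast
      then have "strip Vb ?A = strip Vb (bas \<alpha>) \<star> bas \<beta> \<and>
        strip Va ?A = strip Va (bas \<alpha>) \<star> bas \<beta> + strip Vb (bas \<alpha>) \<star> weight (bas \<beta>) \<and> vpart ?A = 0"
      proof cases
        case 2
        then show ?thesis using X[OF 2] K_scl[OF X[OF 2]]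
          by (cases i) (simp_all add: \<alpha> \<beta> ops_simps strip_attach vpart_attach mul_simps)
      qed (simp add: \<alpha> ops_simps mul_simps)
      then show "strip Vb ?A = strip Vb (bas \<alpha>) \<star> bas \<beta>"
        "strip Va ?A = strip Va (bas \<alpha>) \<star> bas \<beta> + strip Vb (bas \<alpha>) \<star> weight (bas \<beta>)" "vpart ?A = 0"
        by blast+
    qed
    have B: "strip j ?B = bas \<alpha> \<star> strip j (bas \<beta>)" "vpart ?B = 0" for j
    proof -
      from l' consider "l' = []" | i l1 where "l' = (h', i) # l1" by blast
      then have "strip j ?B = bas \<alpha> \<star> strip j (bas \<beta>) \<and> vpart ?B = 0"
      proof cases
        case 2
        then show ?thesis using Y[OF 2]
          by (simp add: \<alpha> \<beta> ops_simps strip_attach vpart_attach mul_simps)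
      qed (simp add: \<beta> ops_simps mul_simps)
      then show "strip j ?B = bas \<alpha> \<star> strip j (bas \<beta>)" "vpart ?B = 0" by blast+
    qed
    have eq: "bas \<alpha> \<star> bas \<beta> = ?A + ?B" unfolding \<alpha> \<beta> by (rule mul_bas_rec[OF P])
    have "vpart (bas \<alpha>) = 0 \<or> vpart (bas \<beta>) = 0" using P(3) by (auto simp: \<alpha> \<beta>)
    then have "vpart (bas \<alpha>) \<star> vpart (bas \<beta>) = 0" by (auto simp: mul_simps)
    then show ?thesis unfolding eq ops_add A B by simp
  qed
  then show ?b ?a ?v by blast+
qed

text \<open>Every path of the product starts at the product of the two start vertices, where
  \<open>shift\<close> adds up.\<close>

lemma weight_mul_bas:
  assumes "\<alpha> \<in> P" "\<beta> \<in> P"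
  shows "weight (bas \<alpha> \<star> bas \<beta>) = weight (bas \<alpha>) \<star> bas \<beta> + bas \<alpha> \<star> weight (bas \<beta>)"
proof -
  have "weight (place m x) = scl (shift m) (place m x)" for m x
    by (rule lin_eq[OF lin_comp[OF lin_ops(3) lin_ops(5)] lin_scale[OF lin_ops(5)]]) simp
  then have "weight (bas \<alpha> \<star> bas \<beta>) = scl (shift (fst \<alpha> \<otimes> fst \<beta>)) (bas \<alpha> \<star> bas \<beta>)"
    by (simp add: mul_bas path_mul_eq place_def)
  then show ?thesis
    using assms[THEN paths_fst] by (simp add: mul_simps shift_mult vs.scale_left_distrib)
qed

lemma strip_Vb_mul:
  assumes "x \<in> K" "y \<in> K" shows "strip Vb (x \<star> y) = strip Vb x \<star> y + x \<star> strip Vb y"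
  by (rule bilin_eq_on_supp[of x P y P "\<lambda>x y. strip Vb (x \<star> y)"
      "\<lambda>x y. strip Vb x \<star> y + x \<star> strip Vb y", OF assms];
    (rule linI; simp add: ops_simps mul_simps vs.scale_right_distrib add_ac)?)
    (rule strip_mul_bas(1))

lemma strip_Va_mul:
  assumes "x \<in> K" "y \<in> K"
  shows "strip Va (x \<star> y) = strip Va x \<star> y + strip Vb x \<star> weight y + x \<star> strip Va y"
  by (rule bilin_eq_on_supp[of x P y P "\<lambda>x y. strip Va (x \<star> y)"
      "\<lambda>x y. strip Va x \<star> y + strip Vb x \<star> weight y + x \<star> strip Va y", OF assms];
    (rule linI; simp add: ops_simps mul_simps vs.scale_right_distrib add_ac)?)
    (rule strip_mul_bas(2))

lemma vpart_mul:
  assumes "x \<in> K" "y \<in> K" shows "vpart (x \<star> y) = vpart x \<star> vpart y"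
  by (rule bilin_eq_on_supp[of x P y P "\<lambda>x y. vpart (x \<star> y)" "\<lambda>x y. vpart x \<star> vpart y", OF assms];
    (rule linI; simp add: ops_simps mul_simps vs.scale_right_distrib add_ac)?)
    (rule strip_mul_bas(3))

lemma weight_mul:
  assumes "x \<in> K" "y \<in> K" shows "weight (x \<star> y) = weight x \<star> y + x \<star> weight y"
  by (rule bilin_eq_on_supp[of x P y P "\<lambda>x y. weight (x \<star> y)"
      "\<lambda>x y. weight x \<star> y + x \<star> weight y", OF assms];
    (rule linI; simp add: ops_simps mul_simps vs.scale_right_distrib add_ac)?)
    (rule weight_mul_bas)

lemmas strip_mul = strip_Va_mul strip_Vb_mul

text \<open>Stripping reduces to shorter triples. For \<open>Va\<close> the derivation property of
  \<open>weight\<close> makes the six terms of the two expansions agree; \<open>weight\<close> only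
  rescales a basis path, so the induction hypothesis covers the weighted terms too.\<close>

lemma mul_assoc_bas:
  "\<alpha> \<in> P \<Longrightarrow> \<beta> \<in> P \<Longrightarrow> \<gamma> \<in> P \<Longrightarrow> bas \<alpha> \<star> bas \<beta> \<star> bas \<gamma> = bas \<alpha> \<star> (bas \<beta> \<star> bas \<gamma>)"
proof (induction "length (snd \<alpha>) + length (snd \<beta>) + length (snd \<gamma>)"
    arbitrary: \<alpha> \<beta> \<gamma> rule: less_induct)
  case less
  let ?a = "bas \<alpha>" and ?b = "bas \<beta>" and ?c = "bas \<gamma>"
  note P = less.prems
  have K: "?a \<in> K" "?b \<in> K" "?c \<in> K" using P by simp_all
  \<comment> \<open>A strip of a basis path is zero or a strictly shorter basis path.\<close>
  have 1: "strip j ?a \<star> ?b \<star> ?c = strip j ?a \<star> (?b \<star> ?c)" for j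
    using P(1) by (rule strip_bas_cases[of \<alpha> j]) (use less.hyps P in \<open>auto simp: mul_simps\<close>)
  have 2: "?a \<star> strip j ?b \<star> ?c = ?a \<star> (strip j ?b \<star> ?c)" for j
    using P(2) by (rule strip_bas_cases[of \<beta> j]) (use less.hyps P in \<open>auto simp: mul_simps\<close>)
  have 3: "?a \<star> ?b \<star> strip j ?c = ?a \<star> (?b \<star> strip j ?c)" for j
    using P(3) by (rule strip_bas_cases[of \<gamma> j]) (use less.hyps P in \<open>auto simp: mul_simps\<close>)
  have v: "vpart (bas \<delta>) = 0 \<or> (\<exists>h\<in>carrier G. vpart (bas \<delta>) = bas (h, []))" if "\<delta> \<in> P" for \<delta>
    using paths_fst[OF that] by (cases \<delta>) auto
  note Ks = mul_K K
  show ?case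
  proof (rule K_eqI)
    show "vpart (?a \<star> ?b \<star> ?c) = vpart (?a \<star> (?b \<star> ?c))"
      using v[OF P(1)] v[OF P(2)] v[OF P(3)]
      by (auto simp: vpart_mul[OF Ks(2,3)] vpart_mul[OF mul_K[OF Ks(2,3)] Ks(4)] vpart_mul[OF Ks(3,4)]
          vpart_mul[OF Ks(2) mul_K[OF Ks(3,4)]] mul_simps mul_vert_bas m_assoc)
  next
    show "strip Va (?a \<star> ?b \<star> ?c) = strip Va (?a \<star> (?b \<star> ?c))"
      unfolding strip_Va_mul[OF Ks(2,3)] strip_Va_mul[OF mul_K[OF Ks(2,3)] Ks(4)] strip_Va_mul[OF Ks(3,4)]
        strip_Va_mul[OF Ks(2) mul_K[OF Ks(3,4)]] strip_Vb_mul[OF Ks(2,3)] strip_Vb_mul[OF Ks(3,4)]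
        weight_mul[OF Ks(3,4)]
      by (simp add: mul_simps 1 2 3 vs.scale_right_distrib add_ac)
  next
    show "strip Vb (?a \<star> ?b \<star> ?c) = strip Vb (?a \<star> (?b \<star> ?c))"
      unfolding strip_Vb_mul[OF mul_K[OF Ks(2,3)] Ks(4)] strip_Vb_mul[OF Ks(2) mul_K[OF Ks(3,4)]]
        strip_Vb_mul[OF Ks(2,3)] strip_Vb_mul[OF Ks(3,4)]
      by (simp add: mul_simps 1 2 3 vs.scale_right_distrib add_ac)
  qed (intro mul_K K)+
qed

lemma mul_assoc:
  assumes "x \<in> K" "y \<in> K" "z \<in> K" shows "x \<star> y \<star> z = x \<star> (y \<star> z)"
proof (rule lin_eq_on_supp[OF assms(3), of "\<lambda>z. x \<star> y \<star> z" "\<lambda>z. x \<star> (y \<star> z)"])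
  fix \<gamma> assume \<gamma>: "\<gamma> \<in> P"
  show "x \<star> y \<star> bas \<gamma> = x \<star> (y \<star> bas \<gamma>)"
  proof (rule bilin_eq_on_supp[of x P y P "\<lambda>x y. x \<star> y \<star> bas \<gamma>" "\<lambda>x y. x \<star> (y \<star> bas \<gamma>)", OF assms(1,2)])
    fix \<alpha> \<beta> assume "\<alpha> \<in> P" "\<beta> \<in> P"
    then show "bas \<alpha> \<star> bas \<beta> \<star> bas \<gamma> = bas \<alpha> \<star> (bas \<beta> \<star> bas \<gamma>)"
      using \<gamma> by (rule mul_assoc_bas)
  qed (rule linI; simp add: mul_simps)+
qed (rule linI; simp add: mul_simps)+

end

section \<open>The bialgebra structure\<close>

lemma lookup_lin_ext:
  "Poly_Mapping.lookup (lin_ext f x) k =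
     (\<Sum>e\<in>Poly_Mapping.keys x. Poly_Mapping.lookup x e * Poly_Mapping.lookup (f e) k)"
  by (simp add: lin_ext_def lookup_sum_pm)

text \<open>The counit is read as a coefficient in the one-dimensional space over
  \<open>unit\<close>, so that results on \<open>lin_ext\<close> cover this scalar-valued
  map.\<close>

lemma kQ_counit_eq:
  "kQ_counit x = Poly_Mapping.lookup (lin_ext (\<lambda>\<alpha>. if snd \<alpha> = [] then bas () else 0) x) ()"
  unfolding kQ_counit_def lookup_lin_ext by (intro sum.cong) (auto simp: lookup_bas)

lemma kQ_counit_add: "kQ_counit (x + y) = kQ_counit x + kQ_counit y"
  and kQ_counit_scl: "kQ_counit (scl c x) = c * kQ_counit x"
  and kQ_counit_zero: "kQ_counit 0 = 0"
  and kQ_counit_bas: "kQ_counit (bas \<alpha>) = (if snd \<alpha> = [] then 1 else 0)"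
  by (simp_all add: kQ_counit_eq lin_ext_add lin_ext_scl lookup_add lookup_bas)

lemmas counit_simps = kQ_counit_add kQ_counit_scl kQ_counit_zero

lemma linear_kQ_counit: "Vector_Spaces.linear scl (*) (kQ_counit :: ('g path \<Rightarrow>\<^sub>0 'k::field) \<Rightarrow> 'k)"
proof -
  have "vector_space ((*) :: 'k \<Rightarrow> 'k \<Rightarrow> 'k)"
    by unfold_locales (simp_all add: algebra_simps)
  then show ?thesis
    by (simp add: Vector_Spaces.linear_iff vs.vector_space_axioms counit_simps)
qed

section \<open>Deconcatenation: coassociativity, counit laws and pointedness\<close>

lemma lin_comult [simp]: "lin (kQ_comult G g)"
  by (simp add: kQ_comult_def)

lemmas comult_simps = lin_add[OF lin_comult] lin_scl[OF lin_comult] lin_zero[OF lin_comult]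

lemma comult_bas:
  "kQ_comult G g (bas (h, l)) =
     (\<Sum>i\<le>length l. bas ((vertex_at G g (h, l) i, drop i l), (h, take i l)))"
  by (simp add: kQ_comult_def)

lemma comult_vertex: "kQ_comult G g (bas (h, [])) = bas ((h, []), (h, []))"
  by (simp add: comult_bas)

lemma comult_Cons:
  "kQ_comult G g (bas (h, x # l)) = bas ((h, x # l), (h, [])) +
     (\<Sum>i\<le>length l. bas ((vertex_at G g (target G g x, l) i, drop i l), (h, x # take i l)))"
  by (simp add: comult_bas sum.atMost_Suc_shift vertex_at_Cons del: sum.atMost_Suc)

lemma vertex_at_drop:
  "i + j \<le> length l \<Longrightarrow> vertex_at G g (vertex_at G g (h, l) i, drop i l) j = vertex_at G g (h, l) (i + j)"
  by (auto simp: vertex_at_def)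

lemma vertex_at_take: "j \<le> i \<Longrightarrow> i \<le> length l \<Longrightarrow> vertex_at G g (h, take i l) j = vertex_at G g (h, l) j"
  by (auto simp: vertex_at_def)

lemma tens_assoc_bas: "tens_assoc (bas ((d, e), f)) = bas (d, e, f)"
  by (simp add: tens_assoc_def)

lemma lin_tens_assoc [simp]: "lin tens_assoc"
  by (simp add: tens_assoc_def)

lemma sum_nested_eq:
  fixes F :: "nat \<Rightarrow> nat \<Rightarrow> 'a::comm_monoid_add"
  shows "(\<Sum>i\<le>m. \<Sum>j\<le>m - i. F i j) = (\<Sum>k\<le>m. \<Sum>i\<le>k. F i (k - i))"
proof -
  have "(\<Sum>i\<le>m. \<Sum>j\<le>m - i. F i j) = (\<Sum>(i, j)\<in>(SIGMA i:{..m}. {..m - i}). F i j)"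
    by (rule sum.Sigma) auto
  also have "(SIGMA i:{..m}. {..m - i}) = {(i, j). i + j \<le> m}"
    by auto
  finally show ?thesis by (simp add: sum.triangle_reindex_eq)
qed

text \<open>Both iterates cut a path at two places. The left one counts the second cut from the
  first, and \<open>sum_nested_eq\<close> passes to absolute positions i \<le> k.\<close>

lemma coassoc:
  "tens_assoc (tens_map (kQ_comult G g) id (kQ_comult G g x)) =
   tens_map id (kQ_comult G g) (kQ_comult G g x)"
proof (rule lin_eq[of "\<lambda>x. tens_assoc (tens_map (kQ_comult G g) id (kQ_comult G g x))"
      "\<lambda>x. tens_map id (kQ_comult G g) (kQ_comult G g x)"])
  show "lin (\<lambda>x. tens_assoc (tens_map (kQ_comult G g) id (kQ_comult G g x)))"
    by (intro lin_comp[OF lin_tens_assoc] lin_comp[OF lin_tens_map] lin_comult)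
  show "lin (\<lambda>x. tens_map id (kQ_comult G g) (kQ_comult G g x))"
    by (intro lin_comp[OF lin_tens_map] lin_comult)
  fix \<alpha> :: "'a path"
  obtain h l where \<alpha>: "\<alpha> = (h, l)" by fastforce
  let ?v = "vertex_at G g (h, l)"
  have "tens_assoc (tens_map (kQ_comult G g) id (kQ_comult G g (bas \<alpha>))) =
    (\<Sum>i\<le>length l. \<Sum>j\<le>length l - i.
       bas ((?v (i + j), drop (i + j) l), (?v i, take j (drop i l)), (h, take i l)))"
    unfolding \<alpha> comult_bas lin_sum[OF lin_tens_map] lin_sum[OF lin_tens_assoc]
    by (intro sum.cong refl)
      (simp add: tens_map_bas comult_bas lin_sum[OF lin_tens(2)] lin_sum[OF lin_tens_assoc]
        tens_assoc_bas vertex_at_drop add.commute)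
  also have "\<dots> = (\<Sum>k\<le>length l. \<Sum>i\<le>k.
       bas ((?v (i + (k - i)), drop (i + (k - i)) l), (?v i, take (k - i) (drop i l)), (h, take i l)))"
    by (rule sum_nested_eq)
  also have "\<dots> = tens_map id (kQ_comult G g) (kQ_comult G g (bas \<alpha>))"
    unfolding \<alpha> comult_bas lin_sum[OF lin_tens_map]
    by (intro sum.cong refl)
      (simp add: tens_map_bas comult_bas lin_sum[OF lin_tens(1)] vertex_at_take drop_take min_def)
  finally show "tens_assoc (tens_map (kQ_comult G g) id (kQ_comult G g (bas \<alpha>))) =
    tens_map id (kQ_comult G g) (kQ_comult G g (bas \<alpha>))" .
qed

lemma counit_left: "lin_ext (\<lambda>(x, y). scl (kQ_counit (bas x)) (bas y)) (kQ_comult G g x) = x"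
proof (rule lin_eq[OF lin_comp[OF lin_lin_ext lin_comult] lin_id(2)])
  fix \<alpha> :: "'a path"
  obtain h l where \<alpha>: "\<alpha> = (h, l)" by fastforce
  have "lin_ext (\<lambda>(x, y). scl (kQ_counit (bas x)) (bas y)) (kQ_comult G g (bas \<alpha>)) =
    (\<Sum>i\<le>length l. if i = length l then bas (h, l) else 0)"
    unfolding \<alpha> comult_bas lin_ext_sum by (intro sum.cong refl) (simp add: kQ_counit_bas)
  then show "lin_ext (\<lambda>(x, y). scl (kQ_counit (bas x)) (bas y)) (kQ_comult G g (bas \<alpha>)) = bas \<alpha>"
    by (simp add: \<alpha>)
qed

lemma counit_right: "lin_ext (\<lambda>(x, y). scl (kQ_counit (bas y)) (bas x)) (kQ_comult G g x) = x"
proof (rule lin_eq[OF lin_comp[OF lin_lin_ext lin_comult] lin_id(2)])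
  fix \<alpha> :: "'a path"
  obtain h l where \<alpha>: "\<alpha> = (h, l)" by fastforce
  have "lin_ext (\<lambda>(x, y). scl (kQ_counit (bas y)) (bas x)) (kQ_comult G g (bas \<alpha>)) =
    (\<Sum>i\<le>length l. if i = 0 then bas (h, l) else 0)"
    unfolding \<alpha> comult_bas lin_ext_sum by (intro sum.cong refl) (auto simp: kQ_counit_bas)
  then show "lin_ext (\<lambda>(x, y). scl (kQ_counit (bas y)) (bas x)) (kQ_comult G g (bas \<alpha>)) = bas \<alpha>"
    by (simp add: \<alpha>)
qed

text \<open>The coefficient of a longest path in the right leg of \<open>\<Delta> x\<close> is a nonzero multiple of a
  vertex, so every nonzero subcoalgebra contains a vertex.\<close>

lemma subcoalgebra_contains_vertex:
  fixes C :: "('g path \<Rightarrow>\<^sub>0 'k::field) set"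
  assumes C: "subcoalgebra (kQ_comult G g) C" "C \<noteq> {0}"
  shows "\<exists>v. bas (v, []) \<in> C"
proof -
  have \<Delta>: "kQ_comult G g x \<in> tensor_space C C" if "x \<in> C" for x
    using C(1) that by (auto simp: subcoalgebra_def)
  have sub: "vs.subspace C" using C(1) by (simp add: subcoalgebra_def)
  then obtain x where x: "x \<in> C" "x \<noteq> 0" using C(2) vs.subspace_0 by blast
  have fin: "finite ((\<lambda>\<alpha>. length (snd \<alpha>)) ` Poly_Mapping.keys x)" by simp
  have "(\<lambda>\<alpha>. length (snd \<alpha>)) ` Poly_Mapping.keys x \<noteq> {}" using x(2) by simp
  from Max_in[OF fin this] obtain \<alpha> where \<alpha>: "\<alpha> \<in> Poly_Mapping.keys x"
    and max: "length (snd \<alpha>) = Max ((\<lambda>\<alpha>. length (snd \<alpha>)) ` Poly_Mapping.keys x)" by auto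
  have le: "length (snd \<beta>) \<le> length (snd \<alpha>)" if "\<beta> \<in> Poly_Mapping.keys x" for \<beta>
    unfolding max using that by (intro Max_ge fin) auto
  define R :: "('g path \<times> 'g path \<Rightarrow>\<^sub>0 'k) \<Rightarrow> ('g path \<Rightarrow>\<^sub>0 'k)"
    where "R = lin_ext (\<lambda>(d, e). if e = \<alpha> then bas d else 0)"
  have linR: "lin R" by (simp add: R_def)
  have R_bas: "R (bas (d, e)) = (if e = \<alpha> then bas d else 0)" for d e by (simp add: R_def)
  have R_tens: "R (y \<boxtimes> z) = scl (Poly_Mapping.lookup z \<alpha>) y" for y z
  proof (rule bilin_eq_on_supp[of y UNIV z UNIV "\<lambda>y z. R (y \<boxtimes> z)" "\<lambda>y z. scl (Poly_Mapping.lookup z \<alpha>) y"])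
    fix y z
    show "lin (\<lambda>y. R (y \<boxtimes> z))" "lin (\<lambda>z. R (y \<boxtimes> z))"
      by (intro lin_comp[OF linR] lin_tens)+
    show "lin (scl (Poly_Mapping.lookup z \<alpha>))" by (intro lin_scale lin_id)
    show "lin (\<lambda>z. scl (Poly_Mapping.lookup z \<alpha>) y)"
      by (rule linI) (simp_all add: lookup_add vs.scale_left_distrib)
  qed (simp_all add: R_bas lookup_bas)
  have "R (kQ_comult G g x) \<in> C"
  proof (rule lin_maps_span[OF linR sub \<Delta>[OF x(1), unfolded tensor_space_def]])
    fix e assume "e \<in> {x \<boxtimes> y |x y. x \<in> C \<and> y \<in> C}"
    then show "R e \<in> C" using R_tens vs.subspace_scale[OF sub] by auto
  qed
  moreover have "R (kQ_comult G g x) = scl (Poly_Mapping.lookup x \<alpha>) (bas (vertex_at G g \<alpha> (length (snd \<alpha>)), []))"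
  proof -
    have *: "R (kQ_comult G g (bas \<beta>)) =
        (if \<beta> = \<alpha> then bas (vertex_at G g \<alpha> (length (snd \<alpha>)), []) else 0)"
      if "\<beta> \<in> Poly_Mapping.keys x" for \<beta>
    proof -
      obtain h l where \<beta>: "\<beta> = (h, l)" by fastforce
      \<comment> \<open>A right leg equal to the longest path \<open>\<alpha>\<close> must be all of
        \<open>\<beta>\<close>, so only the last cut survives, and only for
        \<open>\<beta> = \<alpha>\<close>.\<close>
      have "R (kQ_comult G g (bas \<beta>)) = (\<Sum>i\<le>length l. if i = length l then
          (if \<beta> = \<alpha> then bas (vertex_at G g \<alpha> (length (snd \<alpha>)), []) else 0) else 0)"
        unfolding \<beta> comult_bas lin_sum[OF linR] R_bas
        using le[OF that] by (intro sum.cong refl) (auto simp: \<beta>)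
      then show ?thesis by simp
    qed
    have "R (kQ_comult G g x) = lin_ext (\<lambda>\<beta>. R (kQ_comult G g (bas \<beta>))) x"
      by (rule lin_eq_lin_ext[OF lin_comp[OF linR lin_comult]])
    also have "\<dots> = lin_ext (\<lambda>\<beta>. if \<beta> = \<alpha> then bas (vertex_at G g \<alpha> (length (snd \<alpha>)), []) else 0) x"
      by (rule lin_ext_cong) (rule *)
    also have "\<dots> = scl (Poly_Mapping.lookup x \<alpha>) (bas (vertex_at G g \<alpha> (length (snd \<alpha>)), []))"
      unfolding lin_ext_def using \<alpha> by (simp add: if_distrib[of "scl _"] sum.delta' cong: if_cong)
    finally show ?thesis .
  qed
  ultimately have "scl (Poly_Mapping.lookup x \<alpha>) (bas (vertex_at G g \<alpha> (length (snd \<alpha>)), [])) \<in> C"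
    by simp
  then have "scl (inverse (Poly_Mapping.lookup x \<alpha>))
      (scl (Poly_Mapping.lookup x \<alpha>) (bas (vertex_at G g \<alpha> (length (snd \<alpha>)), []))) \<in> C"
    by (rule vs.subspace_scale[OF sub])
  moreover have "Poly_Mapping.lookup x \<alpha> \<noteq> 0" using \<alpha> by (simp add: in_keys_iff)
  ultimately show ?thesis by auto
qed

text \<open>The line through a vertex is a subcoalgebra, so minimality identifies a simple
  subcoalgebra with the line through a vertex that it contains.\<close>

lemma pointed_kQ_comult: "pointed H (kQ_comult G g)" for H :: "('g path \<Rightarrow>\<^sub>0 'k::field) set"
  unfolding pointed_def
proof (intro allI impI, elim conjE)
  fix C :: "('g path \<Rightarrow>\<^sub>0 'k) set" assume "simple_subcoalgebra (kQ_comult G g) C"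
  then have C: "subcoalgebra (kQ_comult G g) C" "C \<noteq> {0}"
    and min: "\<And>D. subcoalgebra (kQ_comult G g) D \<Longrightarrow> D \<subseteq> C \<Longrightarrow> D = {0} \<or> D = C"
    by (auto simp: simple_subcoalgebra_def)
  obtain v where v: "bas (v, []) \<in> C" using subcoalgebra_contains_vertex[OF C] by blast
  let ?b = "bas (v, []) :: 'g path \<Rightarrow>\<^sub>0 'k" let ?D = "vs.span {?b}"
  have "kQ_comult G g x \<in> tensor_space ?D ?D" if "x \<in> ?D" for x
    using that
  proof (rule lin_maps_span[OF lin_comult subspace_tensor_space])
    fix e assume "e \<in> {?b}"
    then have "kQ_comult G g e = ?b \<boxtimes> ?b" by (simp add: comult_vertex)
    then show "kQ_comult G g e \<in> tensor_space ?D ?D"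
      by (simp only:) (intro tens_in_tensor_space vs.span_base; simp)
  qed
  then have "subcoalgebra (kQ_comult G g) ?D" by (auto simp: subcoalgebra_def)
  moreover have "?D \<subseteq> C"
    using v C(1) by (intro vs.span_minimal) (auto simp: subcoalgebra_def)
  ultimately have "?D = {0} \<or> ?D = C" by (rule min)
  moreover have "?b \<in> ?D" by (intro vs.span_base) simp
  ultimately have "C = ?D" by (metis bas_nonzero singletonD)
  moreover have "vs.independent {?b}" by (simp add: vs.dependent_single)
  ultimately show "vs.dim C = 1"
    using vs.dim_eq_card_independent[of "{?b}"] by simp
qed

context jordan_quiver
begin

section \<open>Compatibility of coproduct and counit with the product\<close>

abbreviation tmul (infixl \<open>\<odot>\<close> 70) where "s \<odot> t \<equiv> tens_mul (kQ_mul G g act) s t"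
abbreviation \<Delta> :: "('g path \<Rightarrow>\<^sub>0 'k) \<Rightarrow> _" where "\<Delta> \<equiv> kQ_comult G g"
abbreviation KK :: "('g path \<times> 'g path \<Rightarrow>\<^sub>0 'k) set" where "KK \<equiv> supp (P \<times> P)"

lemma tmul_tens: "(x \<boxtimes> y) \<odot> t = tens_map (\<lambda>z. x \<star> z) (\<lambda>z. y \<star> z) t"
  by (rule tens_mul_tens) simp_all

lemma tmul_tens_tens: "(x \<boxtimes> y) \<odot> (x' \<boxtimes> y') = (x \<star> x') \<boxtimes> (y \<star> y')"
  by (simp add: tmul_tens tens_map_tens)

lemma tmul_bas: "bas (d, e) \<odot> bas (d', e') = (bas d \<star> bas d') \<boxtimes> (bas e \<star> bas e')"
  by (rule tens_mul_bas)

lemma tmul_bas_tens: "bas (d, e) \<odot> (x \<boxtimes> y) = (bas d \<star> x) \<boxtimes> (bas e \<star> y)"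
  "(x \<boxtimes> y) \<odot> bas (d, e) = (x \<star> bas d) \<boxtimes> (y \<star> bas e)"
  using tmul_tens_tens[of "bas d" "bas e" x y] tmul_tens_tens[of x y "bas d" "bas e"] by simp_all

lemmas tmul_simps = lin_add[OF lin_tens_mul(1)] lin_add[OF lin_tens_mul(2)]
  lin_scl[OF lin_tens_mul(1)] lin_scl[OF lin_tens_mul(2)]
  lin_zero[OF lin_tens_mul(1)] lin_zero[OF lin_tens_mul(2)]

lemma drop_take_paths:
  "(h, l) \<in> P \<Longrightarrow> i \<le> length l \<Longrightarrow> (vertex_at G g (h, l) i, drop i l) \<in> P \<and> (h, take i l) \<in> P"
proof (induction i arbitrary: h l)
  case 0 then show ?case using paths_fst by fastforce
next
  case (Suc i)
  then obtain x l1 where l: "l = x # l1" by (cases l) auto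
  have "(h \<otimes> g, l1) \<in> P" "i \<le> length l1" using Suc.prems l by auto
  from Suc.IH[OF this] show ?case using Suc.prems l by (simp add: vertex_at_Cons target_def)
qed

lemma comult_KK: assumes "x \<in> K" shows "\<Delta> x \<in> KK"
proof (rule lin_maps_supp[OF lin_comult subspace_supp assms])
  fix \<alpha> assume "\<alpha> \<in> P"
  moreover obtain h l where \<alpha>: "\<alpha> = (h, l)" by fastforce
  ultimately show "\<Delta> (bas \<alpha>) \<in> KK"
    unfolding \<alpha> comult_bas by (intro vs.subspace_sum[OF subspace_supp]) (simp add: drop_take_paths)
qed

lemma tmul_KK: assumes "s \<in> KK" "t \<in> KK" shows "s \<odot> t \<in> KK"
proof (rule lin_maps_supp[of "\<lambda>s. s \<odot> t", OF lin_tens_mul(2) subspace_supp assms(1)])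
  fix d assume d: "d \<in> P \<times> P"
  show "bas d \<odot> t \<in> KK"
  proof (rule lin_maps_supp[of "\<lambda>t. bas d \<odot> t", OF lin_tens_mul(1) subspace_supp assms(2)])
    fix e assume "e \<in> P \<times> P"
    with d show "bas d \<odot> bas e \<in> KK"
      using tens_in_supp[OF mul_bas_K mul_bas_K] by (cases d; cases e) (simp add: tmul_bas)
  qed
qed

lemma tdecompose:
  assumes "t \<in> KK"
  shows "t = tens_map id vpart t + tens_map id (attach Va) (tens_map id (strip Va) t) +
    tens_map id (attach Vb) (tens_map id (strip Vb) t)"
proof -
  have "tens_map id id t = tens_map id (\<lambda>x. vpart x + attach Va (strip Va x) + attach Vb (strip Vb x)) t"
    using assms by (rule tens_map_cong) (simp_all add: decompose[symmetric])
  then show ?thesis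
    by (simp add: tens_map_add_right tens_map_comp id_def)
qed

lemma KK_eqI:
  assumes "s \<in> KK" "t \<in> KK" "tens_map id vpart s = tens_map id vpart t"
    "tens_map id (strip Va) s = tens_map id (strip Va) t"
    "tens_map id (strip Vb) s = tens_map id (strip Vb) t"
  shows "s = t"
  using tdecompose[OF assms(1)] tdecompose[OF assms(2)] assms(3-5) by simp

text \<open>Right legs are initial segments, so all but the empty one begin with the first arrow.
  Stripping kills the term with empty right leg and leaves the cuts of the shortened path.\<close>

lemma comult_strip:
  assumes "x \<in> K" shows "tens_map id (strip j) (\<Delta> x) = \<Delta> (strip j x)"
proof (rule lin_eq_on_supp[OF assms lin_comp[OF lin_tens_map lin_comult] lin_comp[OF lin_comult lin_ops(1)]])
  fix \<alpha> assume \<alpha>: "\<alpha> \<in> P"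
  obtain h l where hl: "\<alpha> = (h, l)" by fastforce
  show "tens_map id (strip j) (\<Delta> (bas \<alpha>)) = \<Delta> (strip j (bas \<alpha>))"
  proof (cases l)
    case Nil then show ?thesis by (simp add: hl comult_vertex tens_map_bas comult_simps)
  next
    case (Cons x l1)
    obtain i where x: "x = (h, i)" using \<alpha> hl Cons by (cases x) auto
    show ?thesis
      by (simp add: hl Cons x comult_Cons lin_add[OF lin_tens_map] lin_sum[OF lin_tens_map] tens_map_bas
          comult_simps comult_bas[of G g "h \<otimes> g" l1] target_def)
  qed
qed

text \<open>Every right leg starts where the path starts.\<close>

lemma comult_weight:
  "tens_map id weight (\<Delta> x) = \<Delta> (weight x)"
proof (rule lin_eq[OF lin_comp[OF lin_tens_map lin_comult] lin_comp[OF lin_comult lin_ops(3)]])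
  fix \<alpha> :: "'g path"
  obtain h l where hl: "\<alpha> = (h, l)" by fastforce
  show "tens_map id weight (\<Delta> (bas \<alpha>)) = \<Delta> (weight (bas \<alpha>))"
    by (simp add: hl comult_bas lin_sum[OF lin_tens_map] tens_map_bas comult_simps
        lin_scl[OF lin_tens(1)] vs.scale_sum_right)
qed

text \<open>The component of \<Delta> whose right leg has length zero. It is multiplicative because
  start vertices multiply.\<close>

definition start_tens :: "('g path \<Rightarrow>\<^sub>0 'k) \<Rightarrow> ('g path \<times> 'g path \<Rightarrow>\<^sub>0 'k)" where
  "start_tens = lin_ext (\<lambda>\<alpha>. bas (\<alpha>, (fst \<alpha>, [])))"

lemma comult_vpart: "tens_map id vpart (\<Delta> x) = start_tens x"
proof (rule lin_eq[OF lin_comp[OF lin_tens_map lin_comult]])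
  show "lin start_tens" by (simp add: start_tens_def)
  fix \<alpha> :: "'g path"
  obtain h l where hl: "\<alpha> = (h, l)" by fastforce
  show "tens_map id vpart (\<Delta> (bas \<alpha>)) = start_tens (bas \<alpha>)"
  proof (cases l)
    case Nil then show ?thesis by (simp add: hl comult_vertex tens_map_bas start_tens_def)
  next
    case (Cons x l1)
    then show ?thesis
      by (simp add: hl comult_Cons lin_add[OF lin_tens_map] lin_sum[OF lin_tens_map] tens_map_bas start_tens_def)
  qed
qed

lemma start_tens_mul_bas: "start_tens (bas \<alpha> \<star> bas \<beta>) = start_tens (bas \<alpha>) \<odot> start_tens (bas \<beta>)"
proof -
  have "start_tens (place m x) = place m x \<boxtimes> bas (m, [])" for m x
    by (rule lin_eq[OF lin_comp[OF _ lin_ops(5)] lin_comp[OF lin_tens(2) lin_ops(5)]])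
      (simp_all add: start_tens_def)
  then have "start_tens (bas \<alpha> \<star> bas \<beta>) = (bas \<alpha> \<star> bas \<beta>) \<boxtimes> bas (fst \<alpha> \<otimes> fst \<beta>, [])"
    by (simp add: mul_bas path_mul_eq place_def)
  then show ?thesis by (simp add: start_tens_def tmul_bas mul_vert_bas)
qed

text \<open>The Leibniz rules carried to the right leg, while the left legs are simply
  multiplied.\<close>

lemma tens_map_tmul:
  assumes "s \<in> KK" "t \<in> KK"
  shows "tens_map id vpart (s \<odot> t) = tens_map id vpart s \<odot> tens_map id vpart t" (is ?v)
    and "tens_map id (strip Vb) (s \<odot> t) =
      tens_map id (strip Vb) s \<odot> t + s \<odot> tens_map id (strip Vb) t" (is ?b)
    and "tens_map id (strip Va) (s \<odot> t) = tens_map id (strip Va) s \<odot> t +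
      tens_map id (strip Vb) s \<odot> tens_map id weight t + s \<odot> tens_map id (strip Va) t" (is ?a)
proof -
  note ss = tmul_simps lin_add[OF lin_tens_map] lin_scl[OF lin_tens_map] vs.scale_right_distrib add_ac
  note bs = tmul_bas tmul_bas_tens tens_map_bas tens_map_tens tmul_tens_tens lin_add[OF lin_tens(1)]
  show ?v
  proof (rule bilin_eq_on_supp[of s "P \<times> P" t "P \<times> P" "\<lambda>s t. tens_map id vpart (s \<odot> t)"
        "\<lambda>s t. tens_map id vpart s \<odot> tens_map id vpart t", OF assms])
    fix d e assume "d \<in> P \<times> P" "e \<in> P \<times> P"
    then show "tens_map id vpart (bas d \<odot> bas e) = tens_map id vpart (bas d) \<odot> tens_map id vpart (bas e)"
      by (cases d; cases e) (simp add: bs strip_mul_bas del: vpart_bas)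
  qed (rule linI; simp add: ss)+
  show ?b
  proof (rule bilin_eq_on_supp[of s "P \<times> P" t "P \<times> P" "\<lambda>s t. tens_map id (strip Vb) (s \<odot> t)"
        "\<lambda>s t. tens_map id (strip Vb) s \<odot> t + s \<odot> tens_map id (strip Vb) t", OF assms])
    fix d e assume "d \<in> P \<times> P" "e \<in> P \<times> P"
    then show "tens_map id (strip Vb) (bas d \<odot> bas e) =
        tens_map id (strip Vb) (bas d) \<odot> bas e + bas d \<odot> tens_map id (strip Vb) (bas e)"
      by (cases d; cases e) (simp add: bs strip_mul_bas)
  qed (rule linI; simp add: ss)+
  show ?a
  proof (rule bilin_eq_on_supp[of s "P \<times> P" t "P \<times> P" "\<lambda>s t. tens_map id (strip Va) (s \<odot> t)"
        "\<lambda>s t. tens_map id (strip Va) s \<odot> t +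
          tens_map id (strip Vb) s \<odot> tens_map id weight t + s \<odot> tens_map id (strip Va) t", OF assms])
    fix d e assume "d \<in> P \<times> P" "e \<in> P \<times> P"
    then show "tens_map id (strip Va) (bas d \<odot> bas e) = tens_map id (strip Va) (bas d) \<odot> bas e +
        tens_map id (strip Vb) (bas d) \<odot> tens_map id weight (bas e) + bas d \<odot> tens_map id (strip Va) (bas e)"
      by (cases d; cases e) (simp add: bs strip_mul_bas del: weight_bas)
  qed (rule linI; simp add: ss)+
qed

text \<open>\<open>KK_eqI\<close> compares right legs. By \<open>comult_strip\<close> and
  \<open>comult_weight\<close> the two Leibniz expansions consist of coproducts of shorter products,
  which the induction hypothesis matches; the component of length zero is
  \<open>start_tens\<close>.\<close>

lemma comult_mul_bas: "\<alpha> \<in> P \<Longrightarrow> \<beta> \<in> P \<Longrightarrow> \<Delta> (bas \<alpha> \<star> bas \<beta>) = \<Delta> (bas \<alpha>) \<odot> \<Delta> (bas \<beta>)"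
proof (induction "length (snd \<alpha>) + length (snd \<beta>)" arbitrary: \<alpha> \<beta> rule: less_induct)
  case less
  let ?a = "bas \<alpha>" and ?b = "bas \<beta>"
  note P = less.prems
  have K: "?a \<in> K" "?b \<in> K" using P by simp_all
  have KK: "\<Delta> ?a \<in> KK" "\<Delta> ?b \<in> KK" "\<Delta> (?a \<star> ?b) \<in> KK" "\<Delta> ?a \<odot> \<Delta> ?b \<in> KK"
    using comult_KK[OF K(1)] comult_KK[OF K(2)] comult_KK[OF mul_K[OF K]] tmul_KK by blast+
  have 1: "\<Delta> (strip j ?a \<star> ?b) = \<Delta> (strip j ?a) \<odot> \<Delta> ?b" for j
    using P(1) by (rule strip_bas_cases[of \<alpha> j])
      (use less.hyps P in \<open>auto simp: mul_simps comult_simps tmul_simps\<close>)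
  have 2: "\<Delta> (?a \<star> strip j ?b) = \<Delta> ?a \<odot> \<Delta> (strip j ?b)" for j
    using P(2) by (rule strip_bas_cases[of \<beta> j])
      (use less.hyps P in \<open>auto simp: mul_simps comult_simps tmul_simps\<close>)
  note st = comult_strip[OF K(1)] comult_strip[OF K(2)] comult_strip[OF mul_K[OF K]]
  show ?case
  proof (rule KK_eqI[OF KK(3,4)])
    show "tens_map id vpart (\<Delta> (?a \<star> ?b)) = tens_map id vpart (\<Delta> ?a \<odot> \<Delta> ?b)"
      unfolding tens_map_tmul(1)[OF KK(1,2)] comult_vpart by (rule start_tens_mul_bas)
    show "tens_map id (strip Va) (\<Delta> (?a \<star> ?b)) = tens_map id (strip Va) (\<Delta> ?a \<odot> \<Delta> ?b)"
      unfolding tens_map_tmul(3)[OF KK(1,2)] comult_weight st strip_mul_bas(2)[OF P]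
      by (simp add: comult_simps mul_simps 1 2 tmul_simps)
    show "tens_map id (strip Vb) (\<Delta> (?a \<star> ?b)) = tens_map id (strip Vb) (\<Delta> ?a \<odot> \<Delta> ?b)"
      unfolding tens_map_tmul(2)[OF KK(1,2)] st strip_mul_bas(1)[OF P]
      by (simp add: comult_simps 1 2)
  qed
qed

lemma comult_mul:
  assumes "x \<in> K" "y \<in> K" shows "\<Delta> (x \<star> y) = \<Delta> x \<odot> \<Delta> y"
  by (rule bilin_eq_on_supp[of x P y P "\<lambda>x y. \<Delta> (x \<star> y)" "\<lambda>x y. \<Delta> x \<odot> \<Delta> y", OF assms];
    (rule linI; simp add: comult_simps mul_simps tmul_simps)?)
    (rule comult_mul_bas)

lemma counit_mul:
  assumes "x \<in> K" "y \<in> K" shows "kQ_counit (x \<star> y) = kQ_counit x * kQ_counit y"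
proof -
  have v: "kQ_counit (vpart z) = kQ_counit z" for z :: "'g path \<Rightarrow>\<^sub>0 'k"
  proof -
    have "lin_ext (\<lambda>\<alpha>. if snd \<alpha> = [] then bas () else 0) (vpart z) =
      (lin_ext (\<lambda>\<alpha>. if snd \<alpha> = [] then bas () else 0) z :: unit \<Rightarrow>\<^sub>0 'k)"
      by (rule lin_eq[OF lin_comp[OF lin_lin_ext lin_ops(2)] lin_lin_ext]) (simp add: vpart_def case_prod_unfold)
    then show ?thesis by (simp add: kQ_counit_eq)
  qed
  \<comment> \<open>Scalars become vectors over \<open>unit\<close>, since
    \<open>bilin_eq_on_supp\<close> speaks of vector-valued maps.\<close>
  let ?s = "\<lambda>c. scl c (bas ()) :: unit \<Rightarrow>\<^sub>0 'k"
  have "?s (kQ_counit (x \<star> y)) = ?s (kQ_counit x * kQ_counit y)"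
  proof (rule bilin_eq_on_supp[of x P y P "\<lambda>x y. ?s (kQ_counit (x \<star> y))"
        "\<lambda>x y. ?s (kQ_counit x * kQ_counit y)", OF assms])
    fix \<alpha> \<beta> assume P: "\<alpha> \<in> P" "\<beta> \<in> P"
    have "kQ_counit (bas \<alpha> \<star> bas \<beta>) = kQ_counit (vpart (bas \<alpha>) \<star> vpart (bas \<beta>))"
      using strip_mul_bas(3)[OF P] v by metis
    also have "\<dots> = kQ_counit (bas \<alpha>) * kQ_counit (bas \<beta>)"
      by (cases \<alpha>; cases \<beta>) (simp add: mul_vert_bas kQ_counit_bas mul_simps kQ_counit_zero)
    finally show "?s (kQ_counit (bas \<alpha> \<star> bas \<beta>)) = ?s (kQ_counit (bas \<alpha>) * kQ_counit (bas \<beta>))" by simp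
  qed (rule linI; simp add: mul_simps counit_simps vs.scale_left_distrib algebra_simps)+
  then show ?thesis by (metis lookup_scl lookup_bas mult.right_neutral)
qed

end

section \<open>The antipode\<close>

context jordan_quiver
begin

abbreviation "u \<equiv> vert \<one> :: 'g path \<Rightarrow>\<^sub>0 'k"

lemma vert_K [simp]: "h \<in> carrier G \<Longrightarrow> vert h \<in> K"
  by (simp add: vert_def)

lemma vert_mul: "vert h \<star> vert h' = vert (h \<otimes> h')"
  by (simp add: vert_def mul_vert_bas)

lemma unit_mul_bas: "(h, l) \<in> P \<Longrightarrow> bas (\<one>, []) \<star> bas (h, l) = bas (h, l)"
proof (induction l arbitrary: h)
  case Nil then show ?case by (simp add: mul_vert_bas)
next
  case (Cons x l)
  then have x: "x = (h, snd x)" "h \<in> carrier G" "(h \<otimes> g, l) \<in> P" by (auto simp: prod_eq_iff)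
  then show ?case
    using Cons.prems by (subst mul_bas_rec) (auto simp: Cons.IH m_assoc ops_simps simp flip: x(1))
qed

lemma mul_unit_bas: "(h, l) \<in> P \<Longrightarrow> bas (h, l) \<star> bas (\<one>, []) = bas (h, l)"
proof (induction l arbitrary: h)
  case Nil then show ?case by (simp add: mul_vert_bas)
next
  case (Cons x l)
  then have x: "x = (h, snd x)" "h \<in> carrier G" "(h \<otimes> g, l) \<in> P" by (auto simp: prod_eq_iff)
  then show ?case
    using Cons.prems by (subst mul_bas_rec) (auto simp: Cons.IH m_assoc ops_simps simp flip: x(1))
qed

lemma unit_mul: assumes "x \<in> K" shows "u \<star> x = x"
  unfolding vert_def
  by (rule lin_eq_on_supp[OF assms lin_mul(1) lin_id(2)]) (metis unit_mul_bas surj_pair)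

lemma mul_unit: assumes "x \<in> K" shows "x \<star> u = x"
  unfolding vert_def
  by (rule lin_eq_on_supp[OF assms lin_mul(2) lin_id(2)]) (metis mul_unit_bas surj_pair)

text \<open>The recursion solves the equation \<open>\<Sum> S(x\<^sub>1) x\<^sub>2 = \<epsilon>(x)\<close> for its term of highest degree.\<close>

function anti :: "'g path \<Rightarrow> ('g path \<Rightarrow>\<^sub>0 'k)" where
  "anti (h, l) = (if l = [] then vert (inv h) else
     - (\<Sum>i\<in>{1..length l}. anti (vertex_at G g (h, l) i, drop i l) \<star> bas (h, take i l)) \<star> vert (inv h))"
  by auto
termination
  by (relation "measure (\<lambda>\<alpha>. length (snd \<alpha>))") auto

declare anti.simps [simp del]

lemma K_neg: "x \<in> K \<Longrightarrow> - x \<in> K"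
  by (rule vs.subspace_neg[OF subspace_supp])

lemma anti_K: "\<alpha> \<in> P \<Longrightarrow> anti \<alpha> \<in> K"
proof (induction \<alpha> rule: anti.induct)
  case (1 h l)
  have h: "h \<in> carrier G" using paths_fst[OF "1.prems"] by simp
  show ?case
  proof (cases "l = []")
    case True then show ?thesis using vert_K[of "inv h"] h by (simp add: anti.simps)
  next
    case False
    have "anti (vertex_at G g (h, l) i, drop i l) \<star> bas (h, take i l) \<in> K" if "i \<in> {1..length l}" for i
      using "1.IH"[OF False that] drop_take_paths[OF "1.prems", of i] that by (intro mul_K) auto
    then have s: "(\<Sum>i\<in>{1..length l}. anti (vertex_at G g (h, l) i, drop i l) \<star> bas (h, take i l)) \<in> K"
      by (rule vs.subspace_sum[OF subspace_supp])
    show ?thesis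
      unfolding anti.simps[of h l] if_not_P[OF False]
      by (rule mul_K[OF K_neg[OF s] vert_K[OF inv_closed[OF h]]])
  qed
qed

definition S :: "('g path \<Rightarrow>\<^sub>0 'k) \<Rightarrow> ('g path \<Rightarrow>\<^sub>0 'k)" where
  "S = lin_ext anti"

lemma lin_S [simp]: "lin S"
  by (simp add: S_def)

lemma S_bas: "S (bas \<alpha>) = anti \<alpha>"
  by (simp add: S_def)

lemma S_K: assumes "x \<in> K" shows "S x \<in> K"
  by (rule lin_maps_supp[OF lin_S subspace_supp assms]) (simp only: S_bas anti_K)

lemma S_vert: "S (vert h) = vert (inv h)"
  by (simp add: vert_def S_bas anti.simps)

text \<open>Applied to \<open>\<Delta> z\<close>, this is the convolution of \<open>f\<close> with
  the identity, evaluated at \<open>z\<close>.\<close>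

abbreviation conv_left :: "(('g path \<Rightarrow>\<^sub>0 'k) \<Rightarrow> ('g path \<Rightarrow>\<^sub>0 'k)) \<Rightarrow> _" where
  "conv_left f t \<equiv> mul_map (kQ_mul G g act) (tens_map f id t)"

lemma mul_map_bas: "mul_map (kQ_mul G g act) (x \<boxtimes> y) = x \<star> y"
  by (rule mul_map_tens) simp_all

lemma mul_map_bas_bas: "mul_map (kQ_mul G g act) (bas (d, e)) = bas d \<star> bas e"
  by (simp add: mul_map_def)

lemma conv_left_comult_bas:
  "conv_left f (\<Delta> (bas (h, l))) = f (bas (h, l)) \<star> bas (h, []) +
     (\<Sum>i\<in>{1..length l}. f (bas (vertex_at G g (h, l) i, drop i l)) \<star> bas (h, take i l))"
proof -
  have "{..length l} = insert 0 {1..length l}" by auto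
  then have "conv_left f (\<Delta> (bas (h, l))) =
    (\<Sum>i\<in>insert 0 {1..length l}. f (bas (vertex_at G g (h, l) i, drop i l)) \<star> bas (h, take i l))"
    by (simp add: comult_bas lin_sum[OF lin_tens_map] lin_sum[OF lin_mul_map] lin_add[OF lin_tens_map]
        lin_add[OF lin_mul_map] tens_map_bas mul_map_bas)
  then show ?thesis by simp
qed

lemma antipode_left:
  assumes "x \<in> K" shows "conv_left S (\<Delta> x) = scl (kQ_counit x) u"
proof (rule lin_eq_on_supp[OF assms, of "\<lambda>x. conv_left S (\<Delta> x)" "\<lambda>x. scl (kQ_counit x) u"])
  show "lin (\<lambda>x. conv_left S (\<Delta> x))"
    by (intro lin_comp[OF lin_mul_map] lin_comp[OF lin_tens_map] lin_comult)
  show "lin (\<lambda>x. scl (kQ_counit x) u)"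
    by (rule linI) (simp_all add: counit_simps vs.scale_left_distrib)
  fix \<alpha> assume P: "\<alpha> \<in> P"
  obtain h l where hl: "\<alpha> = (h, l)" by fastforce
  have h: "h \<in> carrier G" using paths_fst[OF P] hl by simp
  show "conv_left S (\<Delta> (bas \<alpha>)) = scl (kQ_counit (bas \<alpha>)) u"
  proof (cases "l = []")
    case True
    then show ?thesis
      using vert_mul[of "inv h" h] h
      by (simp add: hl comult_vertex tens_map_bas mul_map_bas_bas kQ_counit_bas S_bas anti.simps vert_def)
  next
    case False
    let ?s = "\<Sum>i\<in>{1..length l}. anti (vertex_at G g (h, l) i, drop i l) \<star> bas (h, take i l)"
    have "anti (vertex_at G g (h, l) i, drop i l) \<star> bas (h, take i l) \<in> K" if "i \<in> {1..length l}" for i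
      using drop_take_paths[of h l i] P hl that by (intro mul_K anti_K) auto
    then have s: "?s \<in> K" by (rule vs.subspace_sum[OF subspace_supp])
    \<comment> \<open>The factor \<open>vert h\<close> from the cut at \<open>0\<close> cancels the
      trailing \<open>vert (inv h)\<close> of the recursion, leaving minus the sum over the other
      cuts.\<close>
    have "anti (h, l) \<star> vert h = - ?s \<star> (vert (inv h) \<star> vert h)"
      unfolding anti.simps[of h l] if_not_P[OF False]
      by (rule mul_assoc[OF K_neg[OF s] vert_K[OF inv_closed[OF h]] vert_K[OF h]])
    also have "\<dots> = - ?s" using h mul_unit[OF K_neg[OF s]] by (simp add: vert_mul)
    finally have "anti (h, l) \<star> bas (h, []) + ?s = 0" by (simp add: vert_def)
    then show ?thesis
      by (simp add: hl conv_left_comult_bas S_bas kQ_counit_bas False del: One_nat_def)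
  qed
qed

text \<open>In the convolution at a path, the cut at \<open>0\<close> gives \<open>T\<close> of the
  whole path times its invertible start vertex; all other cuts involve \<open>T\<close> of shorter
  paths, which vanish by induction.\<close>

lemma conv_left_cancel:
  assumes T: "lin T" "\<And>x. x \<in> K \<Longrightarrow> T x \<in> K" "\<And>x. x \<in> K \<Longrightarrow> conv_left T (\<Delta> x) = 0"
    and x: "x \<in> K"
  shows "T x = 0"
proof -
  have "T (bas \<alpha>) = 0" if "\<alpha> \<in> P" for \<alpha>
    using that
  proof (induction "length (snd \<alpha>)" arbitrary: \<alpha> rule: less_induct)
    case less
    obtain h l where hl: "\<alpha> = (h, l)" by fastforce
    have h: "h \<in> carrier G" and K: "bas \<alpha> \<in> K" using paths_fst[OF less.prems] hl less.prems by simp_all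
    have "T (bas (vertex_at G g (h, l) i, drop i l)) = 0" if "i \<in> {1..length l}" for i
      using that drop_take_paths[of h l i] less.prems hl by (intro less.hyps) auto
    then have "conv_left T (\<Delta> (bas (h, l))) = T (bas (h, l)) \<star> vert h"
      unfolding conv_left_comult_bas by (simp add: mul_simps vert_def)
    then have "T (bas \<alpha>) \<star> vert h = 0" using T(3)[OF K] hl by simp
    then have "T (bas \<alpha>) \<star> vert h \<star> vert (inv h) = 0" by (simp add: mul_simps)
    moreover have "T (bas \<alpha>) \<star> vert h \<star> vert (inv h) = T (bas \<alpha>) \<star> u"
      using mul_assoc[OF T(2)[OF K] vert_K vert_K, of h "inv h"] h by (simp add: vert_mul)
    ultimately show ?case using mul_unit[OF T(2)[OF K]] by simp
  qed
  then show ?thesis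
    by (intro lin_eq_on_supp[OF x T(1) lin_0]) auto
qed

text \<open>Associativity moves the factor \<open>v\<close> into the other leg, where it becomes
  part of a product with \<Delta>.\<close>

lemma conv_left_mul:
  assumes "\<And>x. x \<in> K \<Longrightarrow> f x \<in> K" "v \<in> K" "t \<in> KK"
  shows "conv_left (\<lambda>y. f y \<star> v) t = mul_map (kQ_mul G g act) (tens_map f (\<lambda>y. v \<star> y) t)"
proof (rule lin_eq_on_supp[OF assms(3) lin_comp[OF lin_mul_map lin_tens_map] lin_comp[OF lin_mul_map lin_tens_map]])
  fix e assume "e \<in> P \<times> P"
  then have k: "bas (fst e) \<in> K" "bas (snd e) \<in> K" by (cases e; simp)+
  note k = assms(1)[OF k(1)] k(2)
  then show "conv_left (\<lambda>y. f y \<star> v) (bas e) = mul_map (kQ_mul G g act) (tens_map f (\<lambda>y. v \<star> y) (bas e))"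
    by (simp add: tens_map_bas mul_map_bas mul_assoc[OF k(1) assms(2) k(2)])
qed

abbreviation conv_right :: "('g path \<times> 'g path \<Rightarrow>\<^sub>0 'k) \<Rightarrow> _" where
  "conv_right t \<equiv> mul_map (kQ_mul G g act) (tens_map id S t)"

lemma conv_right_mul:
  assumes "v \<in> K" "w \<in> K" "t \<in> KK"
  shows "mul_map (kQ_mul G g act) (tens_map (\<lambda>y. v \<star> y) (\<lambda>y. S y \<star> w) t) = v \<star> conv_right t \<star> w"
proof (rule lin_eq_on_supp[OF assms(3) lin_comp[OF lin_mul_map lin_tens_map], of "\<lambda>t. v \<star> conv_right t \<star> w"])
  show "lin (\<lambda>t. v \<star> conv_right t \<star> w)"
    by (intro lin_comp[OF lin_mul(2)] lin_comp[OF lin_mul(1)] lin_comp[OF lin_mul_map] lin_tens_map)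
  fix e assume e: "e \<in> P \<times> P"
  then have k: "bas (fst e) \<in> K" "bas (snd e) \<in> K" by (cases e; simp)+
  note k = k(1) S_K[OF k(2)]
  then show "mul_map (kQ_mul G g act) (tens_map (\<lambda>y. v \<star> y) (\<lambda>y. S y \<star> w) (bas e)) = v \<star> conv_right (bas e) \<star> w"
    by (simp add: tens_map_bas mul_map_bas mul_assoc[OF assms(1) k(1) mul_K[OF k(2) assms(2)]]
        mul_assoc[OF k assms(2)] mul_assoc[OF assms(1) mul_K[OF k] assms(2)])
qed

section \<open>The generators\<close>

definition "a = (arr \<one> Va :: 'g path \<Rightarrow>\<^sub>0 'k)"
definition "b = (arr \<one> Vb :: 'g path \<Rightarrow>\<^sub>0 'k)"
definition "x = (vert g :: 'g path \<Rightarrow>\<^sub>0 'k)"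
definition "y = (vert (inv g) :: 'g path \<Rightarrow>\<^sub>0 'k)"

lemma gens_K [simp]: "a \<in> K" "b \<in> K" "x \<in> K" "y \<in> K" "u \<in> K"
  by (simp_all add: a_def b_def x_def y_def arr_def vert_def)

lemma xy: "x \<star> y = u" "y \<star> x = u"
  by (simp_all add: x_def y_def vert_mul)

lemma comult_gens: "\<Delta> x = x \<boxtimes> x" "\<Delta> a = a \<boxtimes> u + x \<boxtimes> a" "\<Delta> b = b \<boxtimes> u + x \<boxtimes> b"
  by (simp_all add: a_def b_def x_def arr_def vert_def comult_vertex comult_Cons target_def)

lemma counit_gens: "kQ_counit x = 1" "kQ_counit a = 0" "kQ_counit b = 0" "kQ_counit u = 1"
  by (simp_all add: a_def b_def x_def arr_def vert_def kQ_counit_bas)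

lemma comult_u: "\<Delta> u = u \<boxtimes> u"
  by (simp add: vert_def comult_vertex)

text \<open>Convolving z \<mapsto> S(gz) g with the identity gives the convolution of S at gz,
  because \<Delta>(gz) is the sum of gz_1 \<otimes> gz_2. Its value \<epsilon>(gz) = \<epsilon>(z)
  is also that of S at z, and cancellation applies.\<close>

lemma S_x_mul:
  assumes z: "z \<in> K" shows "S (x \<star> z) = S z \<star> y"
proof -
  let ?T = "\<lambda>z. S (x \<star> z) \<star> x - S z"
  have T: "?T z = 0"
  proof (rule conv_left_cancel[OF _ _ _ z])
    show "lin ?T"
      by (intro lin_minus lin_comp[OF lin_mul(2)] lin_comp[OF lin_S lin_mul(1)] lin_S)
    show "?T z \<in> K" if "z \<in> K" for z
      using that by (intro vs.subspace_diff[OF subspace_supp] mul_K S_K gens_K)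
    show "conv_left ?T (\<Delta> z) = 0" if z: "z \<in> K" for z
    proof -
      have "conv_left (\<lambda>z. S (x \<star> z) \<star> x) (\<Delta> z) =
          mul_map (kQ_mul G g act) (tens_map (\<lambda>z. S (x \<star> z)) (\<lambda>z. x \<star> z) (\<Delta> z))"
        using comult_KK[OF z] by (intro conv_left_mul S_K mul_K gens_K)
      also have "\<dots> = conv_left S (\<Delta> (x \<star> z))"
        by (simp add: comult_mul[OF gens_K(3) z] comult_gens tmul_tens tens_map_comp)
      also have "\<dots> = scl (kQ_counit z) u"
        by (simp add: antipode_left[OF mul_K[OF gens_K(3) z]] counit_mul[OF gens_K(3) z] counit_gens)
      finally show ?thesis
        by (simp add: tens_map_diff lin_diff[OF lin_mul_map] antipode_left[OF z])
    qed
  qed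
  have "S (x \<star> z) = S (x \<star> z) \<star> (x \<star> y)"
    using mul_unit[OF S_K[OF mul_K[OF gens_K(3) z]]] by (simp add: xy)
  also have "\<dots> = S z \<star> y"
    using T mul_assoc[OF S_K[OF mul_K[OF gens_K(3) z]] gens_K(3,4)] by simp
  finally show ?thesis .
qed

text \<open>\<Delta>(vz) has the two parts vz_1 \<otimes> z_2 and gz_1 \<otimes> vz_2, so the
  convolution of \<open>?T\<close> at z is that of S at vz, namely \<epsilon>(vz) = 0.\<close>

lemma S_primitive_mul:
  assumes z: "z \<in> K" and v: "v \<in> K" "\<Delta> v = v \<boxtimes> u + x \<boxtimes> v" "kQ_counit v = 0"
  shows "S (v \<star> z) = S z \<star> - (y \<star> v)"
proof -
  let ?T = "\<lambda>z. S (v \<star> z) + S (x \<star> z) \<star> v"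
  have T: "?T z = 0"
  proof (rule conv_left_cancel[OF _ _ _ z])
    show "lin ?T"
      by (intro lin_plus lin_comp[OF lin_mul(2)] lin_comp[OF lin_S lin_mul(1)])
    show "?T z \<in> K" if "z \<in> K" for z
      using that by (intro K_add mul_K S_K gens_K v)
    show "conv_left ?T (\<Delta> z) = 0" if z: "z \<in> K" for z
    proof -
      have "tens_map (\<lambda>z. v \<star> z) id (\<Delta> z) = tens_map (\<lambda>z. v \<star> z) (\<lambda>z. u \<star> z) (\<Delta> z)"
        using comult_KK[OF z] by (rule tens_map_cong) (simp_all add: unit_mul)
      then have "conv_left (\<lambda>z. S (v \<star> z)) (\<Delta> z) = conv_left S (tens_map (\<lambda>z. v \<star> z) (\<lambda>z. u \<star> z) (\<Delta> z))"
        using tens_map_comp[OF lin_S lin_id(1), of "\<lambda>z. v \<star> z" id "\<Delta> z"] by (simp add: id_def)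
      moreover have "conv_left (\<lambda>z. S (x \<star> z) \<star> v) (\<Delta> z) =
          mul_map (kQ_mul G g act) (tens_map (\<lambda>z. S (x \<star> z)) (\<lambda>z. v \<star> z) (\<Delta> z))"
        using comult_KK[OF z] by (intro conv_left_mul S_K mul_K gens_K v)
      moreover have "\<dots> = conv_left S (tens_map (\<lambda>z. x \<star> z) (\<lambda>z. v \<star> z) (\<Delta> z))"
        by (simp add: tens_map_comp)
      moreover have "\<Delta> (v \<star> z) =
          tens_map (\<lambda>z. v \<star> z) (\<lambda>z. u \<star> z) (\<Delta> z) + tens_map (\<lambda>z. x \<star> z) (\<lambda>z. v \<star> z) (\<Delta> z)"
        by (simp add: comult_mul[OF v(1) z] v(2) tmul_simps tmul_tens)
      ultimately have "conv_left ?T (\<Delta> z) = conv_left S (\<Delta> (v \<star> z))"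
        by (simp add: tens_map_add_left lin_add[OF lin_mul_map] lin_add[OF lin_tens_map])
      also have "\<dots> = 0"
        by (simp add: antipode_left[OF mul_K[OF v(1) z]] counit_mul[OF v(1) z] v(3))
      finally show ?thesis .
    qed
  qed
  then have "S (v \<star> z) = - (S (x \<star> z) \<star> v)" by (rule eq_neg_iff_add_eq_0[THEN iffD2])
  also have "\<dots> = - (S z \<star> (y \<star> v))"
    unfolding S_x_mul[OF z] by (simp add: mul_assoc[OF S_K[OF z] gens_K(4) v(1)])
  also have "\<dots> = S z \<star> - (y \<star> v)" by (simp add: lin_neg[OF lin_mul(1)])
  finally show ?thesis .
qed

text \<open>As S reverses the product, the outer factors leave the convolution: gz_1 S(gz_2) = g
  (z_1 S(z_2)) g^-1.\<close>

lemma antipode_right_x: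
  assumes z: "z \<in> K" "conv_right (\<Delta> z) = scl (kQ_counit z) u"
  shows "conv_right (\<Delta> (x \<star> z)) = scl (kQ_counit (x \<star> z)) u"
proof -
  have "conv_right (\<Delta> (x \<star> z)) = mul_map (kQ_mul G g act) (tens_map (\<lambda>z. x \<star> z) (\<lambda>z. S (x \<star> z)) (\<Delta> z))"
    by (simp add: comult_mul[OF gens_K(3) z(1)] comult_gens tmul_tens tens_map_comp)
  also have "tens_map (\<lambda>z. x \<star> z) (\<lambda>z. S (x \<star> z)) (\<Delta> z) = tens_map (\<lambda>z. x \<star> z) (\<lambda>z. S z \<star> y) (\<Delta> z)"
    using comult_KK[OF z(1)] by (rule tens_map_cong) (simp_all add: S_x_mul)
  also have "mul_map (kQ_mul G g act) \<dots> = x \<star> conv_right (\<Delta> z) \<star> y"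
    using comult_KK[OF z(1)] by (intro conv_right_mul gens_K)
  also have "\<dots> = scl (kQ_counit (x \<star> z)) u"
    by (simp add: z(2) mul_simps mul_unit[OF gens_K(3)] xy counit_mul[OF gens_K(3) z(1)] counit_gens)
  finally show ?thesis .
qed

lemma antipode_right_primitive:
  assumes z: "z \<in> K" "conv_right (\<Delta> z) = scl (kQ_counit z) u"
    and v: "v \<in> K" "\<Delta> v = v \<boxtimes> u + x \<boxtimes> v" "kQ_counit v = 0"
  shows "conv_right (\<Delta> (v \<star> z)) = scl (kQ_counit (v \<star> z)) u"
proof -
  note zz = comult_KK[OF z(1)]
  have nK: "- (y \<star> v) \<in> K" by (intro K_neg mul_K gens_K v)
  have "\<Delta> (v \<star> z) =
      tens_map (\<lambda>z. v \<star> z) (\<lambda>z. u \<star> z) (\<Delta> z) + tens_map (\<lambda>z. x \<star> z) (\<lambda>z. v \<star> z) (\<Delta> z)"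
    by (simp add: comult_mul[OF v(1) z(1)] v(2) tmul_simps tmul_tens)
  then have "conv_right (\<Delta> (v \<star> z)) =
      mul_map (kQ_mul G g act) (tens_map (\<lambda>z. v \<star> z) (\<lambda>z. S (u \<star> z)) (\<Delta> z)) +
      mul_map (kQ_mul G g act) (tens_map (\<lambda>z. x \<star> z) (\<lambda>z. S (v \<star> z)) (\<Delta> z))"
    by (simp add: lin_add[OF lin_tens_map] lin_add[OF lin_mul_map] tens_map_comp)
  also have "tens_map (\<lambda>z. v \<star> z) (\<lambda>z. S (u \<star> z)) (\<Delta> z) = tens_map (\<lambda>z. v \<star> z) (\<lambda>z. S z \<star> u) (\<Delta> z)"
    using zz by (rule tens_map_cong) (simp_all add: unit_mul mul_unit[OF S_K])
  also have "tens_map (\<lambda>z. x \<star> z) (\<lambda>z. S (v \<star> z)) (\<Delta> z) =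
      tens_map (\<lambda>z. x \<star> z) (\<lambda>z. S z \<star> - (y \<star> v)) (\<Delta> z)"
    using zz by (rule tens_map_cong) (simp_all add: S_primitive_mul[OF _ v])
  also have "mul_map (kQ_mul G g act) (tens_map (\<lambda>z. v \<star> z) (\<lambda>z. S z \<star> u) (\<Delta> z)) = v \<star> conv_right (\<Delta> z) \<star> u"
    using zz v by (intro conv_right_mul gens_K)
  also have "mul_map (kQ_mul G g act) (tens_map (\<lambda>z. x \<star> z) (\<lambda>z. S z \<star> - (y \<star> v)) (\<Delta> z)) =
      x \<star> conv_right (\<Delta> z) \<star> - (y \<star> v)"
    using zz nK by (intro conv_right_mul gens_K)
  \<comment> \<open>Both summands are \<epsilon>(z) times v up to sign, and the signs are opposite
    because \<open>x \<star> y = u\<close>.\<close>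
  also have "v \<star> conv_right (\<Delta> z) \<star> u + x \<star> conv_right (\<Delta> z) \<star> - (y \<star> v) = 0"
    using v(1) mul_assoc[OF gens_K(3,4) v(1)]
    by (simp add: z(2) mul_simps mul_unit[OF gens_K(3)] mul_unit unit_mul lin_neg[OF lin_mul(1)] xy
        flip: vs.scale_right_distrib)
  finally show ?thesis
    by (simp only: counit_mul[OF v(1) z(1)] v(3) mult_zero_left vs.scale_zero_left)
qed

end

section \<open>Normal forms in the free algebra\<close>

lemma lin_free_mul [simp]: "lin (free_mul x)" "lin (\<lambda>x. free_mul x y)"
  by (simp_all add: free_mul_def)

lemma free_mul_bas [simp]: "free_mul (bas v) (bas w) = bas (v @ w)"
  by (simp add: free_mul_def)

lemmas free_mul_simps = lin_add[OF lin_free_mul(1)] lin_add[OF lin_free_mul(2)]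
  lin_scl[OF lin_free_mul(1)] lin_scl[OF lin_free_mul(2)]
  lin_diff[OF lin_free_mul(1)] lin_diff[OF lin_free_mul(2)]

definition normal_word :: "nat \<times> nat \<times> nat \<Rightarrow> generator list" where
  "normal_word = (\<lambda>(c, i, j). replicate c Xg @ replicate i Xa @ replicate j Xb)"

context
  fixes I :: "(generator list \<Rightarrow>\<^sub>0 'k::field) set" and n p :: nat
  assumes I: "two_sided_ideal I" and R: "relators n p \<subseteq> I" and n: "n > 0" and p: "p > 0"
begin

lemma subspace_I: "vs.subspace I"
  using I by (simp add: two_sided_ideal_def)

lemma I_context: "r \<in> I \<Longrightarrow> free_mul (bas v) (free_mul r (bas w)) \<in> I"
  using I by (simp add: two_sided_ideal_def)

lemma I_trans: "x - y \<in> I \<Longrightarrow> y - z \<in> I \<Longrightarrow> x - z \<in> I"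
  using vs.subspace_add[OF subspace_I, of "x - y" "y - z"] by simp

lemma I_cong_add: "x - x' \<in> I \<Longrightarrow> y - y' \<in> I \<Longrightarrow> x + y - (x' + y') \<in> I"
  using vs.subspace_add[OF subspace_I, of "x - x'" "y - y'"] by (simp add: algebra_simps)

lemma I_sym: "x - y \<in> I \<Longrightarrow> y - x \<in> I"
  using vs.subspace_neg[OF subspace_I, of "x - y"] by simp

lemma I_refl: "x - x \<in> I"
  using vs.subspace_0[OF subspace_I] by simp

lemma relators_in_I:
  "bas (v @ replicate n Xg @ w) - bas (v @ w) \<in> I"
  "bas (v @ replicate (n - 1) Xg @ Xa # Xg # w) - bas (v @ Xa # w) \<in> I"
  "bas (v @ replicate (n - 1) Xg @ Xb # Xg # w) - (bas (v @ Xa # w) + bas (v @ Xb # w)) \<in> I"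
  "bas (v @ replicate p Xa @ w) \<in> I"
  "bas (v @ replicate p Xb @ w) \<in> I"
  "bas (v @ Xb # Xa # w) - (bas (v @ Xa # Xb # w) + scl (1/2) (bas (v @ Xa # Xa # w))) \<in> I"
proof -
  have "r \<in> I" if "r \<in> relators n p" for r using R that by blast
  note r = I_context[OF this, unfolded relators_def]
  show "bas (v @ replicate n Xg @ w) - bas (v @ w) \<in> I"
    using r[of "bas (replicate n Xg) - bas []" v w] by (simp add: free_mul_simps)
  show "bas (v @ replicate (n - 1) Xg @ Xa # Xg # w) - bas (v @ Xa # w) \<in> I"
    using r[of "bas (replicate (n - 1) Xg @ [Xa, Xg]) - bas [Xa]" v w] by (simp add: free_mul_simps)
  show "bas (v @ replicate (n - 1) Xg @ Xb # Xg # w) - (bas (v @ Xa # w) + bas (v @ Xb # w)) \<in> I"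
    using r[of "bas (replicate (n - 1) Xg @ [Xb, Xg]) - (bas [Xa] + bas [Xb])" v w]
    by (simp add: free_mul_simps)
  show "bas (v @ replicate p Xa @ w) \<in> I"
    using r[of "bas (replicate p Xa)" v w] by simp
  show "bas (v @ replicate p Xb @ w) \<in> I"
    using r[of "bas (replicate p Xb)" v w] by simp
  show "bas (v @ Xb # Xa # w) - (bas (v @ Xa # Xb # w) + scl (1/2) (bas (v @ Xa # Xa # w))) \<in> I"
    using r[of "bas [Xb, Xa] - (bas [Xa, Xb] + scl (1/2) (bas [Xa, Xa]))" v w]
    by (simp add: free_mul_simps)
qed

lemma replicate_n: "Xg # replicate (n - 1) Xg = replicate n Xg"
  using n by (cases n) auto

text \<open>The relation reads g^(n-1) a g = a. Inserting g^n in front of a and absorbing all but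
  its first letter into the relator turns it into ag = ga.\<close>

lemma swap_Xa_Xg: "bas (v @ Xa # Xg # w) - bas (v @ Xg # Xa # w) \<in> I"
proof (rule I_trans[OF I_sym])
  show "bas (v @ replicate n Xg @ Xa # Xg # w) - bas (v @ Xa # Xg # w) \<in> I"
    by (rule relators_in_I(1))
  show "bas (v @ replicate n Xg @ Xa # Xg # w) - bas (v @ Xg # Xa # w) \<in> I"
    using relators_in_I(2)[of "v @ [Xg]" w] by (simp flip: replicate_n)
qed

lemma swap_Xb_Xg: "bas (v @ Xb # Xg # w) - (bas (v @ Xg # Xa # w) + bas (v @ Xg # Xb # w)) \<in> I"
proof (rule I_trans[OF I_sym])
  show "bas (v @ replicate n Xg @ Xb # Xg # w) - bas (v @ Xb # Xg # w) \<in> I"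
    by (rule relators_in_I(1))
  show "bas (v @ replicate n Xg @ Xb # Xg # w) - (bas (v @ Xg # Xa # w) + bas (v @ Xg # Xb # w)) \<in> I"
    using relators_in_I(3)[of "v @ [Xg]" w] by (simp flip: replicate_n)
qed

lemma swap_Xa_Xg_pow: "bas (v @ Xa # replicate c Xg @ w) - bas (v @ replicate c Xg @ Xa # w) \<in> I"
proof (induction c arbitrary: v)
  case 0 then show ?case using I_refl by simp
next
  case (Suc c)
  then show ?case using I_trans[OF swap_Xa_Xg[of v "replicate c Xg @ w"]] Suc[of "v @ [Xg]"] by simp
qed

text \<open>Each g that b crosses produces one a, which passes the remaining powers of g unchanged;
  hence the coefficient c.\<close>

lemma swap_Xb_Xg_pow:
  "bas (v @ Xb # replicate c Xg @ w) -
     (bas (v @ replicate c Xg @ Xb # w) + scl (of_nat c) (bas (v @ replicate c Xg @ Xa # w))) \<in> I"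
proof (induction c arbitrary: v)
  case 0 then show ?case using I_refl by simp
next
  case (Suc c)
  have "bas (v @ Xg # Xa # replicate c Xg @ w) + bas (v @ Xg # Xb # replicate c Xg @ w) -
    (bas (v @ Xg # replicate c Xg @ Xa # w) + (bas (v @ Xg # replicate c Xg @ Xb # w) +
      scl (of_nat c) (bas (v @ Xg # replicate c Xg @ Xa # w)))) \<in> I"
    using I_cong_add[OF swap_Xa_Xg_pow[of "v @ [Xg]" c w] Suc[of "v @ [Xg]"]] by simp
  from I_trans[OF swap_Xb_Xg[of v "replicate c Xg @ w"] this]
  show ?case by (simp add: vs.scale_left_distrib algebra_simps)
qed

text \<open>Each a that b crosses contributes one half. The correction terms contain no b from the
  crossing, so they need no further reordering.\<close>

lemma swap_Xb_Xa_pow: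
  "bas (v @ Xb # replicate i Xa @ w) -
     (bas (v @ replicate i Xa @ Xb # w) + scl (of_nat i / 2) (bas (v @ replicate (Suc i) Xa @ w))) \<in> I"
proof (induction i arbitrary: v)
  case 0 then show ?case using I_refl by simp
next
  case (Suc i)
  have "bas (v @ Xa # Xb # replicate i Xa @ w) + scl (1/2) (bas (v @ Xa # Xa # replicate i Xa @ w)) -
    ((bas (v @ Xa # replicate i Xa @ Xb # w) + scl (of_nat i / 2) (bas (v @ Xa # Xa # replicate i Xa @ w))) +
     scl (1/2) (bas (v @ Xa # Xa # replicate i Xa @ w))) \<in> I"
    using I_cong_add[OF Suc[of "v @ [Xa]"] I_refl] by simp
  from I_trans[OF relators_in_I(6)[of v "replicate i Xa @ w"] this]
  show ?case by (simp add: vs.scale_left_distrib add_divide_distrib algebra_simps)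
qed

abbreviation "normal_idx \<equiv> {..<n} \<times> {..<p} \<times> {..<p}"
abbreviation "normal_span \<equiv> vs.span ((\<lambda>t. bas (normal_word t)) ` normal_idx \<union> I)"

lemma I_subset_M: "I \<subseteq> normal_span"
  using vs.span_superset by blast

lemma M_cong: "x - y \<in> I \<Longrightarrow> y \<in> normal_span \<Longrightarrow> x \<in> normal_span"
  using I_subset_M vs.span_add[of "x - y" _ y] by auto

text \<open>The exponents i and j are unbounded because a reordering may raise them past p-1; such
  words contain a relator.\<close>

lemma normal_word_in_M:
  assumes "c < n" shows "bas (replicate c Xg @ replicate i Xa @ replicate j Xb) \<in> normal_span"
proof -
  consider "i < p" "j < p" | "i \<ge> p" | "j \<ge> p" by linarith
  then show ?thesis
  proof cases
    case 1
    then have "bas (normal_word (c, i, j)) \<in> (\<lambda>t. bas (normal_word t)) ` normal_idx"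
      using assms by (intro imageI) simp
    then have "bas (normal_word (c, i, j)) \<in> normal_span" by (intro vs.span_base UnI1)
    moreover have "normal_word (c, i, j) = replicate c Xg @ replicate i Xa @ replicate j Xb"
      by (simp add: normal_word_def)
    ultimately show ?thesis by (simp only:)
  next
    case 2
    then have "replicate i Xa = replicate p Xa @ replicate (i - p) Xa"
      by (simp flip: replicate_add)
    then show ?thesis
      using relators_in_I(4)[of "replicate c Xg" "replicate (i - p) Xa @ replicate j Xb"] I_subset_M
      by auto
  next
    case 3
    then have "replicate j Xb = replicate p Xb @ replicate (j - p) Xb"
      by (simp flip: replicate_add)
    then show ?thesis
      using relators_in_I(5)[of "replicate c Xg @ replicate i Xa" "replicate (j - p) Xb"] I_subset_M
      by auto
  qed
qed

text \<open>A new letter only has to travel to its own block, and the correction terms from the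
  crossings merely lengthen the block of a.\<close>

lemma left_mul_M:
  assumes "z \<in> normal_span" shows "free_mul (bas [s]) z \<in> normal_span"
proof (rule lin_maps_span[OF lin_free_mul(1) vs.subspace_span assms])
  fix e assume "e \<in> (\<lambda>t. bas (normal_word t)) ` normal_idx \<union> I"
  then consider "e \<in> I" | c i j where "c < n" "e = bas (replicate c Xg @ replicate i Xa @ replicate j Xb)"
    by (auto simp: normal_word_def)
  then show "free_mul (bas [s]) e \<in> normal_span"
  proof cases
    case 1
    then have "free_mul (bas [s]) e \<in> I" using I by (simp add: two_sided_ideal_def)
    then show ?thesis using I_subset_M by blast
  next
    case 2
    let ?ab = "replicate i Xa @ replicate j Xb"
    have a: "bas (replicate c Xg @ Xa # ?ab) \<in> normal_span"
      using normal_word_in_M[OF 2(1), of "Suc i" j] by simp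
    show ?thesis
    proof (cases s)
      case Xg
      show ?thesis
      proof (cases "Suc c < n")
        case True
        then show ?thesis using normal_word_in_M[OF True, of i j] by (simp add: 2 Xg)
      next
        case False
        \<comment> \<open>Here g^(c+1) = g^n is the empty word modulo \<open>I\<close>.\<close>
        then have "n = Suc c" using 2(1) by simp
        then show ?thesis
          using M_cong[OF relators_in_I(1)[of "[]" ?ab]] normal_word_in_M[OF n, of i j] by (simp add: 2 Xg)
      qed
    next
      case Xa
      then show ?thesis
        using M_cong[OF swap_Xa_Xg_pow[of "[]" c ?ab]] a by (simp add: 2)
    next
      case Xb
      have "bas (replicate c Xg @ Xb # ?ab) \<in> normal_span"
      proof (rule M_cong[OF swap_Xb_Xa_pow[of "replicate c Xg" i "replicate j Xb"]])
        show "bas (replicate c Xg @ replicate i Xa @ Xb # replicate j Xb) +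
            scl (of_nat i / 2) (bas (replicate c Xg @ replicate (Suc i) Xa @ replicate j Xb)) \<in> normal_span"
          using normal_word_in_M[OF 2(1), of i "Suc j"] normal_word_in_M[OF 2(1), of "Suc i" j]
          by (intro vs.span_add vs.span_scale) simp_all
      qed
      then have "bas (replicate c Xg @ Xb # ?ab) + scl (of_nat c) (bas (replicate c Xg @ Xa # ?ab)) \<in> normal_span"
        using a by (intro vs.span_add vs.span_scale)
      then show ?thesis
        using M_cong[OF swap_Xb_Xg_pow[of "[]" c ?ab]] by (simp add: 2 Xb)
    qed
  qed
qed

lemma free_normal_form: "z \<in> normal_span"
proof -
  have "bas w \<in> normal_span" for w
  proof (induction w)
    case Nil then show ?case using normal_word_in_M[OF n, of 0 0] by simp
  next
    case (Cons s w) then show ?case using left_mul_M[of "bas w" s] by simp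
  qed
  then have "lin_ext bas z \<in> normal_span"
    by (intro lin_ext_in_subspace) auto
  then show ?thesis by (simp add: lin_ext_bas_eq)
qed

end

lemma two_sided_ideal_hull: "two_sided_ideal (two_sided_ideal hull R)"
proof (rule hull_in)
  fix T :: "('a list \<Rightarrow>\<^sub>0 'b) set set" assume T: "Ball T two_sided_ideal"
  then have "vs.subspace (\<Inter>T)" by (intro vs.subspace_Inter) (auto simp: two_sided_ideal_def)
  then show "two_sided_ideal (\<Inter>T)" using T by (auto simp: two_sided_ideal_def)
qed

section \<open>Relations and the basis\<close>

context jordan_quiver
begin

section \<open>Relations among the generators\<close>

lemma strip_gens [simp]:
  "strip Va a = x" "strip Vb a = 0" "strip Va b = 0" "strip Vb b = x" "strip j x = 0" "strip j u = 0"
  by (simp_all add: a_def b_def x_def arr_def vert_def)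

lemma weight_gens [simp]: "weight a = 0" "weight b = 0" "weight x = x" "weight u = 0"
  by (simp_all add: a_def b_def x_def arr_def vert_def)

lemma vpart_gens [simp]: "vpart a = 0" "vpart b = 0" "vpart x = x" "vpart u = u"
  by (simp_all add: a_def b_def x_def arr_def vert_def)

lemmas keys_subset [simp] = gens_K[unfolded mem_Collect_eq] mul_K[unfolded mem_Collect_eq]
  K_add[unfolded mem_Collect_eq] K_scl[unfolded mem_Collect_eq] strip_K[unfolded mem_Collect_eq]

lemma a_x: "a \<star> x = x \<star> a"
  by (rule K_eqI) (simp_all add: mul_K strip_mul vpart_mul mul_simps)

text \<open>The term in a stems from \<open>strip Vb b \<star> weight x\<close>, that is, from
  shift(g) = 1.\<close>

lemma b_x: "b \<star> x = x \<star> a + x \<star> b"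
  by (rule K_eqI) (simp_all add: mul_K K_add strip_mul vpart_mul mul_simps ops_simps)

context
  assumes two: "(2 :: 'k) \<noteq> 0"
begin

text \<open>\<open>strip Va\<close> turns the left side into
  \<open>b \<star> x = x \<star> a + x \<star> b\<close>, while it sends \<open>a \<star> a\<close>
  to twice \<open>x \<star> a\<close>; hence the coefficient one half.\<close>

lemma b_a: "b \<star> a = a \<star> b + scl (1/2) (a \<star> a)"
proof (rule K_eqI)
  have half: "scl (1/2) (z + z) = z" for z :: "'g path \<Rightarrow>\<^sub>0 'k"
  proof -
    have "scl (1/2) (z + z) = scl (1/2 + 1/2) z" by (simp only: vs.scale_right_distrib vs.scale_left_distrib)
    also have "1/2 + 1/2 = (1 :: 'k)" using two by (simp add: field_simps)
    finally show ?thesis by simp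
  qed
  show "b \<star> a \<in> K" "a \<star> b + scl (1/2) (a \<star> a) \<in> K"
    by (intro K_add K_scl mul_K gens_K)+
  show "vpart (b \<star> a) = vpart (a \<star> b + scl (1/2) (a \<star> a))"
    by (simp add: vpart_mul mul_simps ops_simps)
  show "strip Va (b \<star> a) = strip Va (a \<star> b + scl (1/2) (a \<star> a))"
    by (simp add: strip_mul mul_simps ops_simps a_x b_x half)
  show "strip Vb (b \<star> a) = strip Vb (a \<star> b + scl (1/2) (a \<star> a))"
    by (simp add: strip_mul mul_simps ops_simps a_x)
qed

lemma b_a_left: "z \<in> K \<Longrightarrow> b \<star> (a \<star> z) = a \<star> (b \<star> z) + scl (1/2) (a \<star> (a \<star> z))"
  using b_a by (simp add: mul_simps mul_K flip: mul_assoc)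

end

lemma a_x_left: "z \<in> K \<Longrightarrow> a \<star> (x \<star> z) = x \<star> (a \<star> z)"
  using a_x by (simp flip: mul_assoc)

lemma b_x_left: "z \<in> K \<Longrightarrow> b \<star> (x \<star> z) = x \<star> (a \<star> z) + x \<star> (b \<star> z)"
  using b_x by (simp add: mul_simps flip: mul_assoc)

text \<open>Powers bracketed to the right and applied to \<open>z\<close>, the form in which both
  \<open>kQ_pow\<close> and \<open>free_eval\<close> produce them.\<close>

definition pow :: "('g path \<Rightarrow>\<^sub>0 'k) \<Rightarrow> nat \<Rightarrow> ('g path \<Rightarrow>\<^sub>0 'k) \<Rightarrow> ('g path \<Rightarrow>\<^sub>0 'k)" where
  "pow v i = (\<lambda>z. v \<star> z) ^^ i"

lemma pow_0 [simp]: "pow v 0 z = z" and pow_Suc [simp]: "pow v (Suc i) z = v \<star> pow v i z"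
  by (simp_all add: pow_def)

lemma pow_K: "v \<in> K \<Longrightarrow> z \<in> K \<Longrightarrow> pow v i z \<in> K"
  by (induction i) (simp_all only: pow_0 pow_Suc mul_K)

lemma pow_gens_K: "z \<in> K \<Longrightarrow> pow a i z \<in> K" "z \<in> K \<Longrightarrow> pow b i z \<in> K" "z \<in> K \<Longrightarrow> pow x i z \<in> K"
  by (rule pow_K; simp only: gens_K)+

lemmas pow_keys_subset [simp] = pow_gens_K[unfolded mem_Collect_eq]

lemma pow_zero: "pow v i 0 = 0"
  by (induction i) (simp_all add: mul_simps)

lemma pow_scl: "pow v i (scl c z) = scl c (pow v i z)"
  by (induction i) (simp_all add: mul_simps)

lemma pow_vert: "h \<in> carrier G \<Longrightarrow> pow x i (vert h) = vert (h \<otimes> g [^] i)"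
  by (induction i) (simp_all add: x_def vert_mul m_assoc commute[of g])

abbreviation "ap i \<equiv> pow a i u"
abbreviation "bp i \<equiv> pow b i u"

lemma ap_K: "ap i \<in> K" and bp_K: "bp i \<in> K"
  by (simp_all only: pow_gens_K gens_K)

lemma scl_Suc: "scl (of_nat (Suc i)) z = z + scl (of_nat i) z"
  by (simp add: vs.scale_left_distrib)

text \<open>\<open>strip Vb a = 0\<close> removes the twist and a commutes with g, so the usual rule
  for deriving a power holds.\<close>

lemma strip_ap: "strip Va (ap (Suc i)) = scl (of_nat (Suc i)) (x \<star> ap i)" "strip Vb (ap i) = 0"
proof -
  show b: "strip Vb (ap i) = 0" for i
    by (induction i) (simp_all add: strip_Vb_mul ap_K mul_simps)
  show "strip Va (ap (Suc i)) = scl (of_nat (Suc i)) (x \<star> ap i)"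
  proof (induction i)
    case (Suc i)
    have "strip Va (ap (Suc (Suc i))) = x \<star> ap (Suc i) + a \<star> strip Va (ap (Suc i))"
      by (simp only: pow_Suc[of a "Suc i"] strip_Va_mul gens_K ap_K strip_gens mul_simps add_0_right)
    also have "\<dots> = x \<star> ap (Suc i) + scl (of_nat (Suc i)) (x \<star> ap (Suc i))"
      unfolding Suc by (simp only: mul_simps a_x_left[OF ap_K] pow_Suc)
    finally show ?case by (simp only: scl_Suc)
  qed (simp add: strip_Va_mul mul_simps)
qed

text \<open>All paths in b^j start at the identity, where \<open>shift\<close> vanishes, so the
  twist in the Leibniz rule is zero.\<close>

lemma strip_Va_bp: "strip Va (bp j) = 0" and weight_bp: "weight (bp j) = 0"
proof -
  show w: "weight (bp j) = 0" for j
    by (induction j) (simp_all add: weight_mul bp_K mul_simps)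
  show "strip Va (bp j) = 0"
    by (induction j) (simp_all add: strip_Va_mul bp_K mul_simps w)
qed

lemma strip_Vb_bp_Suc: "strip Vb (bp (Suc j)) = x \<star> bp j + b \<star> strip Vb (bp j)"
  by (simp add: strip_Vb_mul bp_K)

text \<open>The factor \<open>j + 1\<close> splits off \<open>strip Vb (b\<^sup>j\<^sup>+\<^sup>1)\<close>, so that \<open>b\<^sup>p\<close> is annihilated by both strips.\<close>

lemma strip_Vb_bp:
  assumes two: "(2 :: 'k) \<noteq> 0"
  shows "strip Vb (bp (Suc j)) = scl (of_nat (Suc j)) (x \<star> bp j + scl (1/2) (a \<star> strip Vb (bp j)))"
proof (induction j)
  case 0 then show ?case by (simp add: strip_Vb_mul mul_simps)
next
  case (Suc j)
  define B Y Y' where "B = bp j" and "Y = strip Vb (bp j)" and "Y' = strip Vb (bp (Suc j))"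
  have K: "B \<in> K" "Y \<in> K" "Y' \<in> K" using bp_K strip_K unfolding B_def Y_def Y'_def by blast+
  let ?c = "of_nat (Suc j) :: 'k"
  have Y': "Y' = scl ?c (x \<star> B + scl (1/2) (a \<star> Y))"
    unfolding Y'_def Y_def B_def by (rule Suc)
  \<comment> \<open>The Leibniz rule trades \<open>b \<star> Y\<close> for \<open>Y'\<close>, so
    that in the end only \<open>a\<close> multiplies a strip.\<close>
  have bY: "b \<star> Y = Y' - x \<star> B"
    using strip_Vb_bp_Suc[of j] by (simp add: Y'_def Y_def B_def)
  have "strip Vb (bp (Suc (Suc j))) = x \<star> (b \<star> B) + b \<star> Y'"
    unfolding strip_Vb_bp_Suc[of "Suc j"] by (simp add: B_def Y'_def)
  also have "b \<star> Y' = scl ?c (b \<star> (x \<star> B) + scl (1/2) (b \<star> (a \<star> Y)))"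
    by (subst Y') (simp only: mul_simps)
  also have "b \<star> (x \<star> B) = x \<star> (a \<star> B) + x \<star> (b \<star> B)"
    by (rule b_x_left[OF K(1)])
  also have "b \<star> (a \<star> Y) = a \<star> (Y' - x \<star> B) + scl (1/2) (a \<star> (a \<star> Y))"
    by (simp only: b_a_left[OF two K(2)] bY)
  also have "a \<star> (Y' - x \<star> B) = a \<star> Y' - x \<star> (a \<star> B)"
    by (simp only: lin_diff[OF lin_mul(1)] a_x_left[OF K(1)])
  finally have 1: "strip Vb (bp (Suc (Suc j))) = x \<star> (b \<star> B) +
      scl ?c (x \<star> (a \<star> B) + x \<star> (b \<star> B) + scl (1/2) (a \<star> Y' - x \<star> (a \<star> B) + scl (1/2) (a \<star> (a \<star> Y))))" .
  have "a \<star> Y' = scl ?c (x \<star> (a \<star> B) + scl (1/2) (a \<star> (a \<star> Y)))"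
    by (subst Y') (simp only: mul_simps a_x_left[OF K(1)])
  then have 2: "scl (1/2) (a \<star> Y') = scl ?c (scl (1/2) (x \<star> (a \<star> B)) + scl (1/2) (scl (1/2) (a \<star> (a \<star> Y))))"
    by (simp add: vs.scale_right_distrib mult.commute)
  have half: "scl (1/2) z + scl (1/2) z = z" for z :: "'g path \<Rightarrow>\<^sub>0 'k"
    using two by (simp add: field_simps flip: vs.scale_left_distrib)
  \<comment> \<open>One of the two halves of \<open>x \<star> (a \<star> B)\<close> cancels. By
    \<open>2\<close> the other half and the quarter of \<open>a \<star> (a \<star> Y)\<close>,
    multiplied by \<open>?c\<close>, make up one more \<open>scl (1/2) (a \<star> Y')\<close>; with
    the leading \<open>x \<star> (b \<star> B)\<close> this raises the factor from j+1 to
    j+2.\<close>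
  have h: "x \<star> (a \<star> B) = scl (1/2) (x \<star> (a \<star> B)) + scl (1/2) (x \<star> (a \<star> B))"
    by (simp only: half)
  have "x \<star> (a \<star> B) + x \<star> (b \<star> B) + scl (1/2) (a \<star> Y' - x \<star> (a \<star> B) + scl (1/2) (a \<star> (a \<star> Y)))
     = x \<star> (b \<star> B) + scl (1/2) (a \<star> Y') + (scl (1/2) (x \<star> (a \<star> B)) + scl (1/2) (scl (1/2) (a \<star> (a \<star> Y))))"
    by (subst h) (simp only: vs.scale_right_distrib vs.scale_right_diff_distrib, simp)
  then have "strip Vb (bp (Suc (Suc j))) = x \<star> (b \<star> B) +
      (scl ?c (x \<star> (b \<star> B) + scl (1/2) (a \<star> Y')) + scl (1/2) (a \<star> Y'))"
    unfolding 1 2[symmetric] by (simp only: vs.scale_right_distrib 2 add.assoc)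
  also have "\<dots> = scl (of_nat (Suc (Suc j))) (x \<star> (b \<star> B) + scl (1/2) (a \<star> Y'))"
    by (simp only: scl_Suc[of "Suc j"]) (simp only: vs.scale_right_distrib add_ac)
  finally show ?case by (simp only: B_def Y'_def pow_Suc)
qed

lemma ap_char: assumes "CHAR('k) = p" "p > 0" shows "ap p = 0"
proof -
  obtain m where m: "p = Suc m" using assms(2) by (cases p) auto
  have "(of_nat p :: 'k) = 0" using assms(1) by auto
  then show ?thesis
    unfolding m
    by (intro K_eqI[OF ap_K K_0])
      (simp_all only: strip_ap ops_zero vs.scale_zero_left, simp add: vpart_mul ap_K mul_simps)
qed

lemma bp_char: assumes "CHAR('k) = p" "p > 2" shows "bp p = 0"
proof -
  obtain m where m: "p = Suc m" using assms(2) by (cases p) auto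
  have p: "(of_nat p :: 'k) = 0" using assms(1) by auto
  have "(of_nat 2 :: 'k) \<noteq> 0"
    unfolding of_nat_eq_0_iff_char_dvd using assms by (auto dest: dvd_imp_le)
  then have two: "(2 :: 'k) \<noteq> 0" by simp
  show ?thesis
    using p unfolding m
    by (intro K_eqI[OF bp_K K_0])
      (simp_all only: strip_Vb_bp[OF two] strip_Va_bp ops_zero vs.scale_zero_left,
        simp add: vpart_mul bp_K mul_simps)
qed

text \<open>The strips for a come first: they kill powers of b, whereas passing a left factor b
  would twist them by \<open>weight\<close>. Keeping a vertex rather than a scalar lets the exponent
  of g be read off afterwards.\<close>

definition pairing :: "nat \<Rightarrow> nat \<Rightarrow> ('g path \<Rightarrow>\<^sub>0 'k) \<Rightarrow> ('g path \<Rightarrow>\<^sub>0 'k)" where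
  "pairing i j z = vpart ((strip Vb ^^ j) ((strip Va ^^ i) z))"

lemma lin_funpow: "lin f \<Longrightarrow> lin (f ^^ i)" for f :: "('x \<Rightarrow>\<^sub>0 'l::field) \<Rightarrow> ('x \<Rightarrow>\<^sub>0 'l)"
proof (induction i)
  case (Suc i) then show ?case using lin_comp[of f "f ^^ i"] by (simp add: o_def)
qed simp

lemma lin_pairing: "lin (pairing i j)"
  unfolding pairing_def
  by (intro lin_comp[OF lin_ops(2)] lin_comp[OF lin_funpow[OF lin_ops(1)]] lin_funpow[OF lin_ops(1)])

lemma funpow_strip_K: "z \<in> K \<Longrightarrow> (strip k ^^ i) z \<in> K"
  by (induction i) (simp_all only: funpow.simps o_apply id_apply strip_K)

lemmas funpow_strip_keys_subset [simp] = funpow_strip_K[unfolded mem_Collect_eq]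

lemma strip_x_mul: "z \<in> K \<Longrightarrow> strip k (x \<star> z) = x \<star> strip k z"
  by (cases k) (simp_all add: strip_mul mul_simps)

lemma funpow_strip_x_mul: "z \<in> K \<Longrightarrow> (strip k ^^ i) (x \<star> z) = x \<star> (strip k ^^ i) z"
  by (induction i) (simp_all only: funpow.simps o_apply id_apply strip_x_mul funpow_strip_K)

lemma funpow_strip_Vb_a_mul: "z \<in> K \<Longrightarrow> (strip Vb ^^ i) (a \<star> z) = a \<star> (strip Vb ^^ i) z"
proof (induction i)
  case (Suc i)
  then show ?case using funpow_strip_K[OF Suc.prems, where k = Vb and i = i] by (simp add: strip_Vb_mul mul_simps)
qed simp

text \<open>Each strip either passes \<open>a\<close> or replaces it by \<open>x\<close>. Strips
  commute with left multiplication by \<open>x\<close>, so all cross terms coincide and are counted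
  by \<open>Suc i\<close>.\<close>

lemma funpow_strip_Va_a_mul:
  assumes "z \<in> K"
  shows "(strip Va ^^ Suc i) (a \<star> z) = a \<star> (strip Va ^^ Suc i) z + scl (of_nat (Suc i)) (x \<star> (strip Va ^^ i) z)"
proof (induction i)
  case 0 then show ?case using assms by (simp add: strip_Va_mul mul_simps)
next
  case (Suc i)
  let ?z = "(strip Va ^^ i) z"
  have K: "?z \<in> K" "strip Va ?z \<in> K" using funpow_strip_K[OF assms, where k = Va and i = i] strip_K by blast+
  have "(strip Va ^^ Suc (Suc i)) (a \<star> z) =
      strip Va (a \<star> strip Va ?z + scl (of_nat (Suc i)) (x \<star> ?z))"
    using Suc by simp
  also have "\<dots> = x \<star> strip Va ?z + a \<star> strip Va (strip Va ?z) + scl (of_nat (Suc i)) (x \<star> strip Va ?z)"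
    using K by (simp only: ops_simps strip_x_mul strip_Va_mul gens_K strip_gens mul_simps add_0_left add_0_right)
  finally show ?case by (simp only: scl_Suc[of "Suc i"] funpow.simps o_apply add_ac)
qed

lemma funpow_strip_Vb_b_mul:
  assumes "z \<in> K"
  shows "(strip Vb ^^ Suc i) (b \<star> z) = b \<star> (strip Vb ^^ Suc i) z + scl (of_nat (Suc i)) (x \<star> (strip Vb ^^ i) z)"
proof (induction i)
  case 0 then show ?case using assms by (simp add: strip_Vb_mul mul_simps)
next
  case (Suc i)
  let ?z = "(strip Vb ^^ i) z"
  have K: "?z \<in> K" "strip Vb ?z \<in> K" using funpow_strip_K[OF assms, where k = Vb and i = i] strip_K by blast+
  have "(strip Vb ^^ Suc (Suc i)) (b \<star> z) =
      strip Vb (b \<star> strip Vb ?z + scl (of_nat (Suc i)) (x \<star> ?z))"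
    using Suc by simp
  also have "\<dots> = x \<star> strip Vb ?z + b \<star> strip Vb (strip Vb ?z) + scl (of_nat (Suc i)) (x \<star> strip Vb ?z)"
    using K by (simp only: ops_simps strip_x_mul strip_Vb_mul gens_K strip_gens mul_simps add_0_left add_0_right)
  finally show ?case by (simp only: scl_Suc[of "Suc i"] funpow.simps o_apply add_ac)
qed

lemma pairing_x_mul: "z \<in> K \<Longrightarrow> pairing i j (x \<star> z) = x \<star> pairing i j z"
  unfolding pairing_def
  by (simp add: funpow_strip_x_mul funpow_strip_K vpart_mul)

lemma pairing_x_pow: "z \<in> K \<Longrightarrow> pairing i j (pow x c z) = pow x c (pairing i j z)"
  by (induction c) (simp_all only: pow_0 pow_Suc pairing_x_mul pow_gens_K)

text \<open>\<open>vpart\<close> is multiplicative and kills \<open>a\<close>, so only the cross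
  terms of the higher Leibniz rule survive.\<close>

lemma pairing_a_mul:
  assumes z: "z \<in> K"
  shows "pairing 0 j (a \<star> z) = 0"
    and "pairing (Suc i) j (a \<star> z) = scl (of_nat (Suc i)) (x \<star> pairing i j z)"
proof -
  have *: "vpart ((strip Vb ^^ j) (a \<star> w)) = 0" if "w \<in> K" for w
    using that by (simp add: funpow_strip_Vb_a_mul vpart_mul funpow_strip_K mul_simps)
  show "pairing 0 j (a \<star> z) = 0"
    unfolding pairing_def using *[OF z] by simp
  have "pairing (Suc i) j (a \<star> z) = vpart ((strip Vb ^^ j) (a \<star> (strip Va ^^ Suc i) z)) +
     scl (of_nat (Suc i)) (vpart ((strip Vb ^^ j) (x \<star> (strip Va ^^ i) z)))"
    unfolding pairing_def funpow_strip_Va_a_mul[OF z]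
    by (simp only: lin_add[OF lin_funpow[OF lin_ops(1)]] lin_scl[OF lin_funpow[OF lin_ops(1)]] ops_simps)
  also have "\<dots> = scl (of_nat (Suc i)) (x \<star> pairing i j z)"
    unfolding pairing_def *[OF funpow_strip_K[OF z]]
    using funpow_strip_K[OF z, where k = Va and i = i] funpow_strip_K[OF funpow_strip_K[OF z, where k = Va and i = i], where k = Vb and i = j]
    by (simp only: funpow_strip_x_mul vpart_mul gens_K vpart_gens add_0_left)
  finally show "pairing (Suc i) j (a \<star> z) = scl (of_nat (Suc i)) (x \<star> pairing i j z)" .
qed

lemma pairing_b_mul:
  assumes z: "z \<in> K"
  shows "pairing 0 0 (b \<star> z) = 0"
    and "pairing 0 (Suc j) (b \<star> z) = scl (of_nat (Suc j)) (x \<star> pairing 0 j z)"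
proof -
  show "pairing 0 0 (b \<star> z) = 0"
    unfolding pairing_def using z by (simp add: vpart_mul mul_simps)
  have "vpart (b \<star> (strip Vb ^^ Suc j) z) = 0"
    using funpow_strip_K[OF z, where k = Vb and i = "Suc j"] by (simp only: vpart_mul gens_K vpart_gens mul_simps)
  then show "pairing 0 (Suc j) (b \<star> z) = scl (of_nat (Suc j)) (x \<star> pairing 0 j z)"
    unfolding pairing_def funpow_0 funpow_strip_Vb_b_mul[OF z]
    using funpow_strip_K[OF z, where k = Vb and i = j]
    by (simp only: ops_simps vpart_mul gens_K vpart_gens add_0_left)
qed

lemma pairing_bp:
  "pairing i j (bp m) = (if i = 0 \<and> j = m then scl (of_nat (fact m)) (pow x m u) else 0)"
proof (cases i)
  case 0
  have "pairing 0 j (bp m) = (if j = m then scl (of_nat (fact m)) (pow x m u) else 0)"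
  proof (induction m arbitrary: j)
    case 0
    show ?case
    proof (cases j)
      case (Suc j')
      have "(strip Vb ^^ Suc j') u = 0"
        by (simp only: funpow_Suc_right o_apply strip_gens lin_zero[OF lin_funpow[OF lin_ops(1)]])
      then show ?thesis by (simp only: Suc pairing_def pow_0 funpow_0 ops_zero) simp
    qed (simp add: pairing_def)
  next
    case (Suc m)
    show ?case
    proof (cases j)
      case 0 then show ?thesis by (simp add: pairing_b_mul[OF bp_K])
    next
      case (Suc j')
      then show ?thesis
        by (simp only: pow_Suc pairing_b_mul[OF bp_K] Suc.IH) (simp add: mul_simps algebra_simps)
    qed
  qed
  then show ?thesis using 0 by simp
next
  case (Suc i')
  have "(strip Va ^^ Suc i') (bp m) = 0"
    by (simp only: funpow_Suc_right o_apply strip_Va_bp lin_zero[OF lin_funpow[OF lin_ops(1)]])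
  then show ?thesis
    by (simp only: Suc pairing_def lin_zero[OF lin_funpow[OF lin_ops(1)]] ops_zero) simp
qed

text \<open>Every strip that hits a factor leaves a g and multiplies by the current exponent, whence
  g^(k+m) and k! m!.\<close>

lemma pairing_basis:
  "pairing i j (pow a k (bp m)) = (if i = k \<and> j = m then scl (of_nat (fact k * fact m)) (pow x (k + m) u) else 0)"
proof (induction k arbitrary: i)
  case 0 then show ?case by (simp add: pairing_bp)
next
  case (Suc k)
  note K = pow_gens_K(1)[OF bp_K, of k m]
  show ?case
  proof (cases i)
    case 0 then show ?thesis by (simp add: pairing_a_mul[OF K])
  next
    case (Suc i')
    then show ?thesis
      by (simp only: pow_Suc pairing_a_mul[OF K] Suc.IH) (simp add: mul_simps algebra_simps)
  qed
qed

end

section \<open>The presentation\<close>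

context jordan_quiver
begin

section \<open>Evaluation of words in the path algebra\<close>

definition F :: "(generator list \<Rightarrow>\<^sub>0 'k) \<Rightarrow> ('g path \<Rightarrow>\<^sub>0 'k)" where
  "F = free_eval (kQ_mul G g act) u (gen_val G g)"

abbreviation val :: "generator \<Rightarrow> ('g path \<Rightarrow>\<^sub>0 'k)" where "val \<equiv> gen_val G g"

lemma val_simps: "val Xa = a" "val Xb = b" "val Xg = x"
  by (simp_all add: a_def b_def x_def)

lemma val_K: "val s \<in> K"
  by (cases s) (simp_all only: val_simps gens_K)

lemma lin_F [simp]: "lin F"
  by (simp add: F_def free_eval_def)

lemmas F_simps = lin_add[OF lin_F] lin_scl[OF lin_F] lin_diff[OF lin_F]

lemma F_Nil [simp]: "F (bas []) = u" and F_Cons [simp]: "F (bas (s # w)) = val s \<star> F (bas w)"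
  by (simp_all add: F_def free_eval_def)

lemma F_bas_K: "F (bas w) \<in> K"
  by (induction w) (simp_all only: F_Nil F_Cons gens_K mul_K val_K)

lemma F_K: "F z \<in> K"
  by (rule lin_maps_supp[OF lin_F subspace_supp, of z UNIV]) (simp, rule F_bas_K)

lemma F_append: "F (bas (v @ w)) = F (bas v) \<star> F (bas w)"
  by (induction v)
    (simp_all only: append.simps F_Nil F_Cons unit_mul[OF F_bas_K] mul_assoc[OF val_K F_bas_K F_bas_K])

lemma F_free_mul: "F (free_mul z w) = F z \<star> F w"
  by (rule bilin_eq_on_supp[of z UNIV w UNIV "\<lambda>z w. F (free_mul z w)" "\<lambda>z w. F z \<star> F w"])
    (simp_all add: lin_comp[OF lin_F lin_free_mul(1)] lin_comp[OF lin_F lin_free_mul(2)]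
      lin_comp[OF lin_mul(1) lin_F] lin_comp[OF lin_mul(2) lin_F] F_append)

lemma F_replicate: "F (bas (replicate m s @ w)) = pow (val s) m (F (bas w))"
  by (induction m) simp_all

lemma pow_swap: "pow v i (v \<star> z) = pow v (Suc i) z"
  by (induction i) simp_all

lemma pow_x_mul: "z \<in> K \<Longrightarrow> pow x i z = pow x i u \<star> z"
  by (induction i) (simp_all add: unit_mul mul_assoc)

lemma pow_x: "pow x i u = vert (g [^] i)"
  using pow_vert[OF one_closed, of i] by simp

lemma pow_x_order: "z \<in> K \<Longrightarrow> pow x (order G) z = z"
  by (subst pow_x_mul) (simp_all add: pow_x pow_order_eq_1 unit_mul)

lemma ord_g: "ord g = order G"
  using generate_pow_card[OF g] carrier_generated by (simp add: order_def)

lemma pow_g_inj: "c < order G \<Longrightarrow> c' < order G \<Longrightarrow> g [^] c = g [^] c' \<longleftrightarrow> c = c'"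
  using inj_onD[OF ord_inj[OF g], of c c'] by (auto simp: ord_g)

lemma subspace_range_F: "vs.subspace (range F)"
proof (rule vs.subspaceI)
  show "0 \<in> range F" by (rule image_eqI[of _ _ 0]) (simp_all add: lin_zero[OF lin_F])
  fix z w assume "z \<in> range F" "w \<in> range F"
  then obtain z' w' where "z = F z'" "w = F w'" by blast
  then show "z + w \<in> range F" by (intro image_eqI[of _ _ "z' + w'"]) (simp_all add: F_simps)
next
  fix c z assume "z \<in> range F"
  then obtain z' where "z = F z'" by blast
  then show "scl c z \<in> range F" by (intro image_eqI[of _ _ "scl c z'"]) (simp_all add: F_simps)
qed

lemma subalgebra_range_F: "subalgebra (kQ_mul G g act) u (range F)"
  unfolding subalgebra_def
proof (intro conjI ballI)
  show "u \<in> range F" by (rule image_eqI[of _ _ "bas []"]) simp_all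
  fix z w assume "z \<in> range F" "w \<in> range F"
  then obtain z' w' where "z = F z'" "w = F w'" by blast
  then show "z \<star> w \<in> range F" by (intro image_eqI[of _ _ "free_mul z' w'"]) (simp_all add: F_free_mul)
qed (rule subspace_range_F)

lemma val_in_range_F: "val s \<in> range F"
proof -
  have "val s = F (bas [s])" using mul_unit[OF val_K] by simp
  then show ?thesis by (rule image_eqI) simp
qed

lemma vert_in_range_F:
  assumes "h \<in> carrier G" shows "vert h \<in> range F"
proof -
  obtain k :: nat where k: "h = g [^] k" by (rule carrier_cases[OF assms])
  have "vert h = F (bas (replicate k Xg @ []))"
    unfolding F_replicate val_simps F_Nil pow_x k ..
  then show ?thesis by (rule image_eqI) simp
qed

lemma range_F_subset:
  assumes A: "subalgebra (kQ_mul G g act) u A" and "\<And>s. val s \<in> A"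
  shows "range F \<subseteq> A"
proof -
  have "F (bas w) \<in> A" for w
    using A assms(2) by (induction w) (auto simp: subalgebra_def)
  then have "F z \<in> A" for z
    using A by (intro lin_maps_supp[OF lin_F _, of A z UNIV]) (auto simp: subalgebra_def)
  then show ?thesis by blast
qed

text \<open>Serves both for {a, b, g} and for V together with G: it only matters that
  \<open>X\<close> and the three generators yield each other.\<close>

lemma generated_eq_range_F:
  assumes "X \<subseteq> range F"
    and "\<And>A s. subalgebra (kQ_mul G g act) u A \<Longrightarrow> X \<subseteq> A \<Longrightarrow> val s \<in> A"
  shows "generated_subalgebra G g act X = range F"
  unfolding generated_subalgebra_def
proof (rule hull_unique)
  show "range F \<subseteq> kQ G g \<and> subalgebra (kQ_mul G g act) u (range F)"
    using F_K subalgebra_range_F by (auto simp: kQ_def)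
  show "range F \<subseteq> A" if "X \<subseteq> A" "A \<subseteq> kQ G g \<and> subalgebra (kQ_mul G g act) u A" for A
    using that assms(2) by (intro range_F_subset) auto
qed (rule assms(1))

lemma generators_in_range_F: "a \<in> range F" "b \<in> range F" "x \<in> range F"
  using val_in_range_F[of Xa] val_in_range_F[of Xb] val_in_range_F[of Xg] by (simp_all only: val_simps)

lemma generated_by_gens: "generated_subalgebra G g act {a, b, x} = range F"
proof (rule generated_eq_range_F)
  show "{a, b, x} \<subseteq> range F" using generators_in_range_F by blast
  show "val s \<in> A" if "{a, b, x} \<subseteq> A" for A s
    using that by (cases s) (simp_all only: val_simps insert_subset)
qed

lemma radford_eq: "radford_biproduct G g act = range F"
  unfolding radford_biproduct_def
proof (rule generated_eq_range_F)
  have V: "V_in_kQ G = vs.span {a, b}" by (simp add: V_in_kQ_def a_def b_def)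
  have "vs.span {a, b} \<subseteq> range F"
    using generators_in_range_F by (intro vs.span_minimal subspace_range_F) blast
  then show "V_in_kQ G \<union> vert ` carrier G \<subseteq> range F"
    using vert_in_range_F V by blast
  show "val s \<in> A" if A: "V_in_kQ G \<union> vert ` carrier G \<subseteq> A" for A s
  proof -
    have "a \<in> V_in_kQ G" "b \<in> V_in_kQ G" "x \<in> vert ` carrier G"
      unfolding V x_def by (auto intro: vs.span_base)
    then show ?thesis using A by (cases s) (auto simp only: val_simps)
  qed
qed

context
  fixes p n :: nat
  assumes char: "CHAR('k) = p" and p: "p > 2" and n: "order G = n" "n > 0"
begin

section \<open>Vanishing of the relators\<close>

lemma two_nonzero: "(2 :: 'k) \<noteq> 0"
proof -
  have "(of_nat 2 :: 'k) \<noteq> 0"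
    unfolding of_nat_eq_0_iff_char_dvd using char p by (auto dest: dvd_imp_le)
  then show ?thesis by simp
qed

text \<open>No factor of i! is divisible by the characteristic.\<close>

lemma of_nat_fact_nonzero: "i < p \<Longrightarrow> (of_nat (fact i) :: 'k) \<noteq> 0"
proof (induction i)
  case (Suc i)
  have "(of_nat (Suc i) :: 'k) \<noteq> 0"
    unfolding of_nat_eq_0_iff_char_dvd char using Suc.prems by (auto dest: dvd_imp_le)
  then show ?case using Suc by (simp only: fact_Suc of_nat_mult mult_eq_0_iff) simp
qed simp

lemma relators_kernel: "r \<in> relators n p \<Longrightarrow> F r = 0"
proof -
  have 1: "F (bas (replicate n Xg)) = u"
    using F_replicate[of n Xg "[]"] pow_x_order[OF gens_K(5)] n
    by (simp only: val_simps F_Nil append_Nil2)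
  have 2: "F (bas (replicate (n - 1) Xg @ Xa # Xg # w)) = F (bas (Xa # w))" for w
  proof -
    have "F (bas (replicate (n - 1) Xg @ Xa # Xg # w)) = pow x (n - 1) (x \<star> (a \<star> F (bas w)))"
      by (simp only: F_replicate F_Cons val_simps a_x_left[OF F_bas_K])
    \<comment> \<open>The letter g, moved in front of a, completes g^(n-1) to g^n = 1.\<close>
    also have "\<dots> = a \<star> F (bas w)"
      using pow_x_order[OF mul_K[OF gens_K(1) F_bas_K]] n by (simp only: pow_swap Suc_diff_1)
    finally show ?thesis by (simp only: F_Cons val_simps)
  qed
  have 3: "F (bas (replicate (n - 1) Xg @ [Xb, Xg])) = F (bas [Xa]) + F (bas [Xb])"
  proof -
    have "F (bas (replicate (n - 1) Xg @ [Xb, Xg])) = pow x (n - 1) (x \<star> (a + b))"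
      by (simp only: F_replicate F_Cons F_Nil val_simps b_x mul_unit gens_K mul_simps)
    also have "\<dots> = a + b"
      using pow_x_order[OF K_add[OF gens_K(1,2)]] n by (simp only: pow_swap Suc_diff_1)
    finally show ?thesis by (simp only: F_Cons F_Nil val_simps mul_unit gens_K)
  qed
  have 4: "F (bas (replicate p Xa)) = 0" "F (bas (replicate p Xb)) = 0"
    using F_replicate[of p Xa "[]"] F_replicate[of p Xb "[]"] ap_char[OF char] bp_char[OF char p] p
    by (simp_all only: val_simps F_Nil append_Nil2)
  have 5: "F (bas [Xb, Xa]) = F (bas [Xa, Xb]) + scl (1/2) (F (bas [Xa, Xa]))"
    using b_a_left[OF two_nonzero gens_K(5)] by (simp only: F_Cons F_Nil val_simps)
  assume "r \<in> relators n p"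
  then show "F r = 0"
    unfolding relators_def using 1 2[of "[]"] 3 4 5
    by (auto simp only: insert_iff empty_iff F_simps F_Nil right_minus_eq diff_self)
qed

lemma two_sided_ideal_kernel: "two_sided_ideal {z. F z = 0}"
  unfolding two_sided_ideal_def
proof (intro conjI)
  show "vs.subspace {z. F z = 0}"
    by (rule vs.subspaceI) (simp_all add: F_simps lin_zero[OF lin_F])
qed (simp add: F_free_mul mul_simps)

lemma hull_subset_kernel: "two_sided_ideal hull relators n p \<subseteq> {z. F z = 0}"
proof (rule hull_minimal)
  show "relators n p \<subseteq> {z. F z = 0}" using relators_kernel by blast
qed (rule two_sided_ideal_kernel)

section \<open>The monomial basis, the dimension and the kernel of evaluation\<close>

abbreviation "idx \<equiv> {..<n} \<times> {..<p} \<times> {..<p}"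

definition basis_elt :: "nat \<times> nat \<times> nat \<Rightarrow> ('g path \<Rightarrow>\<^sub>0 'k)" where
  "basis_elt t = F (bas (normal_word t))"

lemma basis_elt_eq: "basis_elt (c, i, j) = pow x c (pow a i (bp j))"
proof -
  have w: "normal_word (c, i, j) = replicate c Xg @ replicate i Xa @ replicate j Xb @ []"
    by (simp add: normal_word_def)
  show ?thesis
    unfolding basis_elt_def w F_replicate val_simps F_Nil ..
qed

lemma lookup_vert: "Poly_Mapping.lookup (vert h) (h', []) = (if h = h' then 1 else 0)"
  by (simp add: vert_def lookup_bas)

text \<open>The exponent i + j + c rather than c accounts for the powers of g left behind by the
  strips, see \<open>pairing_basis\<close>.\<close>

definition coord :: "nat \<times> nat \<times> nat \<Rightarrow> ('g path \<Rightarrow>\<^sub>0 'k) \<Rightarrow> 'k" where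
  "coord = (\<lambda>(c, i, j) z. Poly_Mapping.lookup (pairing i j z) (g [^] (i + j + c), []))"

lemma coord_basis_elt:
  assumes "t \<in> idx" "t' \<in> idx"
  shows "coord t (basis_elt t') = (if t = t' then of_nat (fact (fst (snd t)) * fact (snd (snd t))) else 0)"
proof -
  obtain c i j c' i' j' where t: "t = (c, i, j)" "t' = (c', i', j')" by (metis surj_pair)
  have K: "pow a i' (bp j') \<in> K" by (intro pow_gens_K bp_K)
  have pw: "pow x c' (pow x m u) = vert (g [^] (m + c'))" for m
    using pow_vert[of "g [^] m" c'] by (simp add: pow_x nat_pow_mult)
  \<comment> \<open>After cancelling g^m, the exponents are compared below the order of g.\<close>
  have "g [^] (m + c') = g [^] (m + c) \<longleftrightarrow> c = c'" for m
    using pow_g_inj[of c c'] assms n by (auto simp: t simp flip: nat_pow_mult)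
  then show ?thesis
    by (auto simp: t coord_def basis_elt_eq pairing_x_pow[OF K] pairing_basis pow_scl pw
        lookup_vert pow_zero)
qed

lemma coord_nonzero: "t \<in> idx \<Longrightarrow> coord t (basis_elt t) \<noteq> 0"
  using of_nat_fact_nonzero by (auto simp: coord_basis_elt)

lemma coord_sum: "coord t (\<Sum>s\<in>A. scl (f s) (h s)) = (\<Sum>s\<in>A. f s * coord t (h s))"
  by (simp add: coord_def case_prod_unfold lin_sum[OF lin_pairing] lin_scl[OF lin_pairing] lookup_sum_pm)

text \<open>Stated for the indexed family, not for its image, so that it also serves combinations of
  words in \<open>kernel_F\<close>.\<close>

lemma basis_independent:
  assumes "(\<Sum>s\<in>idx. scl (f s) (basis_elt s)) = 0" "t \<in> idx" shows "f t = 0"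
proof -
  have "0 = coord t (\<Sum>s\<in>idx. scl (f s) (basis_elt s))"
    unfolding assms(1) by (simp add: coord_def case_prod_unfold lin_zero[OF lin_pairing])
  also have "\<dots> = (\<Sum>s\<in>idx. if s = t then f t * coord t (basis_elt t) else 0)"
    unfolding coord_sum by (intro sum.cong refl) (auto simp: coord_basis_elt assms(2))
  also have "\<dots> = f t * coord t (basis_elt t)" using assms(2) by (simp add: sum.delta)
  finally show ?thesis using coord_nonzero[OF assms(2)] by simp
qed

lemma inj_basis_elt: "inj_on basis_elt idx"
proof (rule inj_onI)
  fix s t assume st: "s \<in> idx" "t \<in> idx" and eq: "basis_elt s = basis_elt t"
  show "s = t"
  proof (rule ccontr)
    assume "s \<noteq> t"
    then have "coord s (basis_elt t) = 0" using st by (simp only: coord_basis_elt if_False)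
    then show False using coord_nonzero[OF st(1)] eq by simp
  qed
qed

lemma independent_basis: "vs.independent (basis_elt ` idx)"
proof
  assume "vs.dependent (basis_elt ` idx)"
  moreover have "finite (basis_elt ` idx)" by simp
  ultimately have "\<exists>f. (\<exists>v\<in>basis_elt ` idx. f v \<noteq> 0) \<and> (\<Sum>v\<in>basis_elt ` idx. scl (f v) v) = 0"
    by (simp only: vs.dependent_finite)
  then obtain f v where v: "v \<in> basis_elt ` idx" "f v \<noteq> 0"
    and s: "(\<Sum>v\<in>basis_elt ` idx. scl (f v) v) = 0" by blast
  from v(1) obtain t where t: "v = basis_elt t" "t \<in> idx" by (rule imageE)
  have "(\<Sum>t\<in>idx. scl (f (basis_elt t)) (basis_elt t)) = 0"
    using s by (simp only: sum.reindex[OF inj_basis_elt] o_def)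
  from basis_independent[OF this t(2)] show False using v(2) t(1) by simp
qed

lemma normal_form: "z \<in> vs.span ((\<lambda>t. bas (normal_word t)) ` idx \<union> (two_sided_ideal hull relators n p))"
  using n(2) p by (intro free_normal_form[OF two_sided_ideal_hull hull_subset]) simp_all

lemma range_F_eq_span: "range F = vs.span (basis_elt ` idx)"
proof
  show "vs.span (basis_elt ` idx) \<subseteq> range F"
    by (intro vs.span_minimal subspace_range_F) (auto simp: basis_elt_def)
  have "F z \<in> vs.span (basis_elt ` idx)" for z
  proof (rule lin_maps_span[OF lin_F vs.subspace_span normal_form[of z]])
    fix e :: "generator list \<Rightarrow>\<^sub>0 'k"
    assume "e \<in> (\<lambda>t. bas (normal_word t)) ` idx \<union> (two_sided_ideal hull relators n p)"
    then consider t where "t \<in> idx" "e = bas (normal_word t)" | "e \<in> two_sided_ideal hull relators n p"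
      by (auto simp only: Un_iff image_iff)
    then show "F e \<in> vs.span (basis_elt ` idx)"
    proof cases
      case 1
      have "basis_elt t \<in> vs.span (basis_elt ` idx)" by (intro vs.span_base imageI 1)
      then show ?thesis by (simp only: basis_elt_def 1(2))
    next
      case 2
      then have "F e = 0" using hull_subset_kernel by blast
      then show ?thesis using vs.span_zero by simp
    qed
  qed
  then show "range F \<subseteq> vs.span (basis_elt ` idx)" by blast
qed

lemma dim_range_F: "vs.dim (range F) = p ^ 2 * n"
  unfolding range_F_eq_span vs.dim_span vs.dim_eq_card_independent[OF independent_basis]
    card_image[OF inj_basis_elt] by (simp add: power2_eq_square)

text \<open>Modulo the ideal every element is a combination of normal words. If it evaluates to
  zero, independence of the values annihilates all coefficients, so only a part in the ideal
  remains.\<close>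

lemma kernel_F: "{z. F z = 0} = two_sided_ideal hull relators n p"
proof (rule antisym)
  show "two_sided_ideal hull relators n p \<subseteq> {z. F z = 0}" by (rule hull_subset_kernel)
  let ?I = "two_sided_ideal hull relators n p :: (generator list \<Rightarrow>\<^sub>0 'k) set"
  let ?B = "(\<lambda>t. bas (normal_word t)) ` idx :: (generator list \<Rightarrow>\<^sub>0 'k) set"
  have I: "vs.subspace ?I" by (rule subspace_I[OF two_sided_ideal_hull hull_subset n(2)]) (use p in simp)
  show "{z. F z = 0} \<subseteq> ?I"
  proof
    fix z assume "z \<in> {z. F z = 0}"
    then have Fz: "F z = 0" by simp
    have "z \<in> {s + r |s r. s \<in> vs.span ?B \<and> r \<in> vs.span ?I}"
      using normal_form[of z] by (simp only: vs.span_Un)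
    then have "z \<in> {s + r |s r. s \<in> vs.span ?B \<and> r \<in> ?I}"
      by (simp only: vs.span_eq_iff[THEN iffD2, OF I])
    then obtain s r where z: "z = s + r" and s: "s \<in> vs.span ?B" and r: "r \<in> ?I" by blast
    from s obtain f where "s = (\<Sum>v\<in>?B. scl (f v) v)"
      by (auto simp: vs.span_finite)
    \<comment> \<open>Distinctness of the normal words is inherited from that of their
      values.\<close>
    moreover have "inj_on (\<lambda>t. bas (normal_word t) :: generator list \<Rightarrow>\<^sub>0 'k) idx"
    proof (rule inj_onI)
      fix t t' assume "t \<in> idx" "t' \<in> idx" "bas (normal_word t) = (bas (normal_word t') :: generator list \<Rightarrow>\<^sub>0 'k)"
      then show "t = t'" using inj_onD[OF inj_basis_elt, of t t'] by (simp only: basis_elt_def)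
    qed
    ultimately have s: "s = (\<Sum>t\<in>idx. scl (f (bas (normal_word t))) (bas (normal_word t)))"
      by (simp only: sum.reindex o_def)
    have "F r = 0" using r hull_subset_kernel by blast
    then have "F s = 0" using Fz z by (simp add: F_simps)
    then have "(\<Sum>t\<in>idx. scl (f (bas (normal_word t))) (basis_elt t)) = 0"
      unfolding s by (simp only: lin_sum[OF lin_F] F_simps basis_elt_def)
    from basis_independent[OF this] have "s = 0" unfolding s by (intro sum.neutral) simp
    then show "z \<in> ?I" using z r by simp
  qed
qed

end

section \<open>The Hopf algebra structure on the biproduct\<close>

lemma range_F_K: "range F \<subseteq> K"
  using F_K by blast

text \<open>Induction over words: the biproduct is spanned by what arises from the unit through left
  multiplication by generators. Properties of products thus need to be shown only with a generator
  on the left.\<close>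

lemma range_F_induct:
  assumes "z \<in> range F" "vs.subspace M" "u \<in> M"
    and "\<And>s z. z \<in> M \<Longrightarrow> z \<in> range F \<Longrightarrow> val s \<star> z \<in> M"
  shows "z \<in> M"
proof -
  have "F (bas w) \<in> M" for w
    using assms(3,4) by (induction w) (simp_all only: F_Nil F_Cons rangeI)
  then have "F z \<in> M" for z
    by (intro lin_maps_supp[OF lin_F assms(2), of z UNIV]) auto
  then show ?thesis using assms(1) by blast
qed

lemma range_F_mul: "z \<in> range F \<Longrightarrow> w \<in> range F \<Longrightarrow> z \<star> w \<in> range F"
  using subalgebra_range_F by (simp only: subalgebra_def)

lemma range_F_units: "u \<in> range F" "y \<in> range F"
  using vert_in_range_F by (simp_all add: y_def)

lemma tmul_range_F:
  assumes "s \<in> tensor_space (range F) (range F)" "t \<in> tensor_space (range F) (range F)"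
  shows "s \<odot> t \<in> tensor_space (range F) (range F)"
proof (rule lin_maps_span[of "\<lambda>s. s \<odot> t", OF lin_tens_mul(2) subspace_tensor_space assms(1)[unfolded tensor_space_def]])
  fix e assume "e \<in> {x \<boxtimes> y |x y. x \<in> range F \<and> y \<in> range F}"
  then obtain v w where e: "e = v \<boxtimes> w" "v \<in> range F" "w \<in> range F" by blast
  show "e \<odot> t \<in> tensor_space (range F) (range F)"
    unfolding e(1) tmul_tens using e(2,3) assms(2)
    by (intro tens_map_tensor_space[OF lin_mul(1) lin_mul(1)]) (auto intro: range_F_mul)
qed

lemma comult_val: "\<Delta> (val s) \<in> tensor_space (range F) (range F)"
  using generators_in_range_F range_F_units
  by (cases s) (simp_all only: val_simps comult_gens, (intro vs.subspace_add[OF subspace_tensor_space]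
      tens_in_tensor_space; assumption)+)

lemma comult_range_F:
  assumes "z \<in> range F" shows "\<Delta> z \<in> tensor_space (range F) (range F)"
proof -
  have "z \<in> {z. \<Delta> z \<in> tensor_space (range F) (range F)}"
    using assms
  proof (rule range_F_induct)
    show "vs.subspace {z. \<Delta> z \<in> tensor_space (range F) (range F)}"
      using subspace_tensor_space[of "range F" "range F"]
      by (intro vs.subspaceI) (auto simp: comult_simps vs.subspace_0 vs.subspace_add vs.subspace_scale)
    show "u \<in> {z. \<Delta> z \<in> tensor_space (range F) (range F)}"
      using tens_in_tensor_space[OF range_F_units(1) range_F_units(1)] by (simp add: comult_u)
    show "val s \<star> z \<in> {z. \<Delta> z \<in> tensor_space (range F) (range F)}"
      if "z \<in> {z. \<Delta> z \<in> tensor_space (range F) (range F)}" "z \<in> range F" for s z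
      using that(1) comult_mul[OF val_K subsetD[OF range_F_K that(2)], of s] tmul_range_F[OF comult_val]
      by simp
  qed
  then show ?thesis by simp
qed

text \<open>It only matters that the right factor stays in the biproduct; it is -g^-1 a, -g^-1 b or
  g^-1.\<close>

lemma S_val_mul:
  assumes "z \<in> K" obtains w where "w \<in> range F" "S (val s \<star> z) = S z \<star> w"
proof (cases s)
  case Xa
  show ?thesis
    using that[of "- (y \<star> a)"] S_primitive_mul[OF assms gens_K(1) comult_gens(2) counit_gens(2)]
      vs.subspace_neg[OF subspace_range_F range_F_mul[OF range_F_units(2) generators_in_range_F(1)]]
    by (simp only: Xa val_simps)
next
  case Xb
  show ?thesis
    using that[of "- (y \<star> b)"] S_primitive_mul[OF assms gens_K(2) comult_gens(3) counit_gens(3)]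
      vs.subspace_neg[OF subspace_range_F range_F_mul[OF range_F_units(2) generators_in_range_F(2)]]
    by (simp only: Xb val_simps)
next
  case Xg
  show ?thesis
    using that[OF range_F_units(2)] S_x_mul[OF assms] by (simp only: Xg val_simps)
qed

lemma S_range_F:
  assumes "z \<in> range F" shows "S z \<in> range F"
proof -
  have "z \<in> {z. S z \<in> range F}"
    using assms
  proof (rule range_F_induct)
    show "vs.subspace {z. S z \<in> range F}"
      using subspace_range_F
      by (intro vs.subspaceI) (simp_all add: lin_zero[OF lin_S] lin_add[OF lin_S] lin_scl[OF lin_S]
          vs.subspace_0 vs.subspace_add vs.subspace_scale del: image_iff)
    show "u \<in> {z. S z \<in> range F}" using range_F_units(1) by (simp add: S_vert)
    show "val s \<star> z \<in> {z. S z \<in> range F}" if z: "z \<in> {z. S z \<in> range F}" "z \<in> range F" for s z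
    proof -
      obtain w where "w \<in> range F" "S (val s \<star> z) = S z \<star> w"
        using S_val_mul[OF subsetD[OF range_F_K z(2)]] by blast
      then show ?thesis using z(1) range_F_mul[of "S z" w] by (simp only: mem_Collect_eq)
    qed
  qed
  then show ?thesis by simp
qed

lemma antipode_right:
  assumes "z \<in> range F" shows "conv_right (\<Delta> z) = scl (kQ_counit z) u"
proof -
  let ?M = "{z. conv_right (\<Delta> z) = scl (kQ_counit z) u}"
  have "z \<in> ?M"
    using assms
  proof (rule range_F_induct)
    show "vs.subspace ?M"
      by (rule vs.subspaceI) (simp_all add: comult_simps lin_zero[OF lin_tens_map] lin_zero[OF lin_mul_map]
          lin_add[OF lin_tens_map] lin_add[OF lin_mul_map] lin_scl[OF lin_tens_map] lin_scl[OF lin_mul_map]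
          counit_simps vs.scale_left_distrib)
    show "u \<in> ?M"
      by (simp add: comult_u tens_map_tens S_vert mul_map_bas unit_mul counit_gens)
    show "val s \<star> z \<in> ?M" if z: "z \<in> ?M" "z \<in> range F" for s z
    proof -
      have z': "conv_right (\<Delta> z) = scl (kQ_counit z) u" and K: "z \<in> K"
        using z range_F_K by auto
      show ?thesis
        using antipode_right_x[OF K z'] antipode_right_primitive[OF K z' gens_K(1) comult_gens(2) counit_gens(2)]
          antipode_right_primitive[OF K z' gens_K(2) comult_gens(3) counit_gens(3)]
        by (cases s) (simp_all only: val_simps mem_Collect_eq)
    qed
  qed
  then show ?thesis by simp
qed

lemma hopf_algebra_range_F:
  "hopf_algebra_on (range F) (kQ_mul G g act) u \<Delta> kQ_counit"
  unfolding hopf_algebra_on_def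
proof (intro conjI)
  note K = subsetD[OF range_F_K]
  show "algebra_on (range F) (kQ_mul G g act) u"
    unfolding algebra_on_def
  proof (intro conjI allI ballI)
    fix z v w assume "z \<in> range F" "v \<in> range F" "w \<in> range F"
    then show "z \<star> v \<star> w = z \<star> (v \<star> w)" by (intro mul_assoc K)
  next
    fix z assume "z \<in> range F"
    then show "u \<star> z = z" "z \<star> u = z" by (intro unit_mul mul_unit K; assumption)+
  qed (rule lin_mul subalgebra_range_F)+
  show "coalgebra_on (range F) \<Delta> kQ_counit"
    unfolding coalgebra_on_def
  proof (intro conjI subspace_range_F lin_comult linear_kQ_counit ballI coassoc counit_left counit_right)
    show "\<Delta> ` range F \<subseteq> tensor_space (range F) (range F)"
      by (rule image_subsetI) (rule comult_range_F)
  qed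
  show "algebra_hom (range F) (kQ_mul G g act) u (tensor_space (range F) (range F)) (tens_mul (kQ_mul G g act))
      (u \<boxtimes> u) \<Delta>"
    unfolding algebra_hom_def
  proof (intro conjI allI ballI)
    show "\<Delta> ` range F \<subseteq> tensor_space (range F) (range F)"
      by (rule image_subsetI) (rule comult_range_F)
    fix z w assume "z \<in> range F" "w \<in> range F"
    then show "\<Delta> (z \<star> w) = \<Delta> z \<odot> \<Delta> w" by (intro comult_mul K)
  qed (rule comult_simps comult_u)+
  show "\<forall>x\<in>range F. \<forall>y\<in>range F. kQ_counit (x \<star> y) = kQ_counit x * kQ_counit y"
    by (intro ballI counit_mul K)
  show "kQ_counit u = 1" by (rule counit_gens)
  show "\<exists>S. lin S \<and> S ` range F \<subseteq> range F \<and>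
      (\<forall>h\<in>range F. mul_map (kQ_mul G g act) (tens_map S id (\<Delta> h)) = scl (kQ_counit h) u \<and>
        mul_map (kQ_mul G g act) (tens_map id S (\<Delta> h)) = scl (kQ_counit h) u)"
  proof (intro exI[of _ S] conjI ballI)
    show "S ` range F \<subseteq> range F"
      by (rule image_subsetI) (rule S_range_F)
    fix h assume h: "h \<in> range F"
    show "conv_left S (\<Delta> h) = scl (kQ_counit h) u" by (rule antipode_left[OF K[OF h]])
    show "conv_right (\<Delta> h) = scl (kQ_counit h) u" by (rule antipode_right[OF h])
  qed (rule lin_S)
qed

lemma comult_unique:
  assumes D: "algebra_hom (range F) (kQ_mul G g act) u (tensor_space (range F) (range F))
      (tens_mul (kQ_mul G g act)) (u \<boxtimes> u) D"
    and gens: "D x = x \<boxtimes> x" "D a = a \<boxtimes> u + x \<boxtimes> a" "D b = b \<boxtimes> u + x \<boxtimes> b"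
    and z: "z \<in> range F"
  shows "D z = \<Delta> z"
proof -
  have val: "D (val s) = \<Delta> (val s)" for s
    by (cases s) (simp_all only: val_simps gens comult_gens)
  have add: "D (z + w) = D z + D w" and mul: "D (z \<star> w) = D z \<odot> D w"
    if "z \<in> range F" "w \<in> range F" for z w
    using D that by (simp_all only: algebra_hom_def)
  have scl: "D (scl c z) = scl c (D z)" if "z \<in> range F" for c z
    using D that by (simp only: algebra_hom_def)
  \<comment> \<open>\<open>D\<close> is known to be linear only on the biproduct, so this is
    obtained from the scalar \<open>0\<close> there.\<close>
  have zero: "D 0 = 0"
    using scl[OF vs.subspace_0[OF subspace_range_F], of 0] by simp
  let ?M = "{z. z \<in> range F \<and> D z = \<Delta> z}"
  have "z \<in> ?M"
    using z
  proof (rule range_F_induct)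
    show "vs.subspace ?M"
      using subspace_range_F
      by (intro vs.subspaceI) (simp_all only: mem_Collect_eq zero add scl comult_simps
          vs.subspace_0 vs.subspace_add vs.subspace_scale simp_thms)
    show "u \<in> ?M" using D range_F_units(1) by (simp only: algebra_hom_def mem_Collect_eq comult_u simp_thms)
    show "val s \<star> z \<in> ?M" if "z \<in> ?M" "z \<in> range F" for s z
      using that range_F_mul[OF val_in_range_F that(2), of s] mul[OF val_in_range_F that(2), of s]
        comult_mul[OF val_K subsetD[OF range_F_K that(2)], of s]
      by (simp only: mem_Collect_eq val simp_thms)
  qed
  then show ?thesis by simp
qed

end

theorem corollary3p14:
  fixes G :: "('g, 'm) monoid_scheme" and g :: 'g and n p :: nat
    and act :: "(vbasis \<Rightarrow>\<^sub>0 'k::field) \<Rightarrow> 'g \<Rightarrow> (vbasis \<Rightarrow>\<^sub>0 'k)"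
  assumes "CHAR('k) = p" and "p > 2"
    and "group G" and "g \<in> carrier G" and "carrier G = generate G {g}"
    and "order G = n" and "n > 0" and "p dvd n"
    and "right_module G act"
    and "act (bas Va) g = bas Va" and "act (bas Vb) g = bas Va + bas Vb"
  shows
    "let H = radford_biproduct G g act;
         mul = kQ_mul G g act; pow = kQ_pow G g act; u = vert \<one>\<^bsub>G\<^esub>;
         \<Delta> = kQ_comult G g; \<epsilon> = kQ_counit;
         a = arr \<one>\<^bsub>G\<^esub> Va; b = arr \<one>\<^bsub>G\<^esub> Vb; x = vert g; x_inv = vert (inv\<^bsub>G\<^esub> g)
     in
       hopf_algebra_on H mul u \<Delta> \<epsilon> \<and> pointed H \<Delta> \<and> vs.dim H = p ^ 2 * n \<and>
       H = generated_subalgebra G g act {a, b, x} \<and>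
       mul x x_inv = u \<and> mul x_inv x = u \<and>
       pow x n = u \<and> mul (mul x_inv a) x = a \<and> mul (mul x_inv b) x = a + b \<and>
       pow a p = 0 \<and> pow b p = 0 \<and> mul b a = mul a b + scl (1/2) (pow a 2) \<and>
       presented_by H mul u (gen_val G g) (relators n p) \<and>
       \<Delta> x = x \<boxtimes> x \<and> \<Delta> a = a \<boxtimes> u + x \<boxtimes> a \<and> \<Delta> b = b \<boxtimes> u + x \<boxtimes> b \<and>
       (\<forall>D. algebra_hom H mul u (tensor_space H H) (tens_mul mul) (u \<boxtimes> u) D \<and>
            D x = x \<boxtimes> x \<and> D a = a \<boxtimes> u + x \<boxtimes> a \<and> D b = b \<boxtimes> u + x \<boxtimes> b
            \<longrightarrow> (\<forall>h\<in>H. D h = \<Delta> h))"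
proof -
  interpret Q: jordan_quiver G g act
  proof (intro jordan_quiver.intro jordan_quiver_axioms.intro)
    \<comment> \<open>The cardinality of an infinite set is \<open>0\<close>, so
      \<open>n > 0\<close> yields finiteness.\<close>
    show "finite (carrier G)"
      using assms(6,7) by (intro card_ge_0_finite) (simp add: order_def)
  qed (fact assms)+
  note gens = Q.a_def[symmetric] Q.b_def[symmetric] Q.x_def[symmetric] Q.y_def[symmetric]
  note two = Q.two_nonzero[OF assms(1,2,6,7)]
  have pow: "kQ_pow G g act v i = Q.pow v i (vert \<one>\<^bsub>G\<^esub>)" for v i
    by (simp add: kQ_pow_def Q.pow_def)
  have a2: "kQ_pow G g act Q.a 2 = kQ_mul G g act Q.a Q.a"
    using Q.mul_unit[OF Q.gens_K(1)] by (simp add: pow numeral_2_eq_2)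
  \<comment> \<open>With g^-1 g = 1, a relation vg = gw becomes g^-1 v g = w.\<close>
  have y_left: "kQ_mul G g act (kQ_mul G g act Q.y v) Q.x = w"
    if v: "v \<in> Q.K" and w: "w \<in> Q.K" "kQ_mul G g act v Q.x = kQ_mul G g act Q.x w" for v w
    using Q.mul_assoc[OF Q.gens_K(4) v Q.gens_K(3)] Q.mul_assoc[OF Q.gens_K(4,3) w(1)]
    by (simp only: w(2) Q.xy Q.unit_mul[OF w(1)])
  show ?thesis
    unfolding Let_def gens Q.radford_eq
  proof (intro conjI allI impI ballI)
    show "kQ_pow G g act Q.x n = vert \<one>\<^bsub>G\<^esub>"
      using Q.pow_x_order[OF Q.gens_K(5)] assms(6) by (simp add: pow)
    show "kQ_mul G g act (kQ_mul G g act Q.y Q.a) Q.x = Q.a"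
      by (rule y_left[OF Q.gens_K(1,1) Q.a_x])
    show "kQ_mul G g act (kQ_mul G g act Q.y Q.b) Q.x = Q.a + Q.b"
      by (rule y_left[OF Q.gens_K(2) Q.K_add[OF Q.gens_K(1,2)]]) (simp only: Q.b_x Q.mul_simps)
    show "kQ_pow G g act Q.a p = 0" "kQ_pow G g act Q.b p = 0"
      using Q.ap_char[OF assms(1)] Q.bp_char[OF assms(1,2)] assms(2) by (simp_all add: pow)
    show "kQ_mul G g act Q.b Q.a = kQ_mul G g act Q.a Q.b + scl (1/2) (kQ_pow G g act Q.a 2)"
      unfolding a2 by (rule Q.b_a[OF two])
    show "presented_by (range Q.F) (kQ_mul G g act) (vert \<one>\<^bsub>G\<^esub>) (gen_val G g) (relators n p)"
      unfolding presented_by_def Q.F_def[symmetric]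
      using Q.kernel_F[OF assms(1,2,6,7)] by blast
    show "D h = kQ_comult G g h"
      if "algebra_hom (range Q.F) (kQ_mul G g act) (vert \<one>\<^bsub>G\<^esub>) (tensor_space (range Q.F) (range Q.F))
          (tens_mul (kQ_mul G g act)) (vert \<one>\<^bsub>G\<^esub> \<boxtimes> vert \<one>\<^bsub>G\<^esub>) D \<and> D Q.x = Q.x \<boxtimes> Q.x \<and>
          D Q.a = Q.a \<boxtimes> vert \<one>\<^bsub>G\<^esub> + Q.x \<boxtimes> Q.a \<and> D Q.b = Q.b \<boxtimes> vert \<one>\<^bsub>G\<^esub> + Q.x \<boxtimes> Q.b"
        "h \<in> range Q.F" for D h
      using that by (intro Q.comult_unique) blast+
  qed (rule Q.hopf_algebra_range_F pointed_kQ_comult Q.dim_range_F[OF assms(1,2,6,7)]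
      Q.generated_by_gens[symmetric] Q.xy Q.comult_gens)+
qed

end
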